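(* Let $K$ be a field of characteristic zero and let $R$ be an affine $K$-algebra which is an integral domain, with a non-zero derivation $\delta$ such that $R[\theta;\delta]$ is a primitive ring (or equivalently, $R$ is $\delta$-primitive). Then $R[\theta;\delta]$ satisfies $(\diamond)$ if and only if $R$ is $\delta$-simple and the Krull dimension of $R$ is at most $1$.
   Context: An affine $K$-algebra is a finitely generated commutative $K$-algebra. A derivation of $R$ is an additive map $\delta: R\to R$ with $\delta(ab)=\delta(a)b+a\delta(b)$ (it is not required to be $K$-linear). A $\delta$-ideal is an ideal $I$ of $R$ with $\delta(I)\subseteq I$; $R$ is $\delta$-simple if $0$ and $R$ are its only $\delta$-ideals; $R$ is $\delta$-primitive if it has a maximal ideal that contains no non-zero $\delta$-ideal of $R$. The differential operator ring $R[\theta;\delta]$ is the free left $R$-module with basis $1,\theta,\theta^2,\ldots$ with multiplication extending that of $R$ and determined by $\theta a = a\theta+\delta(a)$ for $a\in R$. A ring is primitive if it has a faithful simple left module. A Noetherian ring $S$ satisfies property $(\diamond)$ if every cyclic essential extension of a simple $S$-module is Artinian; modules are left modules. *)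

theory Defs
  imports "HOL-Algebra.UnivPoly" "HOL-Algebra.Generated_Rings" "HOL-Library.Extended_Nat"
begin

section \<open>Left modules over a ring\<close>

text \<open>
  The library locale \<^locale>\<open>module\<close> demands a commutative ring of scalars. The following
  locale has the same axioms over an arbitrary ring; the library's \<^locale>\<open>submodule\<close>
  does not depend on commutativity and is used as it stands.
\<close>

locale left_module = S?: ring S + M?: abelian_group M
  for S :: "('s, 'a) ring_scheme" (structure) and M :: "('s, 'm, 'b) module_scheme" (structure) +
  assumes smult_closed [simp, intro]:
      "\<lbrakk>a \<in> carrier S; x \<in> carrier M\<rbrakk> \<Longrightarrow> a \<odot>\<^bsub>M\<^esub> x \<in> carrier M"
    and smult_l_distr:
      "\<lbrakk>a \<in> carrier S; b \<in> carrier S; x \<in> carrier M\<rbrakk> \<Longrightarrow>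
      (a \<oplus>\<^bsub>S\<^esub> b) \<odot>\<^bsub>M\<^esub> x = a \<odot>\<^bsub>M\<^esub> x \<oplus>\<^bsub>M\<^esub> b \<odot>\<^bsub>M\<^esub> x"
    and smult_r_distr:
      "\<lbrakk>a \<in> carrier S; x \<in> carrier M; y \<in> carrier M\<rbrakk> \<Longrightarrow>
      a \<odot>\<^bsub>M\<^esub> (x \<oplus>\<^bsub>M\<^esub> y) = a \<odot>\<^bsub>M\<^esub> x \<oplus>\<^bsub>M\<^esub> a \<odot>\<^bsub>M\<^esub> y"
    and smult_assoc:
      "\<lbrakk>a \<in> carrier S; b \<in> carrier S; x \<in> carrier M\<rbrakk> \<Longrightarrow>
      (a \<otimes>\<^bsub>S\<^esub> b) \<odot>\<^bsub>M\<^esub> x = a \<odot>\<^bsub>M\<^esub> (b \<odot>\<^bsub>M\<^esub> x)"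
    and smult_one [simp]: "x \<in> carrier M \<Longrightarrow> \<one>\<^bsub>S\<^esub> \<odot>\<^bsub>M\<^esub> x = x"

definition simple_module :: "('s, 'a) ring_scheme \<Rightarrow> ('s, 'm, 'b) module_scheme \<Rightarrow> bool" where
  "simple_module S M \<longleftrightarrow> left_module S M \<and> carrier M \<noteq> {\<zero>\<^bsub>M\<^esub>} \<and>
     (\<forall>H. submodule H S M \<longrightarrow> H = {\<zero>\<^bsub>M\<^esub>} \<or> H = carrier M)"

definition faithful_module :: "('s, 'a) ring_scheme \<Rightarrow> ('s, 'm, 'b) module_scheme \<Rightarrow> bool" where
  "faithful_module S M \<longleftrightarrow> left_module S M \<and>
     (\<forall>a\<in>carrier S. (\<forall>x\<in>carrier M. a \<odot>\<^bsub>M\<^esub> x = \<zero>\<^bsub>M\<^esub>) \<longrightarrow> a = \<zero>\<^bsub>S\<^esub>)"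

definition cyclic_module :: "('s, 'a) ring_scheme \<Rightarrow> ('s, 'm, 'b) module_scheme \<Rightarrow> bool" where
  "cyclic_module S M \<longleftrightarrow> left_module S M \<and>
     (\<exists>x\<in>carrier M. carrier M = (\<lambda>a. a \<odot>\<^bsub>M\<^esub> x) ` carrier S)"

definition artinian_module :: "('s, 'a) ring_scheme \<Rightarrow> ('s, 'm, 'b) module_scheme \<Rightarrow> bool" where
  "artinian_module S M \<longleftrightarrow> left_module S M \<and>
     (\<forall>H::nat \<Rightarrow> 'm set. (\<forall>n. submodule (H n) S M) \<and> (\<forall>n. H (Suc n) \<subseteq> H n) \<longrightarrow>
        (\<exists>n. \<forall>m\<ge>n. H m = H n))"

definition essential_submodule ::
    "('s, 'a) ring_scheme \<Rightarrow> ('s, 'm, 'b) module_scheme \<Rightarrow> 'm set \<Rightarrow> bool" where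
  "essential_submodule S M N \<longleftrightarrow> submodule N S M \<and>
     (\<forall>H. submodule H S M \<and> H \<noteq> {\<zero>\<^bsub>M\<^esub>} \<longrightarrow> H \<inter> N \<noteq> {\<zero>\<^bsub>M\<^esub>})"

definition essential_ext_of_simple ::
    "('s, 'a) ring_scheme \<Rightarrow> ('s, 'm, 'b) module_scheme \<Rightarrow> bool" where
  "essential_ext_of_simple S M \<longleftrightarrow> left_module S M \<and>
     (\<exists>N. essential_submodule S M N \<and> simple_module S (M\<lparr>carrier := N\<rparr>))"

text \<open>
  Modules below have elements of type \<^typ>\<open>'s set\<close>, the type of the cosets of a left ideal of
  \<open>S\<close>. A definition cannot quantify over types, but this loses nothing: a cyclic module
  (in particular a simple one) is isomorphic to \<open>S/L\<close> for a left ideal \<open>L\<close>. The lemmas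
  \<open>primitive_ringI\<close> and \<open>diamondD\<close> below confirm that any module type could be used instead.
\<close>

definition primitive_ring :: "('s, 'a) ring_scheme \<Rightarrow> bool" where
  "primitive_ring S \<longleftrightarrow> ring S \<and>
     (\<exists>M :: ('s, 's set) module. simple_module S M \<and> faithful_module S M)"

definition diamond :: "('s, 'a) ring_scheme \<Rightarrow> bool" where
  "diamond S \<longleftrightarrow> ring S \<and>
     (\<forall>M :: ('s, 's set) module.
        cyclic_module S M \<and> essential_ext_of_simple S M \<longrightarrow> artinian_module S M)"

section \<open>Differential rings\<close>

definition derivation :: "('r, 'a) ring_scheme \<Rightarrow> ('r \<Rightarrow> 'r) \<Rightarrow> bool" where
  "derivation R \<delta> \<longleftrightarrow> \<delta> \<in> carrier R \<rightarrow> carrier R \<and>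
     (\<forall>a\<in>carrier R. \<forall>b\<in>carrier R. \<delta> (a \<oplus>\<^bsub>R\<^esub> b) = \<delta> a \<oplus>\<^bsub>R\<^esub> \<delta> b) \<and>
     (\<forall>a\<in>carrier R. \<forall>b\<in>carrier R. \<delta> (a \<otimes>\<^bsub>R\<^esub> b) = \<delta> a \<otimes>\<^bsub>R\<^esub> b \<oplus>\<^bsub>R\<^esub> a \<otimes>\<^bsub>R\<^esub> \<delta> b)"

definition delta_ideal :: "('r, 'a) ring_scheme \<Rightarrow> ('r \<Rightarrow> 'r) \<Rightarrow> 'r set \<Rightarrow> bool" where
  "delta_ideal R \<delta> I \<longleftrightarrow> ideal I R \<and> \<delta> ` I \<subseteq> I"

definition delta_simple :: "('r, 'a) ring_scheme \<Rightarrow> ('r \<Rightarrow> 'r) \<Rightarrow> bool" where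
  "delta_simple R \<delta> \<longleftrightarrow> (\<forall>I. delta_ideal R \<delta> I \<longrightarrow> I = {\<zero>\<^bsub>R\<^esub>} \<or> I = carrier R)"

definition delta_primitive :: "('r, 'a) ring_scheme \<Rightarrow> ('r \<Rightarrow> 'r) \<Rightarrow> bool" where
  "delta_primitive R \<delta> \<longleftrightarrow> (\<exists>P. maximalideal P R \<and>
     (\<forall>I. delta_ideal R \<delta> I \<and> I \<subseteq> P \<longrightarrow> I = {\<zero>\<^bsub>R\<^esub>}))"

section \<open>Affine algebras and Krull dimension\<close>

definition affine_algebra :: "('k, 'a) ring_scheme \<Rightarrow> ('k, 'r, 'b) module_scheme \<Rightarrow> bool" where
  "affine_algebra K R \<longleftrightarrow> algebra K R \<and>
     (\<exists>A. finite A \<and> A \<subseteq> carrier R \<and>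
        generate_ring R ((\<lambda>k. k \<odot>\<^bsub>R\<^esub> \<one>\<^bsub>R\<^esub>) ` carrier K \<union> A) = carrier R)"

text \<open>The zero ring, which has no prime ideals, gets dimension \<open>0\<close> here.\<close>

definition krull_dim :: "('r, 'a) ring_scheme \<Rightarrow> enat" where
  "krull_dim R = Sup {enat n | n. \<exists>P :: nat \<Rightarrow> 'r set.
     (\<forall>i\<le>n. primeideal (P i) R) \<and> (\<forall>i<n. P i \<subset> P (Suc i))}"

section \<open>The differential operator ring\<close>

text \<open>
  The sequence \<open>q\<close> with finite support stands for \<open>\<Sum>\<^sub>j q\<^sub>j \<theta>\<^sup>j\<close>, so the underlying left \<open>R\<close>-module is
  that of the library's \<^term>\<open>UP R\<close>. Left multiplication by \<open>\<theta>\<close> sends it to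
  \<open>\<Sum>\<^sub>j q\<^sub>j \<theta>\<^sup>j\<^sup>+\<^sup>1 + \<delta>(q\<^sub>j) \<theta>\<^sup>j\<close>, by \<open>\<theta>a = a\<theta> + \<delta>(a)\<close>, and the product of \<open>\<Sum>\<^sub>i p\<^sub>i \<theta>\<^sup>i\<close> with \<open>q\<close> is
  \<open>\<Sum>\<^sub>i p\<^sub>i (\<theta>\<^sup>i q)\<close>.
\<close>

definition theta_mult :: "('r, 'a) ring_scheme \<Rightarrow> ('r \<Rightarrow> 'r) \<Rightarrow> (nat \<Rightarrow> 'r) \<Rightarrow> (nat \<Rightarrow> 'r)" where
  "theta_mult R \<delta> q = (\<lambda>n. (if n = 0 then \<zero>\<^bsub>R\<^esub> else q (n - 1)) \<oplus>\<^bsub>R\<^esub> \<delta> (q n))"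

definition diff_op_ring :: "('r, 'a) ring_scheme \<Rightarrow> ('r \<Rightarrow> 'r) \<Rightarrow> (nat \<Rightarrow> 'r) ring" where
  "diff_op_ring R \<delta> = \<lparr>carrier = carrier (UP R),
     monoid.mult = (\<lambda>p q n. \<Oplus>\<^bsub>R\<^esub>i\<in>{i. p i \<noteq> \<zero>\<^bsub>R\<^esub>}. p i \<otimes>\<^bsub>R\<^esub> (theta_mult R \<delta> ^^ i) q n),
     one = \<one>\<^bsub>UP R\<^esub>, zero = \<zero>\<^bsub>UP R\<^esub>, add = add (UP R)\<rparr>"

text \<open>
  The facts \<open>diff_op_ring_is_ring\<close>, \<open>R_embeds\<close>, \<open>theta_commutation\<close> and \<open>monom_eq_power\<close> below
  verify the defining properties of \<open>R[\<theta>;\<delta>]\<close>.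
\<close>

locale derivation_ring = ring R for R (structure) +
  fixes \<delta> assumes derivation: "derivation R \<delta>"
begin

abbreviation "S \<equiv> diff_op_ring R \<delta>"
abbreviation "T \<equiv> theta_mult R \<delta>"

lemma up_zero [simp, intro]: "(\<lambda>n. \<zero>) \<in> up R"
  by (auto intro!: mem_upI)

lemma d_closed [simp, intro]: "a \<in> carrier R \<Longrightarrow> \<delta> a \<in> carrier R"
  and d_add: "\<lbrakk>a \<in> carrier R; b \<in> carrier R\<rbrakk> \<Longrightarrow> \<delta> (a \<oplus> b) = \<delta> a \<oplus> \<delta> b"
  and d_mult: "\<lbrakk>a \<in> carrier R; b \<in> carrier R\<rbrakk> \<Longrightarrow> \<delta> (a \<otimes> b) = \<delta> a \<otimes> b \<oplus> a \<otimes> \<delta> b"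
  using derivation by (auto simp: derivation_def)

lemma d_zero [simp]: "\<delta> \<zero> = \<zero>"
  using d_add[of \<zero> \<zero>] add.r_cancel_one'[of "\<delta> \<zero>"] by simp

lemma d_one [simp]: "\<delta> \<one> = \<zero>"
  using d_mult[of \<one> \<one>] add.r_cancel_one'[of "\<delta> \<one>"] by simp

lemma upE:
  assumes "q \<in> up R"
  obtains N where "\<forall>n>N. q n = \<zero>"
  using bound_upD[OF assms] by blast

lemma upI: "\<lbrakk>\<And>n. q n \<in> carrier R; \<And>n. N < n \<Longrightarrow> q n = \<zero>\<rbrakk> \<Longrightarrow> q \<in> up R"
  by (intro mem_upI exI[of _ N] bound.intro)

lemma T_bound: "\<lbrakk>q \<in> up R; \<forall>n>N. q n = \<zero>; Suc N < n\<rbrakk> \<Longrightarrow> T q n = \<zero>"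
  by (cases n) (auto simp: theta_mult_def)

lemma T_closed [simp, intro]: "q \<in> up R \<Longrightarrow> T q \<in> up R"
proof -
  assume q: "q \<in> up R"
  then obtain N where "\<forall>n>N. q n = \<zero>" using upE by blast
  with q T_bound show ?thesis
    by (intro upI[of _ "Suc N"]) (auto simp: theta_mult_def intro: mem_upD)
qed

lemma Tn_closed [simp, intro]: "q \<in> up R \<Longrightarrow> (T ^^ i) q \<in> up R"
  by (induction i) auto

lemma Tn_car [simp, intro]: "q \<in> up R \<Longrightarrow> (T ^^ i) q n \<in> carrier R"
  by (rule mem_upD) auto

lemma Tn_bound:
  "\<lbrakk>q \<in> up R; \<forall>n>N. q n = \<zero>; N + i < n\<rbrakk> \<Longrightarrow> (T ^^ i) q n = \<zero>"
proof (induction i arbitrary: n)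
  case (Suc i)
  show ?case
    using T_bound[of "(T ^^ i) q" "N + i" n] Suc by simp
qed simp

lemma T_add:
  "\<lbrakk>p \<in> up R; q \<in> up R\<rbrakk> \<Longrightarrow> T (\<lambda>i. p i \<oplus> q i) = (\<lambda>i. T p i \<oplus> T q i)"
  by (rule ext) (simp add: theta_mult_def mem_upD d_add a_ac)

lemma Tn_add:
  "\<lbrakk>p \<in> up R; q \<in> up R\<rbrakk> \<Longrightarrow> (T ^^ i) (\<lambda>i. p i \<oplus> q i) = (\<lambda>n. (T ^^ i) p n \<oplus> (T ^^ i) q n)"
  by (induction i) (simp_all add: T_add)

lemma T_smult:
  "\<lbrakk>a \<in> carrier R; q \<in> up R\<rbrakk> \<Longrightarrow> T (\<lambda>i. a \<otimes> q i) = (\<lambda>n. a \<otimes> T q n \<oplus> \<delta> a \<otimes> q n)"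
  by (rule ext) (simp add: theta_mult_def mem_upD d_mult r_distr a_ac)

definition L :: "(nat \<Rightarrow> 'a) \<Rightarrow> (nat \<Rightarrow> 'a) \<Rightarrow> nat \<Rightarrow> 'a" where
  "L p q = (\<lambda>n. \<Oplus>i\<in>{i. p i \<noteq> \<zero>}. p i \<otimes> (T ^^ i) q n)"

lemma L_eq:
  assumes "p \<in> up R" "q \<in> up R" "\<forall>n>N. p n = \<zero>"
  shows "L p q n = (\<Oplus>i\<in>{..N}. p i \<otimes> (T ^^ i) q n)"
  unfolding L_def
proof (rule add.finprod_mono_neutral_cong_left)
  show "{i. p i \<noteq> \<zero>} \<subseteq> {..N}" using assms(3) by (auto simp: not_less[symmetric])
qed (use assms in \<open>auto intro!: m_closed intro: mem_upD\<close>)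

lemma L_fun:
  assumes "p \<in> up R" "q \<in> up R" "\<forall>n>N. p n = \<zero>"
  shows "L p q = (\<lambda>n. \<Oplus>i\<in>{..N}. p i \<otimes> (T ^^ i) q n)"
  using L_eq[OF assms] by (intro ext)

lemma up_finsum:
  "(\<And>i. i \<le> N \<Longrightarrow> f i \<in> up R) \<Longrightarrow> (\<lambda>n. \<Oplus>i\<in>{..N::nat}. f i n) \<in> up R"
proof (induction N)
  case (Suc N)
  then have "(\<lambda>n. f (Suc N) n \<oplus> (\<Oplus>i\<in>{..N}. f i n)) \<in> up R"
    by (intro up_add_closed) auto
  moreover have "(\<Oplus>i\<in>{..Suc N}. f i n) = f (Suc N) n \<oplus> (\<Oplus>i\<in>{..N}. f i n)" for n
    by (rule finsum_Suc) (use Suc.prems in \<open>auto intro: mem_upD\<close>)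
  ultimately show ?case by simp
qed (auto simp: mem_upD)

lemma T_finsum:
  "(\<And>i. i \<le> N \<Longrightarrow> f i \<in> up R) \<Longrightarrow>
    T (\<lambda>n. \<Oplus>i\<in>{..N::nat}. f i n) = (\<lambda>n. \<Oplus>i\<in>{..N}. T (f i) n)"
proof (induction N)
  case (Suc N)
  have "(\<lambda>n. \<Oplus>i\<in>{..Suc N}. f i n) = (\<lambda>n. f (Suc N) n \<oplus> (\<Oplus>i\<in>{..N}. f i n))"
    by (rule ext, rule finsum_Suc) (use Suc.prems in \<open>auto intro: mem_upD\<close>)
  moreover have "(\<Oplus>i\<in>{..Suc N}. T (f i) n) = T (f (Suc N)) n \<oplus> (\<Oplus>i\<in>{..N}. T (f i) n)" for n
    by (rule finsum_Suc) (use Suc.prems in \<open>auto intro: mem_upD\<close>)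
  ultimately show ?case
    using Suc by (simp add: T_add up_finsum)
qed (auto simp: mem_upD)

lemma L_closed:
  assumes "p \<in> up R" "q \<in> up R"
  shows "L p q \<in> up R"
proof -
  obtain N where N: "\<forall>n>N. p n = \<zero>" by (rule upE[OF assms(1)]) blast
  show ?thesis
    unfolding L_fun[OF assms N] using assms
    by (intro up_finsum up_smult_closed) (auto simp: mem_upD)
qed

lemma L_add_left:
  assumes "p \<in> up R" "q \<in> up R" "r \<in> up R"
  shows "L (\<lambda>i. p i \<oplus> q i) r n = L p r n \<oplus> L q r n"
proof -
  obtain N M where N: "\<forall>n>N. p n = \<zero>" and M: "\<forall>n>M. q n = \<zero>"
    using upE assms by metis
  let ?K = "max N M"
  have "L (\<lambda>i. p i \<oplus> q i) r n = (\<Oplus>i\<in>{..?K}. (p i \<oplus> q i) \<otimes> (T ^^ i) r n)"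
    by (rule L_eq) (use assms N M in \<open>auto intro: up_add_closed\<close>)
  also have "\<dots> = (\<Oplus>i\<in>{..?K}. p i \<otimes> (T ^^ i) r n \<oplus> q i \<otimes> (T ^^ i) r n)"
    using assms by (intro finsum_cong') (auto simp: mem_upD l_distr)
  also have "\<dots> = (\<Oplus>i\<in>{..?K}. p i \<otimes> (T ^^ i) r n) \<oplus> (\<Oplus>i\<in>{..?K}. q i \<otimes> (T ^^ i) r n)"
    using assms by (intro finsum_addf) (auto simp: mem_upD)
  also have "\<dots> = L p r n \<oplus> L q r n"
    using L_eq[of p r ?K n] L_eq[of q r ?K n] assms N M by simp
  finally show ?thesis .
qed

lemma L_add_right:
  assumes "p \<in> up R" "q \<in> up R" "r \<in> up R"
  shows "L p (\<lambda>i. q i \<oplus> r i) n = L p q n \<oplus> L p r n"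
proof -
  obtain N where N: "\<forall>n>N. p n = \<zero>" by (rule upE[OF assms(1)]) blast
  have "L p (\<lambda>i. q i \<oplus> r i) n = (\<Oplus>i\<in>{..N}. p i \<otimes> (T ^^ i) (\<lambda>i. q i \<oplus> r i) n)"
    by (rule L_eq) (use assms N in \<open>auto intro: up_add_closed\<close>)
  also have "\<dots> = (\<Oplus>i\<in>{..N}. p i \<otimes> (T ^^ i) q n \<oplus> p i \<otimes> (T ^^ i) r n)"
    using assms by (intro finsum_cong') (auto simp: mem_upD r_distr Tn_add)
  also have "\<dots> = (\<Oplus>i\<in>{..N}. p i \<otimes> (T ^^ i) q n) \<oplus> (\<Oplus>i\<in>{..N}. p i \<otimes> (T ^^ i) r n)"
    using assms by (intro finsum_addf) (auto simp: mem_upD)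
  also have "\<dots> = L p q n \<oplus> L p r n"
    using L_eq[of p q N n] L_eq[of p r N n] assms N by simp
  finally show ?thesis .
qed

lemma L_smult_left:
  assumes "a \<in> carrier R" "q \<in> up R" "r \<in> up R"
  shows "L (\<lambda>i. a \<otimes> q i) r n = a \<otimes> L q r n"
proof -
  obtain N where N: "\<forall>n>N. q n = \<zero>" by (rule upE[OF assms(2)]) blast
  have "L (\<lambda>i. a \<otimes> q i) r n = (\<Oplus>i\<in>{..N}. (a \<otimes> q i) \<otimes> (T ^^ i) r n)"
    by (rule L_eq) (use assms N in \<open>auto intro: up_smult_closed\<close>)
  also have "\<dots> = (\<Oplus>i\<in>{..N}. a \<otimes> (q i \<otimes> (T ^^ i) r n))"
    using assms by (intro finsum_cong') (auto simp: mem_upD m_assoc)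
  also have "\<dots> = a \<otimes> (\<Oplus>i\<in>{..N}. q i \<otimes> (T ^^ i) r n)"
    using assms by (intro finsum_rdistr[symmetric]) (auto simp: mem_upD)
  finally show ?thesis using L_eq[OF assms(2,3) N] by simp
qed

lemma L_finsum_left:
  assumes "r \<in> up R"
  shows "(\<And>i. i \<le> N \<Longrightarrow> f i \<in> up R) \<Longrightarrow>
    L (\<lambda>n. \<Oplus>i\<in>{..N::nat}. f i n) r = (\<lambda>n. \<Oplus>i\<in>{..N}. L (f i) r n)"
proof (induction N)
  case 0
  have "f 0 n \<in> carrier R" "L (f 0) r n \<in> carrier R" for n
    using 0 L_closed[OF _ assms, of "f 0"] by (auto dest: mem_upD)
  then show ?case by simp
next
  case (Suc N)
  have 1: "(\<lambda>n. \<Oplus>i\<in>{..Suc N}. f i n) = (\<lambda>n. f (Suc N) n \<oplus> (\<Oplus>i\<in>{..N}. f i n))"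
    by (rule ext, rule finsum_Suc) (use Suc.prems in \<open>auto intro: mem_upD\<close>)
  have 2: "(\<Oplus>i\<in>{..Suc N}. L (f i) r n) = L (f (Suc N)) r n \<oplus> (\<Oplus>i\<in>{..N}. L (f i) r n)" for n
    by (rule finsum_Suc) (use Suc.prems L_closed[OF _ assms] in \<open>auto intro!: mem_upD\<close>)
  have "L (\<lambda>n. f (Suc N) n \<oplus> (\<Oplus>i\<in>{..N}. f i n)) r n =
      L (f (Suc N)) r n \<oplus> L (\<lambda>n. \<Oplus>i\<in>{..N}. f i n) r n" for n
    by (rule L_add_left) (use Suc.prems assms up_finsum in auto)
  with 1 2 Suc show ?case by simp
qed

lemma L_T_left:
  assumes "q \<in> up R" "r \<in> up R"
  shows "L (T q) r = T (L q r)"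
proof
  fix n
  obtain N where N: "\<forall>n>N. q n = \<zero>" by (rule upE[OF assms(1)]) blast
  have [simp]: "q i \<in> carrier R" for i using assms by (simp add: mem_upD)
  have [simp]: "T ((T ^^ i) r) m \<in> carrier R" for i m using assms by (simp add: mem_upD)
  let ?f = "\<lambda>i. (if i = 0 then \<zero> else q (i - 1)) \<otimes> (T ^^ i) r n"
  let ?g = "\<lambda>i. \<delta> (q i) \<otimes> (T ^^ i) r n"
  have "T (L q r) n = (\<Oplus>i\<in>{..N}. T (\<lambda>n. q i \<otimes> (T ^^ i) r n) n)"
    unfolding L_fun[OF assms N]
    by (subst T_finsum) (use assms in \<open>auto intro: up_smult_closed\<close>)
  also have "\<dots> = (\<Oplus>i\<in>{..N}. q i \<otimes> (T ^^ Suc i) r n \<oplus> ?g i)"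
    using assms by (intro finsum_cong') (auto simp: T_smult)
  also have "\<dots> = (\<Oplus>i\<in>{..N}. q i \<otimes> (T ^^ Suc i) r n) \<oplus> (\<Oplus>i\<in>{..N}. ?g i)"
    using assms by (intro finsum_addf) auto
  also have "(\<Oplus>i\<in>{..N}. q i \<otimes> (T ^^ Suc i) r n) = (\<Oplus>i\<in>{..Suc N}. ?f i)"
    using assms by (subst finsum_Suc2) (auto simp: mem_upD)
  also have "(\<Oplus>i\<in>{..N}. ?g i) = (\<Oplus>i\<in>{..Suc N}. ?g i)"
    using assms N by (subst finsum_Suc) (auto simp: mem_upD)
  also have "(\<Oplus>i\<in>{..Suc N}. ?f i) \<oplus> (\<Oplus>i\<in>{..Suc N}. ?g i) = (\<Oplus>i\<in>{..Suc N}. ?f i \<oplus> ?g i)"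
    using assms by (intro finsum_addf[symmetric]) auto
  also have "\<dots> = (\<Oplus>i\<in>{..Suc N}. T q i \<otimes> (T ^^ i) r n)"
    using assms by (intro finsum_cong') (auto simp: theta_mult_def l_distr)
  also have "\<dots> = L (T q) r n"
    by (rule L_eq[symmetric]) (use assms T_bound[OF assms(1) N] in auto)
  finally show "L (T q) r n = T (L q r) n" by simp
qed

lemma L_Tn_left:
  assumes "q \<in> up R" "r \<in> up R"
  shows "L ((T ^^ i) q) r = (T ^^ i) (L q r)"
  by (induction i) (use assms L_T_left in auto)

lemma L_assoc:
  assumes "p \<in> up R" "q \<in> up R" "r \<in> up R"
  shows "L (L p q) r = L p (L q r)"
proof
  fix n
  obtain N where N: "\<forall>n>N. p n = \<zero>" by (rule upE[OF assms(1)]) blast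
  have qr: "L q r \<in> up R" using L_closed assms by simp
  have [simp]: "p i \<in> carrier R" for i using assms by (simp add: mem_upD)
  have "L (L p q) r n = L (\<lambda>n. \<Oplus>i\<in>{..N}. p i \<otimes> (T ^^ i) q n) r n"
    by (simp only: L_fun[OF assms(1,2) N])
  also have "\<dots> = (\<Oplus>i\<in>{..N}. L (\<lambda>n. p i \<otimes> (T ^^ i) q n) r n)"
    by (subst L_finsum_left) (use assms in \<open>auto intro: up_smult_closed\<close>)
  also have "\<dots> = (\<Oplus>i\<in>{..N}. p i \<otimes> (T ^^ i) (L q r) n)"
  proof (rule finsum_cong')
    show "(\<lambda>i. p i \<otimes> (T ^^ i) (L q r) n) \<in> {..N} \<rightarrow> carrier R"
      using qr by auto
    show "L (\<lambda>n. p i \<otimes> (T ^^ i) q n) r n = p i \<otimes> (T ^^ i) (L q r) n" for i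
      using L_smult_left[of "p i" "(T ^^ i) q" r n] assms
      by (simp only: L_Tn_left[OF assms(2,3)] Tn_closed mem_upD)
  qed simp
  also have "\<dots> = L p (L q r) n" using L_eq[OF assms(1) qr N] by simp
  finally show "L (L p q) r n = L p (L q r) n" .
qed

lemma Tn_one: "(T ^^ i) (\<lambda>n. if n = 0 then \<one> else \<zero>) = (\<lambda>n. if n = i then \<one> else \<zero>)"
proof (induction i)
  case (Suc i)
  show ?case unfolding funpow.simps o_apply Suc by (rule ext) (auto simp: theta_mult_def)
qed simp

lemma L_one_right:
  assumes "p \<in> up R"
  shows "L p (\<lambda>n. if n = 0 then \<one> else \<zero>) = p"
proof
  fix n
  obtain N where N: "\<forall>n>N. p n = \<zero>" by (rule upE[OF assms]) blast
  have "L p (\<lambda>n. if n = 0 then \<one> else \<zero>) n =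
      (\<Oplus>i\<in>{..max N n}. p i \<otimes> (T ^^ i) (\<lambda>n. if n = 0 then \<one> else \<zero>) n)"
    by (rule L_eq) (use assms N up_one_closed in auto)
  also have "\<dots> = (\<Oplus>i\<in>{..max N n}. if n = i then p i else \<zero>)"
    using assms by (intro finsum_cong') (auto simp: Tn_one mem_upD)
  also have "\<dots> = p n"
    using assms by (subst finsum_singleton) (auto simp: mem_upD)
  finally show "L p (\<lambda>n. if n = 0 then \<one> else \<zero>) n = p n" .
qed

lemma L_one_left:
  assumes "p \<in> up R"
  shows "L (\<lambda>n. if n = 0 then \<one> else \<zero>) p = p"
proof
  fix n
  have "L (\<lambda>n. if n = 0 then \<one> else \<zero>) p n =
      (\<Oplus>i\<in>{..0}. (if i = 0 then \<one> else \<zero>) \<otimes> (T ^^ i) p n)"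
    by (rule L_eq) (use assms up_one_closed in auto)
  then show "L (\<lambda>n. if n = 0 then \<one> else \<zero>) p n = p n" using assms by (simp add: mem_upD)
qed

lemma S_simps:
  "carrier S = up R" "\<one>\<^bsub>S\<^esub> = (\<lambda>n. if n = 0 then \<one> else \<zero>)" "\<zero>\<^bsub>S\<^esub> = (\<lambda>n. \<zero>)"
  "p \<otimes>\<^bsub>S\<^esub> q = L p q"
  "\<lbrakk>p \<in> up R; q \<in> up R\<rbrakk> \<Longrightarrow> p \<oplus>\<^bsub>S\<^esub> q = (\<lambda>n. p n \<oplus> q n)"
  by (simp_all add: diff_op_ring_def UP_def L_def)

theorem diff_op_ring_is_ring: "ring S"
proof (rule ringI)
  show "abelian_group S"
  proof (rule abelian_groupI, goal_cases)
    case (6 x)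
    then show ?case
      by (intro bexI[of _ "\<lambda>n. \<ominus> x n"])
         (auto simp: S_simps up_a_inv_closed l_neg mem_upD)
  qed (auto simp: S_simps up_add_closed a_ac mem_upD)
  show "monoid S"
  proof (rule monoidI, goal_cases)
    case 1
    then show ?case by (simp add: S_simps L_closed)
  next
    case 2
    show ?case by (simp add: S_simps up_one_closed)
  next
    case (3 x y z)
    then show ?case unfolding S_simps by (rule L_assoc)
  next
    case (4 x)
    then show ?case unfolding S_simps by (rule L_one_left)
  next
    case (5 x)
    then show ?case unfolding S_simps by (rule L_one_right)
  qed
next
  fix x y z assume "x \<in> carrier S" "y \<in> carrier S" "z \<in> carrier S"
  then have x: "x \<in> up R" "y \<in> up R" "z \<in> up R" by (simp_all add: S_simps)
  show "(x \<oplus>\<^bsub>S\<^esub> y) \<otimes>\<^bsub>S\<^esub> z = x \<otimes>\<^bsub>S\<^esub> z \<oplus>\<^bsub>S\<^esub> y \<otimes>\<^bsub>S\<^esub> z"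
    by (intro ext, simp only: S_simps(4,5) x L_closed L_add_left)
  show "z \<otimes>\<^bsub>S\<^esub> (x \<oplus>\<^bsub>S\<^esub> y) = z \<otimes>\<^bsub>S\<^esub> x \<oplus>\<^bsub>S\<^esub> z \<otimes>\<^bsub>S\<^esub> y"
    by (intro ext, simp only: S_simps(4,5) x L_closed L_add_right)
qed

lemma monom_simp: "a \<in> carrier R \<Longrightarrow> monom (UP R) a n = (\<lambda>i. if i = n then a else \<zero>)"
  by (simp add: UP_def)

lemma monom_up: "a \<in> carrier R \<Longrightarrow> (\<lambda>i. if i = n then a else \<zero>) \<in> up R"
  by (rule upI[of _ n]) auto

text \<open>\<open>a \<mapsto> monom (UP R) a 0\<close> embeds \<open>R\<close> as a subring, and \<open>\<theta>\<close> is \<open>monom (UP R) \<one> 1\<close>.\<close>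

lemma R_mult:
  assumes "a \<in> carrier R" "p \<in> up R"
  shows "monom (UP R) a 0 \<otimes>\<^bsub>S\<^esub> p = (\<lambda>n. a \<otimes> p n)"
proof -
  have "L (\<lambda>i. if i = 0 then a else \<zero>) p n =
      (\<Oplus>i\<in>{..0}. (if i = 0 then a else \<zero>) \<otimes> (T ^^ i) p n)" for n
    by (rule L_eq) (use assms monom_up in auto)
  then show ?thesis using assms by (auto simp: S_simps monom_simp mem_upD)
qed

theorem R_embeds:
  "(\<lambda>a. monom (UP R) a 0) \<in> ring_hom R S" "inj_on (\<lambda>a. monom (UP R) a 0) (carrier R)"
proof -
  show "(\<lambda>a. monom (UP R) a 0) \<in> ring_hom R S"
  proof (rule ring_hom_memI)
    fix x y assume [simp]: "x \<in> carrier R" "y \<in> carrier R"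
    show "monom (UP R) (x \<otimes> y) 0 = monom (UP R) x 0 \<otimes>\<^bsub>S\<^esub> monom (UP R) y 0"
      by (subst R_mult) (auto simp: monom_simp monom_up)
  qed (auto simp: monom_simp monom_up S_simps(1,2,5))
  show "inj_on (\<lambda>a. monom (UP R) a 0) (carrier R)"
    by (rule inj_onI) (metis monom_simp)
qed

lemma theta_mult_eq:
  assumes "p \<in> up R"
  shows "monom (UP R) \<one> 1 \<otimes>\<^bsub>S\<^esub> p = T p"
proof -
  have *: "monom (UP R) \<one> 1 = T (\<lambda>n. if n = 0 then \<one> else \<zero>)"
    using Tn_one[of 1] by (simp add: monom_simp)
  show ?thesis
    unfolding S_simps(4) * L_T_left[OF up_one_closed assms] L_one_left[OF assms] ..
qed

theorem theta_commutation:
  assumes "a \<in> carrier R"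
  shows "monom (UP R) \<one> 1 \<otimes>\<^bsub>S\<^esub> monom (UP R) a 0 =
    monom (UP R) a 0 \<otimes>\<^bsub>S\<^esub> monom (UP R) \<one> 1 \<oplus>\<^bsub>S\<^esub> monom (UP R) (\<delta> a) 0"
proof -
  have up: "monom (UP R) a 0 \<in> up R" "monom (UP R) \<one> 1 \<in> up R" "monom (UP R) (\<delta> a) 0 \<in> up R"
    using assms by (simp_all add: monom_simp monom_up)
  show ?thesis
    unfolding theta_mult_eq[OF up(1)] R_mult[OF assms up(2)]
      S_simps(5)[OF up_smult_closed[OF assms up(2)] up(3)]
    using assms by (intro ext) (simp add: monom_simp theta_mult_def)
qed

theorem monom_eq_power:
  assumes "a \<in> carrier R"
  shows "monom (UP R) a n = monom (UP R) a 0 \<otimes>\<^bsub>S\<^esub> (monom (UP R) \<one> 1 [^]\<^bsub>S\<^esub> n)"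
proof -
  interpret S: ring S by (rule diff_op_ring_is_ring)
  have th: "monom (UP R) \<one> 1 \<in> carrier S" by (simp add: monom_simp monom_up S_simps)
  have "monom (UP R) \<one> 1 [^]\<^bsub>S\<^esub> n = (T ^^ n) (\<lambda>n. if n = 0 then \<one> else \<zero>)"
  proof (induction n)
    case (Suc n)
    have "monom (UP R) \<one> 1 [^]\<^bsub>S\<^esub> Suc n = monom (UP R) \<one> 1 \<otimes>\<^bsub>S\<^esub> (monom (UP R) \<one> 1 [^]\<^bsub>S\<^esub> n)"
      by (rule S.nat_pow_Suc2[OF th])
    then show ?case using theta_mult_eq[of "(T ^^ n) (\<lambda>n. if n = 0 then \<one> else \<zero>)"] Suc up_one_closed
      by simp
  qed (simp add: S_simps)
  then show ?thesis using assms R_mult[of a "\<lambda>i. if i = n then \<one> else \<zero>"]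
    by (auto simp: Tn_one monom_simp monom_up)
qed

end

section \<open>Independence of the module type\<close>

lemma (in left_module) smult_l_null: "x \<in> carrier M \<Longrightarrow> \<zero>\<^bsub>S\<^esub> \<odot>\<^bsub>M\<^esub> x = \<zero>\<^bsub>M\<^esub>"
  using smult_l_distr[of "\<zero>\<^bsub>S\<^esub>" "\<zero>\<^bsub>S\<^esub>" x] M.add.r_cancel_one'[of "\<zero>\<^bsub>S\<^esub> \<odot>\<^bsub>M\<^esub> x"]
  by simp

lemma (in left_module) submodule_iff:
  "submodule H S M \<longleftrightarrow> H \<subseteq> carrier M \<and> \<zero>\<^bsub>M\<^esub> \<in> H \<and>
    (\<forall>x\<in>H. \<forall>y\<in>H. x \<oplus>\<^bsub>M\<^esub> y \<in> H) \<and> (\<forall>a\<in>carrier S. \<forall>x\<in>H. a \<odot>\<^bsub>M\<^esub> x \<in> H)"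
    (is "_ \<longleftrightarrow> ?R")
proof
  assume "submodule H S M"
  then interpret H: submodule H S M .
  show ?R using H.subset H.one_closed H.m_closed by auto
next
  assume R: ?R
  have neg: "\<ominus>\<^bsub>M\<^esub> x \<in> H" if "x \<in> H" for x
  proof -
    have x: "x \<in> carrier M" using R that by blast
    have "(\<ominus>\<^bsub>S\<^esub> \<one>\<^bsub>S\<^esub>) \<odot>\<^bsub>M\<^esub> x \<oplus>\<^bsub>M\<^esub> x = \<zero>\<^bsub>M\<^esub>"
      using smult_l_distr[of "\<ominus>\<^bsub>S\<^esub> \<one>\<^bsub>S\<^esub>" "\<one>\<^bsub>S\<^esub>" x] x smult_l_null by (simp add: S.l_neg)
    then have "\<ominus>\<^bsub>M\<^esub> x = (\<ominus>\<^bsub>S\<^esub> \<one>\<^bsub>S\<^esub>) \<odot>\<^bsub>M\<^esub> x"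
      using M.minus_equality[OF _ x] x by simp
    then show ?thesis using R that by auto
  qed
  show "submodule H S M"
    using R neg
    by (intro submodule.intro subgroup.intro submodule_axioms.intro) (auto simp: a_inv_def)
qed

lemma (in left_module) submodule_left_module:
  assumes "submodule N S M"
  shows "left_module S (M\<lparr>carrier := N\<rparr>)"
proof -
  interpret N: submodule N S M by fact
  have N: "x \<in> carrier M" if "x \<in> N" for x using that N.subset by auto
  have add: "x \<oplus>\<^bsub>M\<^esub> y \<in> N" if "x \<in> N" "y \<in> N" for x y
    using that N.m_closed by simp
  have "abelian_group (M\<lparr>carrier := N\<rparr>)"
  proof (rule abelian_groupI, goal_cases)
    case (6 x)
    then show ?case
      using N N.m_inv_closed[of x]
      by (intro bexI[of _ "\<ominus>\<^bsub>M\<^esub> x"]) (auto simp: a_inv_def[symmetric] M.l_neg)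
  qed (use N add N.one_closed in \<open>auto simp: M.a_ac\<close>)
  then show ?thesis
    using N N.smult_closed
    by (intro left_module.intro left_module_axioms.intro S.ring_axioms)
       (simp_all add: smult_l_distr smult_r_distr smult_assoc)
qed

lemma (in left_module) simple_submodule_iff:
  assumes "submodule N S M"
  shows "simple_module S (M\<lparr>carrier := N\<rparr>) \<longleftrightarrow> N \<noteq> {\<zero>\<^bsub>M\<^esub>} \<and>
    (\<forall>H. submodule H S M \<and> H \<subseteq> N \<longrightarrow> H = {\<zero>\<^bsub>M\<^esub>} \<or> H = N)"
proof -
  have lm: "left_module S (M\<lparr>carrier := N\<rparr>)" by (rule submodule_left_module[OF assms])
  have "N \<subseteq> carrier M" using assms submodule_iff by simp
  then have "submodule H S (M\<lparr>carrier := N\<rparr>) \<longleftrightarrow> submodule H S M \<and> H \<subseteq> N" for H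
    unfolding left_module.submodule_iff[OF lm] submodule_iff by auto
  then show ?thesis using lm by (simp add: simple_module_def)
qed

definition transport :: "('m \<Rightarrow> 'n) \<Rightarrow> ('s, 'm, 'b) module_scheme \<Rightarrow> ('s, 'n) module" where
  "transport f M = (let g = inv_into (carrier M) f in
     \<lparr>carrier = f ` carrier M, monoid.mult = (\<lambda>x y. x), one = f \<zero>\<^bsub>M\<^esub>, zero = f \<zero>\<^bsub>M\<^esub>,
      add = (\<lambda>x y. f (g x \<oplus>\<^bsub>M\<^esub> g y)), smult = (\<lambda>a x. f (a \<odot>\<^bsub>M\<^esub> g x))\<rparr>)"

locale transport_module = left_module S M
  for S :: "('s, 'a) ring_scheme" (structure) and M :: "('s, 'm, 'b) module_scheme" (structure) +
  fixes f :: "'m \<Rightarrow> 'n"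
  assumes inj: "inj_on f (carrier M)"
begin

abbreviation "N \<equiv> transport f M"

lemma transport_simps:
  "carrier N = f ` carrier M" "\<zero>\<^bsub>N\<^esub> = f \<zero>\<^bsub>M\<^esub>"
  "\<And>x y. \<lbrakk>x \<in> carrier M; y \<in> carrier M\<rbrakk> \<Longrightarrow> f x \<oplus>\<^bsub>N\<^esub> f y = f (x \<oplus>\<^bsub>M\<^esub> y)"
  "\<And>a x. x \<in> carrier M \<Longrightarrow> a \<odot>\<^bsub>N\<^esub> f x = f (a \<odot>\<^bsub>M\<^esub> x)"
  using inj by (simp_all add: transport_def Let_def)

lemma feq: "\<lbrakk>x \<in> carrier M; y \<in> carrier M\<rbrakk> \<Longrightarrow> f x = f y \<longleftrightarrow> x = y"
  using inj by (auto dest: inj_onD)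

lemma transport_left_module: "left_module S N"
proof -
  have "abelian_group N"
  proof (rule abelian_groupI, goal_cases)
    case (6 x)
    then obtain u where "u \<in> carrier M" "x = f u" by (auto simp: transport_simps)
    then show ?case
      by (intro bexI[of _ "f (\<ominus>\<^bsub>M\<^esub> u)"]) (auto simp: transport_simps M.l_neg)
  qed (auto simp: transport_simps M.a_ac)
  then show ?thesis
    by (intro left_module.intro left_module_axioms.intro S.ring_axioms)
       (auto simp: transport_simps smult_l_distr smult_r_distr smult_assoc)
qed

lemma submodule_transport:
  assumes "H \<subseteq> carrier M"
  shows "submodule (f ` H) S N \<longleftrightarrow> submodule H S M"
proof -
  have *: "f x \<in> f ` H \<longleftrightarrow> x \<in> H" if "x \<in> carrier M" for x
    using that assms inj by (simp add: inj_on_image_mem_iff)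
  have "submodule (f ` H) S N \<longleftrightarrow> f ` H \<subseteq> f ` carrier M \<and> f \<zero>\<^bsub>M\<^esub> \<in> f ` H \<and>
     (\<forall>x\<in>H. \<forall>y\<in>H. f (x \<oplus>\<^bsub>M\<^esub> y) \<in> f ` H) \<and> (\<forall>a\<in>carrier S. \<forall>x\<in>H. f (a \<odot>\<^bsub>M\<^esub> x) \<in> f ` H)"
    using assms unfolding left_module.submodule_iff[OF transport_left_module]
    by (auto simp: transport_simps subset_iff)
  also have "\<dots> \<longleftrightarrow> H \<subseteq> carrier M \<and> \<zero>\<^bsub>M\<^esub> \<in> H \<and>
     (\<forall>x\<in>H. \<forall>y\<in>H. x \<oplus>\<^bsub>M\<^esub> y \<in> H) \<and> (\<forall>a\<in>carrier S. \<forall>x\<in>H. a \<odot>\<^bsub>M\<^esub> x \<in> H)"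
    using assms by (intro conj_cong ball_cong refl) (auto simp: * subset_iff)
  also have "\<dots> \<longleftrightarrow> submodule H S M" by (simp only: submodule_iff)
  finally show ?thesis .
qed

lemma submodule_transportE:
  assumes "submodule H S N"
  obtains H' where "H = f ` H'" "H' \<subseteq> carrier M" "submodule H' S M"
proof -
  from assms have "H \<subseteq> f ` carrier M"
    unfolding left_module.submodule_iff[OF transport_left_module] by (simp add: transport_simps)
  then obtain H' where "H = f ` H'" "H' \<subseteq> carrier M" by (auto simp: subset_image_iff)
  with that assms submodule_transport show ?thesis by blast
qed

lemma image_eq: "\<lbrakk>A \<subseteq> carrier M; B \<subseteq> carrier M\<rbrakk> \<Longrightarrow> f ` A = f ` B \<longleftrightarrow> A = B"
  using inj by (simp add: inj_on_image_eq_iff)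

lemma image_eq_zero: "A \<subseteq> carrier M \<Longrightarrow> f ` A = {\<zero>\<^bsub>N\<^esub>} \<longleftrightarrow> A = {\<zero>\<^bsub>M\<^esub>}"
  using image_eq[of A "{\<zero>\<^bsub>M\<^esub>}"] by (simp add: transport_simps)

lemma transport_simple: "simple_module S M \<Longrightarrow> simple_module S N"
  unfolding simple_module_def
proof (elim conjE, intro conjI allI impI transport_left_module)
  assume M: "carrier M \<noteq> {\<zero>\<^bsub>M\<^esub>}" "\<forall>H. submodule H S M \<longrightarrow> H = {\<zero>\<^bsub>M\<^esub>} \<or> H = carrier M"
  show "carrier N \<noteq> {\<zero>\<^bsub>N\<^esub>}" using M(1) image_eq_zero[of "carrier M"] by (simp add: transport_simps(1))
  fix H assume "submodule H S N"
  then obtain H' where "H = f ` H'" "H' \<subseteq> carrier M" "submodule H' S M"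
    using submodule_transportE by blast
  then show "H = {\<zero>\<^bsub>N\<^esub>} \<or> H = carrier N" using M(2) image_eq_zero by (auto simp: transport_simps(1))
qed

lemma transport_faithful: "faithful_module S M \<Longrightarrow> faithful_module S N"
  unfolding faithful_module_def using transport_left_module
  by (auto simp: transport_simps feq)

lemma transport_cyclic: "cyclic_module S M \<Longrightarrow> cyclic_module S N"
  unfolding cyclic_module_def
proof (elim conjE bexE, intro conjI transport_left_module)
  fix x assume x: "x \<in> carrier M" "carrier M = (\<lambda>a. a \<odot>\<^bsub>M\<^esub> x) ` carrier S"
  have "f ` carrier M = f ` (\<lambda>a. a \<odot>\<^bsub>M\<^esub> x) ` carrier S" by (rule arg_cong[OF x(2)])
  then show "\<exists>x\<in>carrier N. carrier N = (\<lambda>a. a \<odot>\<^bsub>N\<^esub> x) ` carrier S"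
    using x(1) imageI[OF x(1), of f]
    by (intro bexI[of _ "f x"]) (simp_all only: transport_simps(1,4) image_image)
qed

lemma transport_artinian: "artinian_module S N \<Longrightarrow> artinian_module S M"
  unfolding artinian_module_def
proof (elim conjE, intro conjI left_module_axioms allI impI)
  fix H :: "nat \<Rightarrow> 'm set"
  assume N: "\<forall>H. (\<forall>n. submodule (H n) S N) \<and> (\<forall>n. H (Suc n) \<subseteq> H n) \<longrightarrow> (\<exists>n. \<forall>m\<ge>n. H m = H n)"
    and H: "(\<forall>n. submodule (H n) S M) \<and> (\<forall>n. H (Suc n) \<subseteq> H n)"
  have sub: "H n \<subseteq> carrier M" for n
    using H submodule_iff[of "H n"] by simp
  have "(\<forall>n. submodule (f ` H n) S N) \<and> (\<forall>n. f ` H (Suc n) \<subseteq> f ` H n)"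
    using H by (simp add: submodule_transport[OF sub] image_mono)
  with spec[OF N, of "\<lambda>n. f ` H n"] have "\<exists>n. \<forall>m\<ge>n. f ` H m = f ` H n"
    by simp
  then show "\<exists>n. \<forall>m\<ge>n. H m = H n" by (simp add: image_eq[OF sub sub])
qed

lemma transport_essential_ext_of_simple:
  assumes "essential_ext_of_simple S M"
  shows "essential_ext_of_simple S N"
proof -
  from assms obtain L where L: "essential_submodule S M L" "simple_module S (M\<lparr>carrier := L\<rparr>)"
    by (auto simp: essential_ext_of_simple_def)
  then have sub: "submodule L S M" and LM: "L \<subseteq> carrier M"
    using submodule_iff by (auto simp: essential_submodule_def)
  have "essential_submodule S N (f ` L)"
    unfolding essential_submodule_def
  proof (intro conjI allI impI)
    show "submodule (f ` L) S N" using sub LM submodule_transport by simp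
    fix H assume H: "submodule H S N \<and> H \<noteq> {\<zero>\<^bsub>N\<^esub>}"
    obtain H' where H': "H = f ` H'" "H' \<subseteq> carrier M" "submodule H' S M"
      using submodule_transportE[OF conjunct1[OF H]] .
    with H have "H' \<inter> L \<noteq> {\<zero>\<^bsub>M\<^esub>}"
      using L(1) image_eq_zero[OF H'(2)] by (simp add: essential_submodule_def)
    moreover have "H \<inter> f ` L = f ` (H' \<inter> L)"
      using H' LM inj by (auto simp: inj_on_image_Int[of f "carrier M"])
    ultimately show "H \<inter> f ` L \<noteq> {\<zero>\<^bsub>N\<^esub>}"
      using image_eq_zero[of "H' \<inter> L"] LM by auto
  qed
  moreover have "simple_module S (N\<lparr>carrier := f ` L\<rparr>)"
  proof -
    have "submodule (f ` L) S N" using sub LM submodule_transport by simp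
    moreover have "f ` L \<noteq> {\<zero>\<^bsub>N\<^esub>}"
      using L(2) image_eq_zero[OF LM] simple_submodule_iff[OF sub] by simp
    moreover have "H = {\<zero>\<^bsub>N\<^esub>} \<or> H = f ` L" if H: "submodule H S N" "H \<subseteq> f ` L" for H
    proof -
      obtain H' where H': "H = f ` H'" "H' \<subseteq> carrier M" "submodule H' S M"
        using submodule_transportE[OF H(1)] .
      have "H' \<subseteq> L"
        using H(2) H'(1,2) LM inj inj_on_image_mem_iff[OF inj _ LM] by blast
      then have "H' = {\<zero>\<^bsub>M\<^esub>} \<or> H' = L"
        using L(2) H'(3) simple_submodule_iff[OF sub] by simp
      then show ?thesis using H' image_eq_zero[OF H'(2)] by auto
    qed
    ultimately show ?thesis
      by (simp add: left_module.simple_submodule_iff[OF transport_left_module])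
  qed
  ultimately show ?thesis
    using transport_left_module unfolding essential_ext_of_simple_def by blast
qed

end

lemma cyclic_transport:
  fixes S :: "('s, 'a) ring_scheme" and M :: "('s, 'm, 'b) module_scheme"
  assumes "cyclic_module S M"
  obtains f :: "'m \<Rightarrow> 's set" where "transport_module S M f"
proof -
  from assms obtain x where x: "left_module S M" "x \<in> carrier M"
    "carrier M = (\<lambda>a. a \<odot>\<^bsub>M\<^esub> x) ` carrier S" unfolding cyclic_module_def by blast
  have "inj_on (\<lambda>y. {a \<in> carrier S. a \<odot>\<^bsub>M\<^esub> x = y}) (carrier M)"
  proof (rule inj_onI)
    fix y z
    assume y: "y \<in> carrier M" and
      eq: "{a \<in> carrier S. a \<odot>\<^bsub>M\<^esub> x = y} = {a \<in> carrier S. a \<odot>\<^bsub>M\<^esub> x = z}"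
    from y obtain a where "a \<in> carrier S" "y = a \<odot>\<^bsub>M\<^esub> x"
      by (subst (asm) x(3)) (erule imageE)
    then have "a \<in> {a \<in> carrier S. a \<odot>\<^bsub>M\<^esub> x = z}" by (subst eq[symmetric]) simp
    then show "y = z" using \<open>y = a \<odot>\<^bsub>M\<^esub> x\<close> by simp
  qed
  then have "transport_module S M (\<lambda>y. {a \<in> carrier S. a \<odot>\<^bsub>M\<^esub> x = y})"
    by (intro transport_module.intro transport_module_axioms.intro x(1))
  then show ?thesis by (rule that)
qed

lemma simple_imp_cyclic:
  assumes "simple_module S M"
  shows "cyclic_module S M"
proof -
  from assms interpret left_module S M by (simp add: simple_module_def)
  have "\<exists>x\<in>carrier M. x \<noteq> \<zero>\<^bsub>M\<^esub>"
  proof (rule ccontr)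
    assume "\<not> (\<exists>x\<in>carrier M. x \<noteq> \<zero>\<^bsub>M\<^esub>)"
    then have "carrier M = {\<zero>\<^bsub>M\<^esub>}" using M.zero_closed by blast
    then show False using assms by (simp add: simple_module_def)
  qed
  then obtain x where x: "x \<in> carrier M" "x \<noteq> \<zero>\<^bsub>M\<^esub>" by blast
  define H where "H = (\<lambda>a. a \<odot>\<^bsub>M\<^esub> x) ` carrier S"
  have H: "a \<odot>\<^bsub>M\<^esub> x \<in> H" if "a \<in> carrier S" for a using that by (simp add: H_def)
  have "submodule H S M"
    unfolding submodule_iff
  proof (intro conjI ballI)
    show "H \<subseteq> carrier M" using x by (auto simp: H_def)
    show "\<zero>\<^bsub>M\<^esub> \<in> H" using H[of "\<zero>\<^bsub>S\<^esub>"] smult_l_null[OF x(1)] by simp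
  next
    fix u v assume "u \<in> H" "v \<in> H"
    then obtain a b where "a \<in> carrier S" "b \<in> carrier S" "u = a \<odot>\<^bsub>M\<^esub> x" "v = b \<odot>\<^bsub>M\<^esub> x"
      unfolding H_def by (elim imageE)
    then show "u \<oplus>\<^bsub>M\<^esub> v \<in> H"
      using smult_l_distr[of a b x] x H[of "a \<oplus>\<^bsub>S\<^esub> b"] by simp
  next
    fix a u assume "a \<in> carrier S" "u \<in> H"
    then obtain b where "b \<in> carrier S" "u = b \<odot>\<^bsub>M\<^esub> x" unfolding H_def by (elim imageE)
    then show "a \<odot>\<^bsub>M\<^esub> u \<in> H"
      using smult_assoc[of a b x] x \<open>a \<in> carrier S\<close> H[of "a \<otimes>\<^bsub>S\<^esub> b"] by simp
  qed
  moreover have "x \<in> H" using H[of "\<one>\<^bsub>S\<^esub>"] x by simp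
  moreover have "H \<noteq> {\<zero>\<^bsub>M\<^esub>}" using x \<open>x \<in> H\<close> by auto
  ultimately have "carrier M = H" using assms unfolding simple_module_def by blast
  then show ?thesis
    using x(1) left_module_axioms unfolding cyclic_module_def H_def by (intro conjI bexI)
qed

lemma primitive_ringI:
  fixes S :: "('s, 'a) ring_scheme" and M :: "('s, 'm, 'b) module_scheme"
  assumes "simple_module S M" "faithful_module S M"
  shows "primitive_ring S"
proof -
  obtain f :: "'m \<Rightarrow> 's set" where "transport_module S M f"
    using cyclic_transport[OF simple_imp_cyclic[OF assms(1)]] .
  then interpret transport_module S M f .
  show ?thesis
    unfolding primitive_ring_def
    by (intro conjI exI[of _ N] transport_simple[OF assms(1)] transport_faithful[OF assms(2)]
        S.ring_axioms)
qed

lemma diamondD: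
  fixes S :: "('s, 'a) ring_scheme" and M :: "('s, 'm, 'b) module_scheme"
  assumes "diamond S" "cyclic_module S M" "essential_ext_of_simple S M"
  shows "artinian_module S M"
proof -
  obtain f :: "'m \<Rightarrow> 's set" where "transport_module S M f" using cyclic_transport[OF assms(2)] .
  then interpret transport_module S M f .
  have "\<forall>M :: ('s, 's set) module.
      cyclic_module S M \<and> essential_ext_of_simple S M \<longrightarrow> artinian_module S M"
    using assms(1) unfolding diamond_def by (rule conjunct2)
  then have "artinian_module S N"
    by (rule allE[of _ N])
      (simp only: transport_cyclic[OF assms(2)] transport_essential_ext_of_simple[OF assms(3)] simp_thms)
  then show ?thesis by (rule transport_artinian)
qed

end

theory Submission
  imports Defs "HOL-Algebra.Ideal_Product"
begin

text \<open>
  Write \<open>S = R[\<theta>;\<delta>]\<close>; every module in question is cyclic, so everything is done with left ideals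
  of \<open>S\<close>. In characteristic zero two commutator arguments control these. A non-zero two-sided
  ideal meets \<open>R\<close> in a non-zero \<open>\<delta>\<close>-ideal; and if \<open>Q\<close> is a prime ideal of \<open>R\<close> that is not a
  \<open>\<delta>\<close>-ideal, then \<open>SQ\<close> is the only left ideal whose intersection with \<open>R\<close> is \<open>Q\<close>.

  Primitivity: \<open>S/SP\<close> is simple and faithful for a maximal ideal \<open>P \<noteq> 0\<close> without non-zero
  \<open>\<delta>\<close>-ideals. Conversely, let \<open>S/L\<close> be simple and faithful. If \<open>L \<inter> R \<noteq> 0\<close>, one may assume that
  \<open>L \<inter> R\<close> is prime, and then \<open>L = SP\<close> with \<open>P\<close> as above. If \<open>L \<inter> R = 0\<close>, there is a non-zero
  \<open>f \<in> R\<close> with a power in each non-zero \<open>\<delta>\<close>-ideal, and \<open>P\<close> is a maximal ideal that avoids \<open>f\<close>.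

  If \<open>R\<close> is \<open>\<delta>\<close>-simple of dimension at most one, then \<open>S/L\<close> is Artinian for each \<open>L \<noteq> 0\<close>: when
  \<open>H \<subseteq> H'\<close> have the same leading coefficients in large order and the same minimal order, \<open>H'/H\<close> is
  killed by a non-zero element of \<open>R\<close>, its annihilator in \<open>R\<close> is a \<open>\<delta>\<close>-ideal, and so \<open>H = H'\<close>.

  If \<open>R\<close> has a proper non-zero \<open>\<delta>\<close>-ideal \<open>J\<close>, then \<open>S/SP\<theta>\<close> is an essential extension of the simple
  module \<open>S\<theta>/SP\<theta>\<close>, and its quotient \<open>S/S\<theta> \<cong> R\<close> has the submodules \<open>J \<supset> J\<^sup>2 \<supset> \<dots>\<close>. If \<open>R\<close> is
  \<open>\<delta>\<close>-simple of dimension at least two, there is a non-maximal prime \<open>Q = (xR : a) \<noteq> 0\<close>; the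
  submodule \<open>S(a/x)\<close> of the fraction field is an essential extension of the simple module \<open>R\<close> with
  quotient \<open>S/SQ\<close>, which is not Artinian.
\<close>

section \<open>Left ideals and cyclic modules\<close>

text \<open>Both commutator arguments rest on one coefficient: if \<open>f\<close> has order
  \<open>n\<close> and leading coefficient \<open>c\<close>, then \<open>f b - b f\<close> has order
  below \<open>n\<close>, and its coefficient at \<open>n - 1\<close> is
  \<open>n c \<delta>(b)\<close>. Here \<open>n\<close> is a unit of \<open>R\<close>, so this is
  non-zero, or outside a given prime ideal, as soon as \<open>c\<close> and
  \<open>\<delta>(b)\<close> are. The obstacle in passing from left ideals of \<open>S\<close> to
  \<open>R\<close> is that leading coefficients cannot be inverted. Divisions are therefore carried
  out up to powers of a leading coefficient, and a maximal ideal avoiding such a coefficient is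
  wanted in the end; the vanishing Jacobson radical of an affine domain provides it. The
  essentiality of \<open>S/SP\<theta>\<close> comes from \<open>t = r\<theta> - \<delta>(r)\<close>:
  since \<open>t r = r^2 \<theta>\<close>, left multiplication by \<open>t\<close> moves an operator
  with constant term \<open>r\<close> into \<open>S\<theta>\<close>. In dimension at least two the
  chain needs a prime that is a colon ideal \<open>(xR : a)\<close>, so that the uniqueness of
  \<open>SQ\<close> applies to the denominators of \<open>a/x\<close>; that \<open>Q\<close> is not
  maximal comes from \<open>Q \<subseteq> Q1 \<subset> M\<close>.\<close>

definition left_ideal :: "('s, 'a) ring_scheme \<Rightarrow> 's set \<Rightarrow> bool" where
  "left_ideal S H \<longleftrightarrow> H \<subseteq> carrier S \<and> \<zero>\<^bsub>S\<^esub> \<in> H \<and> (\<forall>x\<in>H. \<forall>y\<in>H. x \<oplus>\<^bsub>S\<^esub> y \<in> H) \<and>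
     (\<forall>s\<in>carrier S. \<forall>x\<in>H. s \<otimes>\<^bsub>S\<^esub> x \<in> H)"

text \<open>This is the Artinian property of \<open>S/L\<close>, read in the lattice of left ideals
  so that no quotient has to be formed.\<close>

definition dcc_above :: "('s, 'a) ring_scheme \<Rightarrow> 's set \<Rightarrow> bool" where
  "dcc_above S L \<longleftrightarrow> (\<forall>H::nat \<Rightarrow> 's set.
     (\<forall>n. left_ideal S (H n) \<and> L \<subseteq> H n) \<and> (\<forall>n. H (Suc n) \<subseteq> H n) \<longrightarrow> (\<exists>n. \<forall>m\<ge>n. H m = H n))"

definition left_maximal :: "('s, 'a) ring_scheme \<Rightarrow> 's set \<Rightarrow> bool" where
  "left_maximal S L \<longleftrightarrow> left_ideal S L \<and> L \<noteq> carrier S \<and>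
     (\<forall>H. left_ideal S H \<and> L \<subseteq> H \<longrightarrow> H = L \<or> H = carrier S)"

text \<open>The translation of "\<open>N/L\<close> is a simple essential submodule of
  \<open>S/L\<close>": simplicity is the absence of left ideals strictly between, and essentiality
  says that nothing strictly above \<open>L\<close> meets \<open>N\<close> only in
  \<open>L\<close>.\<close>

definition essential_simple_pair :: "('s, 'a) ring_scheme \<Rightarrow> 's set \<Rightarrow> 's set \<Rightarrow> bool" where
  "essential_simple_pair S L N \<longleftrightarrow> left_ideal S L \<and> left_ideal S N \<and> L \<subset> N \<and>
     (\<forall>H. left_ideal S H \<and> L \<subseteq> H \<and> H \<subseteq> N \<longrightarrow> H = L \<or> H = N) \<and>
     (\<forall>H. left_ideal S H \<and> L \<subset> H \<longrightarrow> H \<inter> N \<noteq> L)"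

abbreviation ideal_plus :: "('s, 'a) ring_scheme \<Rightarrow> 's set \<Rightarrow> 's set \<Rightarrow> 's set" where
  "ideal_plus S H I \<equiv> {x \<in> carrier S. \<exists>h\<in>H. \<exists>i\<in>I. x = h \<oplus>\<^bsub>S\<^esub> i}"

abbreviation principal_left :: "('s, 'a) ring_scheme \<Rightarrow> 's \<Rightarrow> 's set" where
  "principal_left S y \<equiv> (\<lambda>s. s \<otimes>\<^bsub>S\<^esub> y) ` carrier S"

lemma left_idealI:
  assumes "H \<subseteq> carrier S" "\<zero>\<^bsub>S\<^esub> \<in> H" "\<And>x y. \<lbrakk>x \<in> H; y \<in> H\<rbrakk> \<Longrightarrow> x \<oplus>\<^bsub>S\<^esub> y \<in> H"
    "\<And>s x. \<lbrakk>s \<in> carrier S; x \<in> H\<rbrakk> \<Longrightarrow> s \<otimes>\<^bsub>S\<^esub> x \<in> H"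
  shows "left_ideal S H"
  using assms by (auto simp: left_ideal_def)

lemma left_idealD:
  assumes "left_ideal S H"
  shows "H \<subseteq> carrier S" "\<And>x. x \<in> H \<Longrightarrow> x \<in> carrier S" "\<zero>\<^bsub>S\<^esub> \<in> H"
    "\<And>x y. \<lbrakk>x \<in> H; y \<in> H\<rbrakk> \<Longrightarrow> x \<oplus>\<^bsub>S\<^esub> y \<in> H"
    "\<And>s x. \<lbrakk>s \<in> carrier S; x \<in> H\<rbrakk> \<Longrightarrow> s \<otimes>\<^bsub>S\<^esub> x \<in> H"
  using assms by (auto simp: left_ideal_def)

context ring
begin

lemma left_ideal_a_inv:
  assumes "left_ideal R H" "x \<in> H"
  shows "\<ominus> x \<in> H"
proof -
  have x: "x \<in> carrier R" using left_idealD[OF assms(1)] assms(2) by blast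
  have "\<ominus> x = (\<ominus> \<one>) \<otimes> x" using x by (simp add: l_minus)
  then show ?thesis using left_idealD(5)[OF assms(1) _ assms(2), of "\<ominus> \<one>"] by simp
qed

lemma left_ideal_minus:
  assumes "left_ideal R H" "x \<in> H" "y \<in> H"
  shows "x \<ominus> y \<in> H"
  using left_idealD(4)[OF assms(1,2) left_ideal_a_inv[OF assms(1,3)]] by (simp add: minus_eq)

lemma left_ideal_diff_cancel:
  assumes "left_ideal R H" "x \<in> carrier R" "y \<in> H" "x \<ominus> y \<in> H"
  shows "x \<in> H"
proof -
  have "y \<in> carrier R" using left_idealD[OF assms(1)] assms(3) by blast
  then have "x = (x \<ominus> y) \<oplus> y" using assms(2) by (simp add: minus_eq a_assoc l_neg)
  then show ?thesis using left_idealD(4)[OF assms(1,4,3)] by simp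
qed

lemma left_ideal_one:
  assumes "left_ideal R H" "\<one> \<in> H"
  shows "H = carrier R"
proof
  show "H \<subseteq> carrier R" using left_idealD(1)[OF assms(1)] .
  show "carrier R \<subseteq> H"
  proof
    fix x assume "x \<in> carrier R"
    then show "x \<in> H" using left_idealD(5)[OF assms(1) _ assms(2), of x] by simp
  qed
qed

lemma left_ideal_zero: "left_ideal R {\<zero>}"
  by (rule left_idealI) auto

lemma left_ideal_carrier: "left_ideal R (carrier R)"
  by (rule left_idealI) auto

lemma left_ideal_sum:
  assumes "left_ideal R H" "left_ideal R I"
  shows "left_ideal R (ideal_plus R H I)" (is "left_ideal R ?K")
proof (rule left_idealI)
  note H = left_idealD[OF assms(1)] and I = left_idealD[OF assms(2)]
  show "\<zero> \<in> ?K" using H(3) I(3) by force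
  show "x \<oplus> y \<in> ?K" if xy: "x \<in> ?K" "y \<in> ?K" for x y
  proof -
    obtain h i h' i' where "h \<in> H" "i \<in> I" "h' \<in> H" "i' \<in> I" "x = h \<oplus> i" "y = h' \<oplus> i'"
      using xy by blast
    moreover from this have "x \<oplus> y = (h \<oplus> h') \<oplus> (i \<oplus> i')"
      using H(2) I(2) by (simp add: a_ac)
    ultimately show ?thesis using xy H(4) I(4) by blast
  qed
  show "s \<otimes> x \<in> ?K" if sx: "s \<in> carrier R" "x \<in> ?K" for s x
  proof -
    obtain h i where "h \<in> H" "i \<in> I" "x = h \<oplus> i" using sx by blast
    moreover from this have "s \<otimes> x = (s \<otimes> h) \<oplus> (s \<otimes> i)"
      using H(2) I(2) sx by (simp add: r_distr)
    ultimately show ?thesis using sx H(5) I(5) by blast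
  qed
qed auto

lemma left_ideal_sum_upper:
  assumes "left_ideal R H" "left_ideal R I"
  shows "H \<subseteq> ideal_plus R H I"
    "I \<subseteq> ideal_plus R H I"
proof -
  note H = left_idealD[OF assms(1)] and I = left_idealD[OF assms(2)]
  show "H \<subseteq> ideal_plus R H I"
  proof
    fix x assume "x \<in> H"
    then have "x = x \<oplus> \<zero>" "x \<in> carrier R" using H(2) by simp_all
    then show "x \<in> ideal_plus R H I" using I(3) \<open>x \<in> H\<close> by blast
  qed
  show "I \<subseteq> ideal_plus R H I"
  proof
    fix x assume "x \<in> I"
    then have "x = \<zero> \<oplus> x" "x \<in> carrier R" using I(2) by simp_all
    then show "x \<in> ideal_plus R H I" using H(3) \<open>x \<in> I\<close> by blast
  qed
qed

lemma left_ideal_colon: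
  assumes "left_ideal R H" "y \<in> carrier R"
  shows "left_ideal R {s \<in> carrier R. s \<otimes> y \<in> H}"
  by (rule left_idealI) (use left_idealD[OF assms(1)] assms(2) in \<open>auto simp: l_distr m_assoc\<close>)

lemma left_ideal_right_mult:
  assumes "left_ideal R H" "y \<in> carrier R"
  shows "left_ideal R ((\<lambda>h. h \<otimes> y) ` H)"
proof (rule left_idealI)
  note H = left_idealD[OF assms(1)]
  show "(\<lambda>h. h \<otimes> y) ` H \<subseteq> carrier R" using H(2) assms(2) by auto
  show "\<zero> \<in> (\<lambda>h. h \<otimes> y) ` H" using H(3) assms(2) by (intro image_eqI[of _ _ \<zero>]) auto
  fix x assume x: "x \<in> (\<lambda>h. h \<otimes> y) ` H"
  then obtain h where h: "h \<in> H" "x = h \<otimes> y" by blast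
  show "x \<oplus> x' \<in> (\<lambda>h. h \<otimes> y) ` H" if "x' \<in> (\<lambda>h. h \<otimes> y) ` H" for x'
  proof -
    obtain h' where h': "h' \<in> H" "x' = h' \<otimes> y" using \<open>x' \<in> _\<close> by blast
    show ?thesis using h h' H(2,4) assms(2)
      by (intro image_eqI[of _ _ "h \<oplus> h'"]) (auto simp: l_distr)
  qed
  show "s \<otimes> x \<in> (\<lambda>h. h \<otimes> y) ` H" if "s \<in> carrier R" for s
    using h H(2,5) assms(2) that by (intro image_eqI[of _ _ "s \<otimes> h"]) (auto simp: m_assoc)
qed

end

section \<open>The quotient module \<open>S/L\<close> and its submodules\<close>

locale left_quotient = ring S for S (structure) +
  fixes L
  assumes L: "left_ideal S L"
begin

definition coset_of :: "'a \<Rightarrow> 'a set" where "coset_of x = {y \<in> carrier S. y \<ominus> x \<in> L}"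

definition rep :: "'a set \<Rightarrow> 'a" where "rep A = (SOME x. x \<in> A)"

text \<open>The operations act on chosen representatives; \<open>quot_simps\<close> removes the
  choice. The fields \<open>monoid.mult\<close> and \<open>one\<close> are part of the record type
  only and are filled arbitrarily.\<close>

definition quot :: "('a, 'a set) module" where
  "quot = \<lparr>carrier = coset_of ` carrier S, monoid.mult = (\<lambda>A B. A), one = L, zero = coset_of \<zero>,
     add = (\<lambda>A B. coset_of (rep A \<oplus> rep B)), smult = (\<lambda>a A. coset_of (a \<otimes> rep A))\<rparr>"

lemma coset_of_eq:
  assumes "x \<in> carrier S" "y \<in> carrier S"
  shows "coset_of x = coset_of y \<longleftrightarrow> x \<ominus> y \<in> L"
proof
  assume "coset_of x = coset_of y"
  moreover have "x \<in> coset_of x" using assms left_idealD(3)[OF L] by (simp add: coset_of_def minus_eq r_neg)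
  ultimately show "x \<ominus> y \<in> L" by (simp add: coset_of_def)
next
  assume *: "x \<ominus> y \<in> L"
  have "z \<ominus> x \<in> L \<longleftrightarrow> z \<ominus> y \<in> L" if z: "z \<in> carrier S" for z
  proof
    assume "z \<ominus> x \<in> L"
    then have "(z \<ominus> x) \<oplus> (x \<ominus> y) \<in> L" using left_idealD(4)[OF L] * by blast
    moreover have "(z \<ominus> x) \<oplus> (x \<ominus> y) = z \<ominus> y" using z assms by algebra
    ultimately show "z \<ominus> y \<in> L" by simp
  next
    assume "z \<ominus> y \<in> L"
    then have "(z \<ominus> y) \<ominus> (x \<ominus> y) \<in> L" using left_ideal_minus[OF L] * by blast
    moreover have "(z \<ominus> y) \<ominus> (x \<ominus> y) = z \<ominus> x" using z assms by algebra
    ultimately show "z \<ominus> x \<in> L" by simp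
  qed
  then show "coset_of x = coset_of y" by (auto simp: coset_of_def)
qed

lemma rep_coset_of:
  assumes "x \<in> carrier S"
  shows "rep (coset_of x) \<in> carrier S" "rep (coset_of x) \<ominus> x \<in> L"
proof -
  have "x \<in> coset_of x" using assms left_idealD(3)[OF L] by (simp add: coset_of_def minus_eq r_neg)
  then have "rep (coset_of x) \<in> coset_of x" unfolding rep_def by (rule someI)
  then show "rep (coset_of x) \<in> carrier S" "rep (coset_of x) \<ominus> x \<in> L" by (auto simp: coset_of_def)
qed

lemma quot_simps:
  "carrier quot = coset_of ` carrier S" "\<zero>\<^bsub>quot\<^esub> = coset_of \<zero>"
  "\<lbrakk>x \<in> carrier S; y \<in> carrier S\<rbrakk> \<Longrightarrow> coset_of x \<oplus>\<^bsub>quot\<^esub> coset_of y = coset_of (x \<oplus> y)"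
  "\<lbrakk>a \<in> carrier S; x \<in> carrier S\<rbrakk> \<Longrightarrow> a \<odot>\<^bsub>quot\<^esub> coset_of x = coset_of (a \<otimes> x)"
proof -
  show "carrier quot = coset_of ` carrier S" "\<zero>\<^bsub>quot\<^esub> = coset_of \<zero>" by (simp_all add: quot_def)
  show "coset_of x \<oplus>\<^bsub>quot\<^esub> coset_of y = coset_of (x \<oplus> y)" if xy: "x \<in> carrier S" "y \<in> carrier S"
  proof -
    note r = rep_coset_of[OF xy(1)] rep_coset_of[OF xy(2)]
    have "(rep (coset_of x) \<oplus> rep (coset_of y)) \<ominus> (x \<oplus> y) = (rep (coset_of x) \<ominus> x) \<oplus> (rep (coset_of y) \<ominus> y)"
      using xy r by algebra
    also have "\<dots> \<in> L" using r left_idealD(4)[OF L] by blast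
    finally show ?thesis using xy r by (simp add: quot_def coset_of_eq)
  qed
  show "a \<odot>\<^bsub>quot\<^esub> coset_of x = coset_of (a \<otimes> x)" if ax: "a \<in> carrier S" "x \<in> carrier S"
  proof -
    note r = rep_coset_of[OF ax(2)]
    have "a \<otimes> rep (coset_of x) \<ominus> a \<otimes> x = a \<otimes> (rep (coset_of x) \<ominus> x)"
      using ax r by algebra
    also have "\<dots> \<in> L" using r ax left_idealD(5)[OF L] by blast
    finally show ?thesis using ax r by (simp add: quot_def coset_of_eq)
  qed
qed

lemma quot_left_module: "left_module S quot"
proof -
  have "abelian_group quot"
  proof (rule abelian_groupI, goal_cases)
    case (6 A)
    then obtain x where "x \<in> carrier S" "A = coset_of x" by (auto simp: quot_simps)
    then show ?case by (intro bexI[of _ "coset_of (\<ominus> x)"]) (auto simp: quot_simps l_neg)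
  qed (auto simp: quot_simps a_ac)
  then show ?thesis
    by (intro left_module.intro left_module_axioms.intro ring_axioms)
       (auto simp: quot_simps l_distr r_distr m_assoc)
qed

sublocale quot: left_module S quot by (rule quot_left_module)

lemma coset_of_zero_iff: "x \<in> carrier S \<Longrightarrow> coset_of x = coset_of \<zero> \<longleftrightarrow> x \<in> L"
  by (simp add: coset_of_eq minus_eq)

lemma coset_of_mem_image:
  assumes "left_ideal S H" "L \<subseteq> H" "x \<in> carrier S"
  shows "coset_of x \<in> coset_of ` H \<longleftrightarrow> x \<in> H"
proof
  assume "coset_of x \<in> coset_of ` H"
  then obtain h where h: "h \<in> H" "coset_of x = coset_of h" by blast
  have "h \<in> carrier S" by (rule left_idealD(2)[OF assms(1) h(1)])
  then have "x \<ominus> h \<in> L" using coset_of_eq[OF assms(3) \<open>h \<in> carrier S\<close>] h(2) by simp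
  then show "x \<in> H" using left_ideal_diff_cancel[OF assms(1,3)] h assms(2) by blast
qed simp

lemma submodule_image:
  assumes "left_ideal S H"
  shows "submodule (coset_of ` H) S quot"
  unfolding quot.submodule_iff using left_idealD[OF assms]
  by (auto simp: quot_simps subset_iff)

text \<open>The correspondence theorem: together with \<open>image_eq_iff\<close> it identifies the
  submodules of \<open>S/L\<close> with the left ideals above \<open>L\<close>.\<close>

lemma submodule_preimage:
  assumes "submodule A S quot"
  obtains H where "left_ideal S H" "L \<subseteq> H" "A = coset_of ` H"
proof
  let ?H = "{x \<in> carrier S. coset_of x \<in> A}"
  have A: "A \<subseteq> coset_of ` carrier S" "coset_of \<zero> \<in> A"
    "\<And>x y. \<lbrakk>x \<in> A; y \<in> A\<rbrakk> \<Longrightarrow> x \<oplus>\<^bsub>quot\<^esub> y \<in> A"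
    "\<And>s x. \<lbrakk>s \<in> carrier S; x \<in> A\<rbrakk> \<Longrightarrow> s \<odot>\<^bsub>quot\<^esub> x \<in> A"
    using assms unfolding quot.submodule_iff by (auto simp: quot_simps)
  show "left_ideal S ?H"
  proof (rule left_idealI)
    show "\<zero> \<in> ?H" using A(2) by simp
    show "x \<oplus> y \<in> ?H" if "x \<in> ?H" "y \<in> ?H" for x y
      using A(3)[of "coset_of x" "coset_of y"] that by (simp add: quot_simps)
    show "s \<otimes> x \<in> ?H" if "s \<in> carrier S" "x \<in> ?H" for s x
      using A(4)[of s "coset_of x"] that by (simp add: quot_simps)
  qed blast
  show "L \<subseteq> ?H"
  proof
    fix y assume "y \<in> L"
    then have "y \<in> carrier S" "coset_of y = coset_of \<zero>" using coset_of_zero_iff left_idealD(2)[OF L] by simp_all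
    then show "y \<in> ?H" using A(2) by simp
  qed
  show "A = coset_of ` ?H" using A(1) by auto
qed

lemma image_subset_iff':
  assumes "left_ideal S H" "L \<subseteq> H" "left_ideal S K" "L \<subseteq> K"
  shows "coset_of ` H \<subseteq> coset_of ` K \<longleftrightarrow> H \<subseteq> K"
proof
  assume sub: "coset_of ` H \<subseteq> coset_of ` K"
  show "H \<subseteq> K"
  proof
    fix t assume t: "t \<in> H"
    then have "coset_of t \<in> coset_of ` K" using sub by blast
    then show "t \<in> K" using coset_of_mem_image[OF assms(3,4) left_idealD(2)[OF assms(1) t]] by simp
  qed
qed blast

lemma image_eq_iff:
  assumes "left_ideal S H" "L \<subseteq> H" "left_ideal S K" "L \<subseteq> K"
  shows "coset_of ` H = coset_of ` K \<longleftrightarrow> H = K"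
  using image_subset_iff'[OF assms] image_subset_iff'[OF assms(3,4,1,2)] by blast

lemma image_L: "coset_of ` L = {\<zero>\<^bsub>quot\<^esub>}"
proof -
  have "coset_of x = coset_of \<zero>" if "x \<in> L" for x using coset_of_zero_iff left_idealD(2)[OF L that] that by simp
  then have "coset_of ` L \<subseteq> {coset_of \<zero>}" by blast
  then show ?thesis using imageI[OF left_idealD(3)[OF L], of coset_of] by (simp add: quot_simps(2)) blast
qed

lemma quot_cyclic: "cyclic_module S quot"
  unfolding cyclic_module_def
proof (intro conjI quot_left_module bexI[of _ "coset_of \<one>"])
  show "carrier quot = (\<lambda>a. a \<odot>\<^bsub>quot\<^esub> coset_of \<one>) ` carrier S" by (auto simp: quot_simps)
qed (simp add: quot_simps)

lemma quot_essential_ext: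
  assumes "essential_simple_pair S L N"
  shows "essential_ext_of_simple S quot"
  unfolding essential_ext_of_simple_def
proof (intro conjI quot_left_module exI[of _ "coset_of ` N"])
  have N: "left_ideal S N" "L \<subseteq> N" "L \<noteq> N"
    and simple: "\<And>H. \<lbrakk>left_ideal S H; L \<subseteq> H; H \<subseteq> N\<rbrakk> \<Longrightarrow> H = L \<or> H = N"
    and ess: "\<And>H. \<lbrakk>left_ideal S H; L \<subset> H\<rbrakk> \<Longrightarrow> H \<inter> N \<noteq> L"
    using assms by (auto simp: essential_simple_pair_def)
  have int: "left_ideal S (H \<inter> N)" if "left_ideal S H" for H
    by (rule left_idealI) (use left_idealD[OF that] left_idealD[OF N(1)] in auto)
  show "essential_submodule S quot (coset_of ` N)"
    unfolding essential_submodule_def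
  proof (intro conjI allI impI submodule_image N(1))
    fix A assume A: "submodule A S quot \<and> A \<noteq> {\<zero>\<^bsub>quot\<^esub>}"
    then obtain H where H: "left_ideal S H" "L \<subseteq> H" "A = coset_of ` H" by (auto elim: submodule_preimage)
    then have "L \<subset> H" using A image_L by auto
    then have "H \<inter> N \<noteq> L" using ess H(1) by blast
    then have "coset_of ` (H \<inter> N) \<noteq> {\<zero>\<^bsub>quot\<^esub>}"
      using image_eq_iff[OF int[OF H(1)] _ L] N H image_L by auto
    moreover have "coset_of ` (H \<inter> N) = A \<inter> coset_of ` N"
      using H(3) coset_of_mem_image[OF N(1,2)] left_idealD(1)[OF H(1)] by auto
    ultimately show "A \<inter> coset_of ` N \<noteq> {\<zero>\<^bsub>quot\<^esub>}" by simp
  qed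
  show "simple_module S (quot\<lparr>carrier := coset_of ` N\<rparr>)"
    unfolding quot.simple_submodule_iff[OF submodule_image[OF N(1)]]
  proof (intro conjI allI impI)
    show "coset_of ` N \<noteq> {\<zero>\<^bsub>quot\<^esub>}" using image_eq_iff[OF N(1,2) L] N(3) image_L by auto
    fix A assume A: "submodule A S quot \<and> A \<subseteq> coset_of ` N"
    then obtain H where H: "left_ideal S H" "L \<subseteq> H" "A = coset_of ` H" by (auto elim: submodule_preimage)
    then have "H \<subseteq> N" using image_subset_iff'[OF H(1,2) N(1,2)] A by blast
    then show "A = {\<zero>\<^bsub>quot\<^esub>} \<or> A = coset_of ` N" using simple[OF H(1,2)] H(3) image_L by blast
  qed
qed

lemma quot_artinian_imp:
  assumes "artinian_module S quot"
  shows "dcc_above S L"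
  unfolding dcc_above_def
proof (intro allI impI)
  fix H :: "nat \<Rightarrow> 'a set"
  assume H: "(\<forall>n. left_ideal S (H n) \<and> L \<subseteq> H n) \<and> (\<forall>n. H (Suc n) \<subseteq> H n)"
  then have "\<forall>n. submodule (coset_of ` H n) S quot" "\<forall>n. coset_of ` H (Suc n) \<subseteq> coset_of ` H n"
    using submodule_image by (simp_all add: image_mono)
  then obtain n where n: "\<forall>m\<ge>n. coset_of ` H m = coset_of ` H n"
    using conjunct2[OF assms[unfolded artinian_module_def], rule_format, of "\<lambda>n. coset_of ` H n"]
    by blast
  have "H m = H n" if "m \<ge> n" for m
  proof (rule iffD1[OF image_eq_iff])
    show "coset_of ` H m = coset_of ` H n" by (rule n[rule_format, OF that])
  qed (use H in blast)+
  then show "\<exists>n. \<forall>m\<ge>n. H m = H n" by blast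
qed

lemma quot_simple:
  assumes "left_maximal S L"
  shows "simple_module S quot"
  unfolding simple_module_def
proof (intro conjI allI impI quot_left_module)
  show "carrier quot \<noteq> {\<zero>\<^bsub>quot\<^esub>}"
    using image_eq_iff[OF left_ideal_carrier left_idealD(1)[OF L] L] assms image_L
    by (auto simp: quot_simps left_maximal_def)
  fix A assume "submodule A S quot"
  then obtain H where H: "left_ideal S H" "L \<subseteq> H" "A = coset_of ` H" by (auto elim: submodule_preimage)
  then have "H = L \<or> H = carrier S" using assms unfolding left_maximal_def by blast
  then show "A = {\<zero>\<^bsub>quot\<^esub>} \<or> A = carrier quot"
    using H(3) image_L by (simp add: quot_simps(1)) blast
qed

end

text \<open>The form in which the property is refuted later: it is enough to exhibit a pair of left
  ideals and a descending chain above the smaller one.\<close>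

lemma diamond_imp_dcc_above:
  assumes "diamond S" "essential_simple_pair S L N"
  shows "dcc_above S L"
proof -
  interpret ring S using assms(1) by (simp add: diamond_def)
  interpret left_quotient S L
    using assms(2) by unfold_locales (simp add: essential_simple_pair_def)
  show ?thesis
    by (rule quot_artinian_imp[OF diamondD[OF assms(1) quot_cyclic quot_essential_ext[OF assms(2)]]])
qed

lemma (in left_module) submodule_zero: "submodule {\<zero>\<^bsub>M\<^esub>} S M"
proof -
  have "a \<odot>\<^bsub>M\<^esub> \<zero>\<^bsub>M\<^esub> = \<zero>\<^bsub>M\<^esub>" if "a \<in> carrier S" for a
    using smult_r_distr[OF that, of "\<zero>\<^bsub>M\<^esub>" "\<zero>\<^bsub>M\<^esub>"]
      M.add.r_cancel_one'[of "a \<odot>\<^bsub>M\<^esub> \<zero>\<^bsub>M\<^esub>"] that by simp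
  then show ?thesis by (simp add: submodule_iff)
qed

section \<open>Cyclic modules as quotients by annihilators\<close>

locale module_vector = left_module S M
  for S :: "('s, 'a) ring_scheme" (structure) and M :: "('s, 'm, 'b) module_scheme" (structure) +
  fixes x assumes x: "x \<in> carrier M"
begin

text \<open>The preimage of zero is the annihilator of \<open>x\<close>; this is the left ideal
  \<open>L\<close> with \<open>Sx\<close> isomorphic to \<open>S/L\<close>.\<close>

definition pre :: "'m set \<Rightarrow> 's set" where "pre A = {a \<in> carrier S. a \<odot>\<^bsub>M\<^esub> x \<in> A}"

lemma pre_mono: "A \<subseteq> B \<Longrightarrow> pre A \<subseteq> pre B" by (auto simp: pre_def)

lemma pre_left_ideal: "submodule A S M \<Longrightarrow> left_ideal S (pre A)"
  by (rule left_idealI)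
     (use x smult_l_null in \<open>auto simp: submodule_iff pre_def smult_l_distr smult_assoc\<close>)

lemma image_submodule: "left_ideal S H \<Longrightarrow> submodule ((\<lambda>a. a \<odot>\<^bsub>M\<^esub> x) ` H) S M"
proof -
  assume H: "left_ideal S H"
  note D = left_idealD[OF H]
  have *: "\<And>a. a \<in> H \<Longrightarrow> a \<odot>\<^bsub>M\<^esub> x \<in> (\<lambda>a. a \<odot>\<^bsub>M\<^esub> x) ` H" by blast
  show "submodule ((\<lambda>a. a \<odot>\<^bsub>M\<^esub> x) ` H) S M"
    unfolding submodule_iff
  proof (intro conjI ballI)
    show "(\<lambda>a. a \<odot>\<^bsub>M\<^esub> x) ` H \<subseteq> carrier M" using D(2) x by auto
    show "\<zero>\<^bsub>M\<^esub> \<in> (\<lambda>a. a \<odot>\<^bsub>M\<^esub> x) ` H" using *[OF D(3)] x smult_l_null by simp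
  next
    fix u v assume "u \<in> (\<lambda>a. a \<odot>\<^bsub>M\<^esub> x) ` H" "v \<in> (\<lambda>a. a \<odot>\<^bsub>M\<^esub> x) ` H"
    then obtain a b where "a \<in> H" "b \<in> H" "u = a \<odot>\<^bsub>M\<^esub> x" "v = b \<odot>\<^bsub>M\<^esub> x" by blast
    then show "u \<oplus>\<^bsub>M\<^esub> v \<in> (\<lambda>a. a \<odot>\<^bsub>M\<^esub> x) ` H"
      using *[OF D(4)[of a b]] D(2) x by (simp add: smult_l_distr)
  next
    fix s u assume s: "s \<in> carrier S" and "u \<in> (\<lambda>a. a \<odot>\<^bsub>M\<^esub> x) ` H"
    then obtain a where "a \<in> H" "u = a \<odot>\<^bsub>M\<^esub> x" by blast
    then show "s \<odot>\<^bsub>M\<^esub> u \<in> (\<lambda>a. a \<odot>\<^bsub>M\<^esub> x) ` H"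
      using *[OF D(5)[of s a]] D(2) x s by (simp add: smult_assoc)
  qed
qed

end

locale module_generator = module_vector +
  assumes gen: "carrier M = (\<lambda>a. a \<odot>\<^bsub>M\<^esub> x) ` carrier S"
begin

lemma image_pre: "A \<subseteq> carrier M \<Longrightarrow> (\<lambda>a. a \<odot>\<^bsub>M\<^esub> x) ` pre A = A"
proof -
  assume A: "A \<subseteq> carrier M"
  have "y \<in> (\<lambda>a. a \<odot>\<^bsub>M\<^esub> x) ` pre A" if y: "y \<in> A" for y
  proof -
    have "y \<in> (\<lambda>a. a \<odot>\<^bsub>M\<^esub> x) ` carrier S" using A y gen by blast
    then obtain a where "a \<in> carrier S" "y = a \<odot>\<^bsub>M\<^esub> x" by (elim imageE)
    with y show ?thesis by (auto simp: pre_def)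
  qed
  moreover have "(\<lambda>a. a \<odot>\<^bsub>M\<^esub> x) ` pre A \<subseteq> A" by (auto simp: pre_def)
  ultimately show ?thesis by blast
qed

text \<open>If \<open>a x = h x\<close> with \<open>h \<in> H\<close>, then \<open>a - h\<close>
  annihilates \<open>x\<close> and hence lies in \<open>H\<close>, so \<open>a\<close> does
  too.\<close>

lemma pre_image:
  assumes "left_ideal S H" "pre {\<zero>\<^bsub>M\<^esub>} \<subseteq> H"
  shows "pre ((\<lambda>a. a \<odot>\<^bsub>M\<^esub> x) ` H) = H"
proof
  note D = left_idealD[OF assms(1)]
  show "H \<subseteq> pre ((\<lambda>a. a \<odot>\<^bsub>M\<^esub> x) ` H)" using D(2) by (auto simp: pre_def)
  show "pre ((\<lambda>a. a \<odot>\<^bsub>M\<^esub> x) ` H) \<subseteq> H"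
  proof
    fix a assume "a \<in> pre ((\<lambda>a. a \<odot>\<^bsub>M\<^esub> x) ` H)"
    then obtain h where h: "h \<in> H" "a \<odot>\<^bsub>M\<^esub> x = h \<odot>\<^bsub>M\<^esub> x" and a: "a \<in> carrier S"
      by (auto simp: pre_def)
    have hc: "h \<in> carrier S" using D(2) h by blast
    have "(a \<ominus> h) \<odot>\<^bsub>M\<^esub> x \<oplus>\<^bsub>M\<^esub> h \<odot>\<^bsub>M\<^esub> x = (a \<ominus> h \<oplus> h) \<odot>\<^bsub>M\<^esub> x"
      by (rule smult_l_distr[symmetric]) (use a hc x in auto)
    also have "a \<ominus> h \<oplus> h = a" using a hc by (simp add: S.minus_eq S.a_assoc S.l_neg)
    finally have "(a \<ominus> h) \<odot>\<^bsub>M\<^esub> x \<oplus>\<^bsub>M\<^esub> h \<odot>\<^bsub>M\<^esub> x = h \<odot>\<^bsub>M\<^esub> x" using h(2) by simp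
    then have "(a \<ominus> h) \<odot>\<^bsub>M\<^esub> x = \<zero>\<^bsub>M\<^esub>"
      using a hc x M.add.l_cancel_one[of "h \<odot>\<^bsub>M\<^esub> x" "(a \<ominus> h) \<odot>\<^bsub>M\<^esub> x"] by (simp add: M.a_comm)
    then have "a \<ominus> h \<in> H" using a hc assms(2) by (auto simp: pre_def)
    then show "a \<in> H" using S.left_ideal_diff_cancel[OF assms(1) a h(1)] by blast
  qed
qed

end

lemma simple_module_generator:
  assumes "simple_module S M" "x \<in> carrier M" "x \<noteq> \<zero>\<^bsub>M\<^esub>"
  shows "module_generator S M x"
proof -
  interpret left_module S M using assms(1) by (simp add: simple_module_def)
  interpret module_vector S M x by unfold_locales (rule assms(2))
  have "\<one>\<^bsub>S\<^esub> \<odot>\<^bsub>M\<^esub> x \<in> (\<lambda>a. a \<odot>\<^bsub>M\<^esub> x) ` carrier S" by blast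
  then have "(\<lambda>a. a \<odot>\<^bsub>M\<^esub> x) ` carrier S \<noteq> {\<zero>\<^bsub>M\<^esub>}" using assms(2,3) by auto
  then have "(\<lambda>a. a \<odot>\<^bsub>M\<^esub> x) ` carrier S = carrier M"
    using assms(1) image_submodule[OF S.left_ideal_carrier] unfolding simple_module_def by blast
  then show ?thesis by unfold_locales simp
qed

text \<open>For \<open>M = Sx\<close> with annihilator \<open>L\<close> of \<open>x\<close>, taking
  preimages and images identifies the submodules of \<open>M\<close> with the left ideals above
  \<open>L\<close>. Simplicity, essentiality and chains all transfer along this bijection.\<close>

lemma diamondI:
  fixes S :: "('s, 'a) ring_scheme"
  assumes "ring S" "\<And>L N. essential_simple_pair S L N \<Longrightarrow> dcc_above S L"
  shows "diamond S"
  unfolding diamond_def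
proof (intro conjI assms(1) allI impI)
  fix M :: "('s, 's set) module"
  assume M: "cyclic_module S M \<and> essential_ext_of_simple S M"
  then obtain x where "left_module S M" "x \<in> carrier M" "carrier M = (\<lambda>a. a \<odot>\<^bsub>M\<^esub> x) ` carrier S"
    by (auto simp: cyclic_module_def)
  then interpret module_generator S M x
    by (intro module_generator.intro module_vector.intro module_vector_axioms.intro
        module_generator_axioms.intro)
  obtain N where N: "essential_submodule S M N" "simple_module S (M\<lparr>carrier := N\<rparr>)"
    using M by (auto simp: essential_ext_of_simple_def)
  have subN: "submodule N S M" using N(1) by (simp add: essential_submodule_def)
  note sub0 = submodule_zero
  let ?im = "\<lambda>H. (\<lambda>a. a \<odot>\<^bsub>M\<^esub> x) ` H"
  have N0: "N \<noteq> {\<zero>\<^bsub>M\<^esub>}" "\<zero>\<^bsub>M\<^esub> \<in> N" "N \<subseteq> carrier M"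
    and simple: "\<And>H. \<lbrakk>submodule H S M; H \<subseteq> N\<rbrakk> \<Longrightarrow> H = {\<zero>\<^bsub>M\<^esub>} \<or> H = N"
    using N(2) simple_submodule_iff[OF subN] subN submodule_iff[of N] by auto
  have pre_eq: "pre A = pre B \<longleftrightarrow> A = B" if "A \<subseteq> carrier M" "B \<subseteq> carrier M" for A B
    using image_pre[OF that(1)] image_pre[OF that(2)] by metis
  have "essential_simple_pair S (pre {\<zero>\<^bsub>M\<^esub>}) (pre N)"
    unfolding essential_simple_pair_def
  proof (intro conjI allI impI pre_left_ideal subN sub0)
    have "pre {\<zero>\<^bsub>M\<^esub>} \<noteq> pre N" using pre_eq[of "{\<zero>\<^bsub>M\<^esub>}" N] N0 by auto
    then show "pre {\<zero>\<^bsub>M\<^esub>} \<subset> pre N" using pre_mono[of "{\<zero>\<^bsub>M\<^esub>}" N] N0 by auto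
  next
    fix H assume H: "left_ideal S H \<and> pre {\<zero>\<^bsub>M\<^esub>} \<subseteq> H \<and> H \<subseteq> pre N"
    have "?im H \<subseteq> N" using H image_mono[of H "pre N" "\<lambda>a. a \<odot>\<^bsub>M\<^esub> x"] image_pre[OF N0(3)] by simp
    then have "?im H = {\<zero>\<^bsub>M\<^esub>} \<or> ?im H = N" using simple image_submodule H by blast
    then show "H = pre {\<zero>\<^bsub>M\<^esub>} \<or> H = pre N" using pre_image[of H] H by auto
  next
    fix H assume H: "left_ideal S H \<and> pre {\<zero>\<^bsub>M\<^esub>} \<subset> H"
    show "H \<inter> pre N \<noteq> pre {\<zero>\<^bsub>M\<^esub>}"
    proof
      assume eq: "H \<inter> pre N = pre {\<zero>\<^bsub>M\<^esub>}"
      have "?im H \<inter> N = {\<zero>\<^bsub>M\<^esub>}"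
      proof
        show "{\<zero>\<^bsub>M\<^esub>} \<subseteq> ?im H \<inter> N"
          using image_submodule[of H] H N0(2) submodule_iff by blast
        show "?im H \<inter> N \<subseteq> {\<zero>\<^bsub>M\<^esub>}"
        proof
          fix y assume "y \<in> ?im H \<inter> N"
          then obtain a where "a \<in> H" "y = a \<odot>\<^bsub>M\<^esub> x" "y \<in> N" by blast
          then have "a \<in> H \<inter> pre N" using left_idealD(2)[OF conjunct1[OF H] \<open>a \<in> H\<close>] by (simp add: pre_def)
          then show "y \<in> {\<zero>\<^bsub>M\<^esub>}" using eq \<open>y = _\<close> by (auto simp: pre_def)
        qed
      qed
      then have "?im H = {\<zero>\<^bsub>M\<^esub>}"
        using N(1) image_submodule[of H] H unfolding essential_submodule_def by blast
      then show False using pre_image[of H] H by auto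
    qed
  qed
  then have dcc: "dcc_above S (pre {\<zero>\<^bsub>M\<^esub>})" by (rule assms(2))
  show "artinian_module S M"
    unfolding artinian_module_def
  proof (intro conjI left_module_axioms allI impI)
    fix H :: "nat \<Rightarrow> 's set set"
    assume H: "(\<forall>n. submodule (H n) S M) \<and> (\<forall>n. H (Suc n) \<subseteq> H n)"
    have "left_ideal S (pre (H n)) \<and> pre {\<zero>\<^bsub>M\<^esub>} \<subseteq> pre (H n)" for n
      using H pre_left_ideal pre_mono[of "{\<zero>\<^bsub>M\<^esub>}" "H n"] submodule_iff[of "H n"] by auto
    moreover have "pre (H (Suc n)) \<subseteq> pre (H n)" for n using H pre_mono by simp
    ultimately obtain n where n: "\<forall>m\<ge>n. pre (H m) = pre (H n)"
      using dcc[unfolded dcc_above_def, rule_format, of "\<lambda>n. pre (H n)"] by blast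
    have sub: "H k \<subseteq> carrier M" for k using H submodule_iff[of "H k"] by blast
    have "H m = H n" if "m \<ge> n" for m
      using iffD1[OF pre_eq[OF sub sub]] n[rule_format, OF that] by blast
    then show "\<exists>n. \<forall>m\<ge>n. H m = H n" by blast
  qed
qed

text \<open>For the annihilator \<open>L\<close> of a non-zero vector \<open>x\<close> of a simple
  module, \<open>L\<close> is maximal, and \<open>a\<close> kills the whole module \<open>Sx\<close>
  exactly when \<open>aS \<subseteq> L\<close>. Conversely \<open>S/L\<close> is the required
  module.\<close>

lemma primitive_ring_iff:
  fixes S :: "('s, 'a) ring_scheme"
  assumes "ring S"
  shows "primitive_ring S \<longleftrightarrow> (\<exists>L. left_maximal S L \<and>
    (\<forall>a\<in>carrier S. (\<forall>s\<in>carrier S. a \<otimes>\<^bsub>S\<^esub> s \<in> L) \<longrightarrow> a = \<zero>\<^bsub>S\<^esub>))"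
proof
  assume "primitive_ring S"
  then obtain M :: "('s, 's set) module" where M: "simple_module S M" "faithful_module S M"
    by (auto simp: primitive_ring_def)
  interpret left_module S M using M(1) by (simp add: simple_module_def)
  have "carrier M \<noteq> {\<zero>\<^bsub>M\<^esub>}" using M(1) by (simp add: simple_module_def)
  then obtain x where nz: "x \<in> carrier M" "x \<noteq> \<zero>\<^bsub>M\<^esub>" using M.zero_closed by blast
  interpret module_generator S M x by (rule simple_module_generator[OF M(1) nz])
  note sub0 = submodule_zero
  have one: "\<one>\<^bsub>S\<^esub> \<notin> pre {\<zero>\<^bsub>M\<^esub>}" using nz by (simp add: pre_def)
  show "\<exists>L. left_maximal S L \<and>
    (\<forall>a\<in>carrier S. (\<forall>s\<in>carrier S. a \<otimes>\<^bsub>S\<^esub> s \<in> L) \<longrightarrow> a = \<zero>\<^bsub>S\<^esub>)"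
  proof (intro exI[of _ "pre {\<zero>\<^bsub>M\<^esub>}"] conjI ballI impI)
    show "left_maximal S (pre {\<zero>\<^bsub>M\<^esub>})"
      unfolding left_maximal_def
    proof (intro conjI allI impI pre_left_ideal sub0)
      show "pre {\<zero>\<^bsub>M\<^esub>} \<noteq> carrier S" using one by auto
      fix H assume H: "left_ideal S H \<and> pre {\<zero>\<^bsub>M\<^esub>} \<subseteq> H"
      then have "(\<lambda>a. a \<odot>\<^bsub>M\<^esub> x) ` H = {\<zero>\<^bsub>M\<^esub>} \<or> (\<lambda>a. a \<odot>\<^bsub>M\<^esub> x) ` H = carrier M"
        using image_submodule M(1) unfolding simple_module_def by blast
      moreover have "pre (carrier M) = carrier S" using x by (auto simp: pre_def)
      ultimately show "H = pre {\<zero>\<^bsub>M\<^esub>} \<or> H = carrier S" using pre_image[of H] H by auto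
    qed
    fix a assume a: "a \<in> carrier S" "\<forall>s\<in>carrier S. a \<otimes>\<^bsub>S\<^esub> s \<in> pre {\<zero>\<^bsub>M\<^esub>}"
    have "a \<odot>\<^bsub>M\<^esub> y = \<zero>\<^bsub>M\<^esub>" if "y \<in> carrier M" for y
    proof -
      have "y \<in> (\<lambda>a. a \<odot>\<^bsub>M\<^esub> x) ` carrier S" using that by (subst (asm) gen)
      then obtain s where "s \<in> carrier S" "y = s \<odot>\<^bsub>M\<^esub> x" by (elim imageE)
      then show ?thesis using a x smult_assoc[of a s x] by (simp add: pre_def)
    qed
    then show "a = \<zero>\<^bsub>S\<^esub>" using M(2) a(1) by (simp add: faithful_module_def)
  qed
next
  assume "\<exists>L. left_maximal S L \<and>
    (\<forall>a\<in>carrier S. (\<forall>s\<in>carrier S. a \<otimes>\<^bsub>S\<^esub> s \<in> L) \<longrightarrow> a = \<zero>\<^bsub>S\<^esub>)"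
  then obtain L where mx: "left_maximal S L"
    "\<And>a. \<lbrakk>a \<in> carrier S; \<forall>s\<in>carrier S. a \<otimes>\<^bsub>S\<^esub> s \<in> L\<rbrakk> \<Longrightarrow> a = \<zero>\<^bsub>S\<^esub>" by blast
  interpret ring S by fact
  interpret left_quotient S L using mx(1) by unfold_locales (simp add: left_maximal_def)
  have "faithful_module S quot"
    unfolding faithful_module_def
  proof (intro conjI quot_left_module ballI impI)
    fix a assume a: "a \<in> carrier S" "\<forall>x\<in>carrier quot. a \<odot>\<^bsub>quot\<^esub> x = \<zero>\<^bsub>quot\<^esub>"
    then have "a \<otimes>\<^bsub>S\<^esub> s \<in> L" if "s \<in> carrier S" for s
      using that coset_of_zero_iff[of "a \<otimes>\<^bsub>S\<^esub> s"] by (auto simp: quot_simps)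
    then show "a = \<zero>\<^bsub>S\<^esub>" using mx(2) a(1) by blast
  qed
  then show "primitive_ring S" using primitive_ringI quot_simple[OF mx(1)] by blast
qed

section \<open>Noetherian rings\<close>

definition left_noetherian :: "('s, 'a) ring_scheme \<Rightarrow> bool" where
  "left_noetherian S \<longleftrightarrow> (\<forall>H::nat \<Rightarrow> 's set.
     (\<forall>n. left_ideal S (H n)) \<and> (\<forall>n. H n \<subseteq> H (Suc n)) \<longrightarrow> (\<exists>n. \<forall>m\<ge>n. H m = H n))"

text \<open>If no member of \<open>F\<close> were maximal, dependent choice would produce a strictly
  ascending chain inside \<open>F\<close>.\<close>

lemma left_noetherian_maximal:
  assumes "left_noetherian S" "F \<noteq> {}" "\<And>H. H \<in> F \<Longrightarrow> left_ideal S H"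
  obtains (max) H where "H \<in> F" "\<And>K. \<lbrakk>K \<in> F; H \<subseteq> K\<rbrakk> \<Longrightarrow> K = H"
proof (rule ccontr)
  assume *: "\<not> thesis"
  have step: "\<exists>K. K \<in> F \<and> H \<subset> K" if "H \<in> F" for H
  proof (rule ccontr)
    assume "\<not> (\<exists>K. K \<in> F \<and> H \<subset> K)"
    then have "K = H" if "K \<in> F" "H \<subseteq> K" for K using that by blast
    then show False using * max \<open>H \<in> F\<close> by blast
  qed
  obtain H0 where "H0 \<in> F" using assms(2) by blast
  then have "\<exists>f. \<forall>n. f n \<in> F \<and> f n \<subset> f (Suc n)"
    using dependent_nat_choice[of "\<lambda>_ x. x \<in> F" "\<lambda>_ x y. x \<subset> y"] step by blast
  then obtain f where f: "\<And>n. f n \<in> F" "\<And>n. f n \<subset> f (Suc n)" by blast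
  then have "\<exists>n. \<forall>m\<ge>n. f m = f n"
    using assms(3) by (intro assms(1)[unfolded left_noetherian_def, rule_format]) blast
  then obtain n where "f (Suc n) = f n" by (meson le_SucI order_refl)
  then show False using f(2)[of n] by blast
qed

text \<open>The chain condition takes the place of Zorn's lemma, applied to the left ideals above
  \<open>I\<close> that avoid \<open>\<one>\<close>.\<close>

lemma (in ring) left_maximal_exists:
  assumes "left_noetherian R" "left_ideal R I" "\<one> \<notin> I"
  obtains M where "left_maximal R M" "I \<subseteq> M"
proof -
  let ?F = "{H. left_ideal R H \<and> I \<subseteq> H \<and> \<one> \<notin> H}"
  obtain M where M: "M \<in> ?F" "\<And>K. \<lbrakk>K \<in> ?F; M \<subseteq> K\<rbrakk> \<Longrightarrow> K = M"
    using left_noetherian_maximal[OF assms(1), of ?F] assms(2,3) by blast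
  have "left_maximal R M"
    unfolding left_maximal_def
  proof (intro conjI allI impI)
    show "left_ideal R M" "M \<noteq> carrier R" using M(1) by auto
    fix H assume H: "left_ideal R H \<and> M \<subseteq> H"
    show "H = M \<or> H = carrier R"
    proof (cases "\<one> \<in> H")
      case True
      then show ?thesis using left_ideal_one H by blast
    next
      case False
      then show ?thesis using M(1) M(2)[of H] H by blast
    qed
  qed
  then show thesis using that M(1) by blast
qed

lemma (in ring) left_maximal_one: "left_maximal R M \<Longrightarrow> \<one> \<notin> M"
  using left_ideal_one by (auto simp: left_maximal_def)

lemma (in cring) left_ideal_iff_ideal: "left_ideal R I \<longleftrightarrow> ideal I R"
proof
  assume I: "left_ideal R I"
  note D = left_idealD[OF I]
  have neg: "\<ominus> x \<in> I" if "x \<in> I" for x using left_ideal_a_inv[OF I that] .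
  show "ideal I R"
  proof (rule idealI[OF ring_axioms])
    show "subgroup I (add_monoid R)"
      using D neg by (intro subgroup.intro) (auto simp: a_inv_def)
    show "x \<otimes> a \<in> I" if "a \<in> I" "x \<in> carrier R" for a x using D(5) that by blast
    show "a \<otimes> x \<in> I" if "a \<in> I" "x \<in> carrier R" for a x
      using D(5)[OF that(2,1)] D(2)[OF that(1)] that(2) by (simp add: m_comm)
  qed
next
  assume "ideal I R"
  then interpret ideal I R .
  show "left_ideal R I"
    by (rule left_idealI) (auto simp: I_l_closed)
qed

lemma (in cring) left_maximal_iff_maximalideal: "left_maximal R M \<longleftrightarrow> maximalideal M R"
proof
  assume M: "left_maximal R M"
  show "maximalideal M R"
    by (rule maximalidealI)
      (use M in \<open>auto simp: left_maximal_def left_ideal_iff_ideal\<close>)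
next
  assume "maximalideal M R"
  then interpret maximalideal M R .
  show "left_maximal R M"
    unfolding left_maximal_def left_ideal_iff_ideal
    using I_notcarr I_maximal is_ideal ideal.Icarr by (metis subsetI)
qed

lemma (in cring) left_maximal_prime:
  assumes "left_maximal R M" "x \<in> carrier R" "y \<in> carrier R" "x \<otimes> y \<in> M"
  shows "x \<in> M \<or> y \<in> M"
  using primeideal.I_prime[OF maximalideal_prime] assms
  unfolding left_maximal_iff_maximalideal by blast

section \<open>Adjoining one element to a subring\<close>

text \<open>These are the values at \<open>b\<close> of polynomials with coefficients in
  \<open>C\<close> and degree below \<open>n\<close>. Working with values keeps every extension
  inside the fixed ring \<open>R\<close>; the price is that coefficients are unique only where no
  algebraic relation of \<open>b\<close> interferes.\<close>

primrec (in ring) poly_upto :: "'a set \<Rightarrow> 'a \<Rightarrow> nat \<Rightarrow> 'a set" where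
  "poly_upto C b 0 = {\<zero>}"
| "poly_upto C b (Suc n) = {c \<otimes> b [^] n \<oplus> p | c p. c \<in> C \<and> p \<in> poly_upto C b n}"

definition (in ring) poly_vals :: "'a set \<Rightarrow> 'a \<Rightarrow> 'a set" where
  "poly_vals C b = (\<Union>n. poly_upto C b n)"

locale adjoin = cring R for R (structure) +
  fixes A b
  assumes A: "subring A R" and b [simp]: "b \<in> carrier R"
begin

abbreviation "RA \<equiv> R\<lparr>carrier := A\<rparr>"
abbreviation "B \<equiv> poly_vals A b"
abbreviation "RB \<equiv> R\<lparr>carrier := B\<rparr>"

lemma A_car [simp]: "x \<in> A \<Longrightarrow> x \<in> carrier R" using subringE(1)[OF A] by blast

lemma A_closed [simp]: "\<zero> \<in> A" "\<one> \<in> A" "x \<in> A \<Longrightarrow> \<ominus> x \<in> A"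
  "\<lbrakk>x \<in> A; y \<in> A\<rbrakk> \<Longrightarrow> x \<oplus> y \<in> A" "\<lbrakk>x \<in> A; y \<in> A\<rbrakk> \<Longrightarrow> x \<otimes> y \<in> A"
  "\<lbrakk>x \<in> A; y \<in> A\<rbrakk> \<Longrightarrow> x \<ominus> y \<in> A"
  using subringE[OF A] by (auto simp: minus_eq)

lemma left_ideal_A: "left_ideal RA A" by (rule left_idealI) auto

lemma RA_cring: "cring RA"
proof -
  interpret RA: ring RA by (rule subring_is_ring[OF A])
  show ?thesis by unfold_locales (auto simp: m_comm)
qed

lemma ideal_A: assumes "left_ideal RA C"
  shows "x \<in> C \<Longrightarrow> x \<in> A" "\<zero> \<in> C" "\<lbrakk>x \<in> C; y \<in> C\<rbrakk> \<Longrightarrow> x \<oplus> y \<in> C"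
    "\<lbrakk>s \<in> A; x \<in> C\<rbrakk> \<Longrightarrow> s \<otimes> x \<in> C"
  using left_idealD[OF assms] by auto

lemma pu_car:
  assumes "left_ideal RA C"
  shows "p \<in> poly_upto C b n \<Longrightarrow> p \<in> carrier R"
  by (induction n arbitrary: p) (auto dest: ideal_A(1)[OF assms])

lemma pu_zero:
  assumes "left_ideal RA C"
  shows "\<zero> \<in> poly_upto C b n"
proof (induction n)
  case (Suc n)
  have "\<zero> = \<zero> \<otimes> b [^] n \<oplus> \<zero>" by simp
  then show ?case using Suc ideal_A(2)[OF assms] by (simp only: poly_upto.simps) blast
qed simp

lemma pu_SucI: "\<lbrakk>c \<in> C; p \<in> poly_upto C b n\<rbrakk> \<Longrightarrow> c \<otimes> b [^] n \<oplus> p \<in> poly_upto C b (Suc n)"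
  by auto

lemma pu_Suc_mono:
  assumes "left_ideal RA C" "p \<in> poly_upto C b n"
  shows "p \<in> poly_upto C b (Suc n)"
  using pu_SucI[OF ideal_A(2)[OF assms(1)] assms(2)] pu_car[OF assms] by simp

lemma pu_mono:
  assumes "left_ideal RA C" "n \<le> m" "p \<in> poly_upto C b n"
  shows "p \<in> poly_upto C b m"
  using assms(2,3) by (induction rule: dec_induct) (use pu_Suc_mono[OF assms(1)] in blast)+

lemma pu_mono_set:
  assumes "C \<subseteq> D" "p \<in> poly_upto C b n"
  shows "p \<in> poly_upto D b n"
  using assms(2) by (induction n arbitrary: p) (use assms(1) in auto)

lemma pu_add:
  assumes C: "left_ideal RA C"
  shows "\<lbrakk>p \<in> poly_upto C b n; q \<in> poly_upto C b n\<rbrakk> \<Longrightarrow> p \<oplus> q \<in> poly_upto C b n"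
proof (induction n arbitrary: p q)
  case (Suc n)
  then obtain c p' d q' where "c \<in> C" "d \<in> C" "p' \<in> poly_upto C b n" "q' \<in> poly_upto C b n"
    and eq: "p = c \<otimes> b [^] n \<oplus> p'" "q = d \<otimes> b [^] n \<oplus> q'" by auto
  moreover from this have "c \<in> carrier R" "d \<in> carrier R" "p' \<in> carrier R" "q' \<in> carrier R"
    using ideal_A(1)[OF C] pu_car[OF C] by auto
  moreover from this have "p \<oplus> q = (c \<oplus> d) \<otimes> b [^] n \<oplus> (p' \<oplus> q')"
    unfolding eq by (simp add: l_distr a_ac)
  ultimately show ?case using Suc.IH pu_SucI[OF ideal_A(3)[OF C]] by simp
qed simp

lemma pu_smult:
  assumes C: "left_ideal RA C" and a: "a \<in> A"
  shows "p \<in> poly_upto C b n \<Longrightarrow> a \<otimes> p \<in> poly_upto C b n"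
proof (induction n arbitrary: p)
  case (Suc n)
  then obtain c p' where "c \<in> C" "p' \<in> poly_upto C b n" and eq: "p = c \<otimes> b [^] n \<oplus> p'" by auto
  moreover from this have "c \<in> carrier R" "p' \<in> carrier R"
    using ideal_A(1)[OF C] pu_car[OF C] by auto
  moreover from this have "a \<otimes> p = (a \<otimes> c) \<otimes> b [^] n \<oplus> (a \<otimes> p')"
    unfolding eq using a by (simp add: r_distr m_assoc)
  ultimately show ?case using Suc.IH pu_SucI[OF ideal_A(4)[OF C a]] by simp
qed (use a in simp)

lemma pu_smult_set:
  assumes C: "left_ideal RA C" and a: "a \<in> C"
  shows "p \<in> poly_upto A b n \<Longrightarrow> a \<otimes> p \<in> poly_upto C b n"
proof (induction n arbitrary: p)
  case (Suc n)
  then obtain c p' where "c \<in> A" "p' \<in> poly_upto A b n" and eq: "p = c \<otimes> b [^] n \<oplus> p'" by auto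
  moreover from this have "c \<in> carrier R" "p' \<in> carrier R" "a \<in> carrier R"
    using ideal_A(1)[OF C] pu_car[OF left_ideal_A] a by auto
  moreover from this have "a \<otimes> p = (c \<otimes> a) \<otimes> b [^] n \<oplus> (a \<otimes> p')"
    unfolding eq by (simp add: r_distr m_ac)
  ultimately show ?case using Suc.IH pu_SucI[OF ideal_A(4)[OF C _ a]] by simp
qed (use ideal_A(1)[OF C a] in simp)

lemma pu_neg: "left_ideal RA C \<Longrightarrow> p \<in> poly_upto C b n \<Longrightarrow> \<ominus> p \<in> poly_upto C b n"
  using pu_smult[of C "\<ominus> \<one>" p n] pu_car[of C p n] by (simp add: l_minus)

lemma pu_minus:
  "\<lbrakk>left_ideal RA C; p \<in> poly_upto C b n; q \<in> poly_upto C b n\<rbrakk> \<Longrightarrow> p \<ominus> q \<in> poly_upto C b n"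
  using pu_add[of C p n "\<ominus> q"] pu_neg[of C q n] by (simp add: minus_eq)

lemma pu_shift1:
  assumes C: "left_ideal RA C"
  shows "p \<in> poly_upto C b n \<Longrightarrow> b \<otimes> p \<in> poly_upto C b (Suc n)"
proof (induction n arbitrary: p)
  case 0
  then show ?case using pu_zero[OF C, of "Suc 0"] by simp
next
  case (Suc n)
  then obtain c p' where *: "c \<in> C" "p' \<in> poly_upto C b n" and eq: "p = c \<otimes> b [^] n \<oplus> p'" by auto
  moreover from this have "c \<in> carrier R" "p' \<in> carrier R"
    using ideal_A(1)[OF C] pu_car[OF C] by auto
  moreover from this have "b \<otimes> p = c \<otimes> b [^] Suc n \<oplus> (b \<otimes> p')"
    unfolding eq by (simp add: r_distr m_ac)
  ultimately show ?case using pu_SucI[OF *(1) Suc.IH[OF *(2)]] by simp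
qed

lemma pu_shift:
  assumes C: "left_ideal RA C" and p: "p \<in> poly_upto C b n"
  shows "b [^] (k::nat) \<otimes> p \<in> poly_upto C b (n + k)"
proof (induction k)
  case (Suc k)
  have "b [^] Suc k \<otimes> p = b \<otimes> (b [^] k \<otimes> p)" using pu_car[OF C p] by (simp add: m_ac)
  then show ?case using pu_shift1[OF C Suc] by simp
qed (use pu_car[OF C p] p in simp)

lemma pu_const: "c \<in> C \<Longrightarrow> c \<in> carrier R \<Longrightarrow> c \<in> poly_upto C b (Suc 0)"
  by force

text \<open>The bounds are degree below \<open>m\<close> and degree at most \<open>n\<close>, which
  add up to degree below \<open>m + n\<close> without loss.\<close>

lemma pu_mult:
  assumes C: "left_ideal RA C"
  shows "\<lbrakk>p \<in> poly_upto A b m; q \<in> poly_upto C b (Suc n)\<rbrakk> \<Longrightarrow> p \<otimes> q \<in> poly_upto C b (m + n)"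
proof (induction m arbitrary: p)
  case 0
  then show ?case using pu_zero[OF C] pu_car[OF C 0(2)] by simp
next
  case (Suc m)
  then obtain c p' where *: "c \<in> A" "p' \<in> poly_upto A b m" and eq: "p = c \<otimes> b [^] m \<oplus> p'" by auto
  have car: "p' \<in> carrier R" "q \<in> carrier R"
    using pu_car[OF left_ideal_A *(2)] pu_car[OF C Suc.prems(2)] by auto
  have "p \<otimes> q = c \<otimes> (b [^] m \<otimes> q) \<oplus> p' \<otimes> q"
    unfolding eq using * car by (simp add: l_distr m_assoc)
  moreover have "c \<otimes> (b [^] m \<otimes> q) \<in> poly_upto C b (Suc m + n)"
    using pu_smult[OF C *(1) pu_shift[OF C Suc.prems(2)], of m] by (simp add: add.commute)
  moreover have "p' \<otimes> q \<in> poly_upto C b (Suc m + n)"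
    using pu_mono[OF C _ Suc.IH[OF *(2) Suc.prems(2)], of "Suc m + n"] by simp
  ultimately show ?case by (simp only: pu_add[OF C])
qed

lemma pvE: "x \<in> poly_vals C b \<Longrightarrow> \<exists>n. x \<in> poly_upto C b n"
  and pvI: "x \<in> poly_upto C b n \<Longrightarrow> x \<in> poly_vals C b"
  by (auto simp: poly_vals_def)

lemma pv_car: "\<lbrakk>left_ideal RA C; x \<in> poly_vals C b\<rbrakk> \<Longrightarrow> x \<in> carrier R"
  using pu_car pvE by blast

lemma pv_add:
  assumes "left_ideal RA C" "x \<in> poly_vals C b" "y \<in> poly_vals C b"
  shows "x \<oplus> y \<in> poly_vals C b"
proof -
  obtain n m where "x \<in> poly_upto C b n" "y \<in> poly_upto C b m" using assms pvE by blast
  then have "x \<in> poly_upto C b (max n m)" "y \<in> poly_upto C b (max n m)"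
    using pu_mono[OF assms(1)] by (meson max.cobounded1, meson max.cobounded2)
  then show ?thesis using pu_add[OF assms(1)] pvI by blast
qed

lemma pv_mult:
  assumes "left_ideal RA C" "x \<in> B" "y \<in> poly_vals C b"
  shows "x \<otimes> y \<in> poly_vals C b"
proof -
  obtain n m where "x \<in> poly_upto A b n" "y \<in> poly_upto C b m" using assms pvE by blast
  then have "x \<otimes> y \<in> poly_upto C b (n + m)"
    using pu_mult[OF assms(1)] pu_Suc_mono[OF assms(1)] by blast
  then show ?thesis by (rule pvI)
qed

text \<open>\<open>poly_vals C b\<close> is the extension \<open>CB\<close> of the ideal
  \<open>C\<close> to \<open>B = A[b]\<close>.\<close>

lemma left_ideal_pv: "left_ideal RA C \<Longrightarrow> left_ideal RB (poly_vals C b)"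
proof (rule left_idealI)
  assume C: "left_ideal RA C"
  have "C \<subseteq> A" using ideal_A(1)[OF C] by blast
  then show "poly_vals C b \<subseteq> carrier RB" using pu_mono_set[of C A] by (auto simp: poly_vals_def)
  show "\<zero>\<^bsub>RB\<^esub> \<in> poly_vals C b" using pu_zero[OF C, of 0] pvI[of _ C 0] by simp
qed (auto intro: pv_add pv_mult)

lemma A_sub_B: "x \<in> A \<Longrightarrow> x \<in> B"
  using pu_const[of x A] pvI A_car by blast

lemma b_B: "b \<in> B"
  using pu_shift1[OF left_ideal_A pu_const[of \<one> A]] pvI[of b A "Suc (Suc 0)"] by simp

lemma B_car [simp]: "x \<in> B \<Longrightarrow> x \<in> carrier R"
  using pv_car[OF left_ideal_A] .

lemma B_closed [simp]: "\<zero> \<in> B" "\<one> \<in> B" "x \<in> B \<Longrightarrow> \<ominus> x \<in> B"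
  "\<lbrakk>x \<in> B; y \<in> B\<rbrakk> \<Longrightarrow> x \<oplus> y \<in> B" "\<lbrakk>x \<in> B; y \<in> B\<rbrakk> \<Longrightarrow> x \<otimes> y \<in> B"
  "\<lbrakk>x \<in> B; y \<in> B\<rbrakk> \<Longrightarrow> x \<ominus> y \<in> B"
proof -
  show neg: "\<ominus> x \<in> B" if "x \<in> B" for x using that pu_neg[OF left_ideal_A] pvE pvI by meson
  show "\<zero> \<in> B" "\<one> \<in> B" "\<lbrakk>x \<in> B; y \<in> B\<rbrakk> \<Longrightarrow> x \<oplus> y \<in> B" "\<lbrakk>x \<in> B; y \<in> B\<rbrakk> \<Longrightarrow> x \<otimes> y \<in> B"
    "\<lbrakk>x \<in> B; y \<in> B\<rbrakk> \<Longrightarrow> x \<ominus> y \<in> B"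
    using A_sub_B pv_add[OF left_ideal_A] pv_mult[OF left_ideal_A] neg by (auto simp: minus_eq)
qed

lemma B_subring: "subring B R"
  by (rule subringI) auto

lemma RB_cring: "cring RB"
proof -
  interpret RB: ring RB by (rule subring_is_ring[OF B_subring])
  show ?thesis by unfold_locales (auto simp: m_comm)
qed

lemma generate_ring_insert:
  assumes "H \<subseteq> carrier R" "A = generate_ring R H"
  shows "generate_ring R (insert b H) = B"
proof
  have H: "insert b H \<subseteq> carrier R" using assms(1) by simp
  have "H \<subseteq> A" unfolding assms(2) by (auto intro: generate_ring.incl)
  then have "insert b H \<subseteq> B" using b_B A_sub_B by auto
  then show "generate_ring R (insert b H) \<subseteq> B"
    by (rule generate_ring_min_subring1[OF H B_subring])
  note G = subringE[OF generate_ring_is_subring[OF H]]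
  have bG: "b \<in> generate_ring R (insert b H)" by (simp add: generate_ring.incl)
  have pow: "b [^] n \<in> generate_ring R (insert b H)" for n :: nat
    by (induction n) (use bG G in auto)
  have AG: "A \<subseteq> generate_ring R (insert b H)"
    unfolding assms(2)
    by (rule generate_ring_min_subring1[OF assms(1) generate_ring_is_subring[OF H]])
      (auto intro: generate_ring.incl)
  have "p \<in> generate_ring R (insert b H)" if "p \<in> poly_upto A b n" for p n
    using that by (induction n arbitrary: p) (use G AG pow in auto)
  then show "B \<subseteq> generate_ring R (insert b H)" by (auto simp: poly_vals_def)
qed

section \<open>Hilbert's basis theorem for \<open>A[b]\<close>\<close>

definition lead :: "nat \<Rightarrow> 'a set \<Rightarrow> 'a set" where
  "lead n I = {a \<in> A. \<exists>p\<in>poly_upto A b n. a \<otimes> b [^] n \<oplus> p \<in> I}"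

lemma ideal_B: assumes "left_ideal RB I"
  shows "x \<in> I \<Longrightarrow> x \<in> B" "\<zero> \<in> I" "\<lbrakk>x \<in> I; y \<in> I\<rbrakk> \<Longrightarrow> x \<oplus> y \<in> I"
    "\<lbrakk>s \<in> B; x \<in> I\<rbrakk> \<Longrightarrow> s \<otimes> x \<in> I" "\<lbrakk>x \<in> I; y \<in> I\<rbrakk> \<Longrightarrow> x \<ominus> y \<in> I"
proof -
  show *: "x \<in> I \<Longrightarrow> x \<in> B" "\<zero> \<in> I" "\<lbrakk>x \<in> I; y \<in> I\<rbrakk> \<Longrightarrow> x \<oplus> y \<in> I"
    "\<lbrakk>s \<in> B; x \<in> I\<rbrakk> \<Longrightarrow> s \<otimes> x \<in> I" for x y s
    using left_idealD[OF assms] by auto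
  show "x \<ominus> y \<in> I" if "x \<in> I" "y \<in> I"
    using *(3)[OF that(1) *(4)[OF _ that(2), of "\<ominus> \<one>"]] *(1)[OF that(2)]
    by (simp add: l_minus minus_eq)
qed

lemma lead_ideal:
  assumes "left_ideal RB I"
  shows "left_ideal RA (lead n I)"
proof (rule left_idealI)
  note D = ideal_B[OF assms]
  show "lead n I \<subseteq> carrier RA" by (auto simp: lead_def)
  show "\<zero>\<^bsub>RA\<^esub> \<in> lead n I"
    using pu_zero[OF left_ideal_A, of n] D(2) by (auto simp: lead_def intro!: bexI[of _ \<zero>])
  fix x assume x: "x \<in> lead n I"
  then obtain p where p: "p \<in> poly_upto A b n" "x \<otimes> b [^] n \<oplus> p \<in> I" "x \<in> A"
    by (auto simp: lead_def)
  have pc: "p \<in> carrier R" using pu_car[OF left_ideal_A p(1)] .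
  show "x \<oplus>\<^bsub>RA\<^esub> y \<in> lead n I" if "y \<in> lead n I" for y
  proof -
    obtain q where q: "q \<in> poly_upto A b n" "y \<otimes> b [^] n \<oplus> q \<in> I" "y \<in> A"
      using \<open>y \<in> lead n I\<close> by (auto simp: lead_def)
    have "(x \<oplus> y) \<otimes> b [^] n \<oplus> (p \<oplus> q) = (x \<otimes> b [^] n \<oplus> p) \<oplus> (y \<otimes> b [^] n \<oplus> q)"
      using p q pc pu_car[OF left_ideal_A q(1)] by (simp add: l_distr a_ac)
    then have "(x \<oplus> y) \<otimes> b [^] n \<oplus> (p \<oplus> q) \<in> I" using D(3)[OF p(2) q(2)] by simp
    then show ?thesis using pu_add[OF left_ideal_A p(1) q(1)] p q by (auto simp: lead_def)
  qed
  show "s \<otimes>\<^bsub>RA\<^esub> x \<in> lead n I" if "s \<in> carrier RA" for s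
  proof -
    have s: "s \<in> A" using that by simp
    have "(s \<otimes> x) \<otimes> b [^] n \<oplus> (s \<otimes> p) = s \<otimes> (x \<otimes> b [^] n \<oplus> p)"
      using p pc s by (simp add: r_distr m_assoc)
    then have "(s \<otimes> x) \<otimes> b [^] n \<oplus> (s \<otimes> p) \<in> I" using D(4)[OF A_sub_B[OF s] p(2)] by simp
    then show ?thesis using pu_smult[OF left_ideal_A s p(1)] p s by (auto simp: lead_def)
  qed
qed

lemma lead_Suc:
  assumes "left_ideal RB I"
  shows "lead n I \<subseteq> lead (Suc n) I"
proof
  fix x assume "x \<in> lead n I"
  then obtain p where p: "p \<in> poly_upto A b n" "x \<otimes> b [^] n \<oplus> p \<in> I" "x \<in> A"
    by (auto simp: lead_def)
  have "x \<otimes> b [^] Suc n \<oplus> b \<otimes> p = b \<otimes> (x \<otimes> b [^] n \<oplus> p)"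
    using p pu_car[OF left_ideal_A p(1)] by (simp add: r_distr m_ac)
  then have "x \<otimes> b [^] Suc n \<oplus> b \<otimes> p \<in> I" using ideal_B(4)[OF assms b_B p(2)] by simp
  then show "x \<in> lead (Suc n) I" using pu_shift1[OF left_ideal_A p(1)] p(3) by (auto simp: lead_def)
qed

lemma lead_mono:
  assumes "left_ideal RB I" "n \<le> m" "I \<subseteq> J"
  shows "lead n I \<subseteq> lead m J"
proof -
  have "lead n I \<subseteq> lead m I"
    using assms(2) by (induction rule: dec_induct) (use lead_Suc[OF assms(1)] in blast)+
  moreover have "lead m I \<subseteq> lead m J" using assms(3) by (auto simp: lead_def)
  ultimately show ?thesis by blast
qed

text \<open>Given \<open>x \<in> J\<close> written with top coefficient \<open>c\<close>, some
  element of \<open>I\<close> has a representation with the same top term. The difference lies in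
  \<open>J\<close> and has lower formal degree, so induction applies. Different representations of
  the same element do no harm here.\<close>

lemma lead_determines:
  assumes I: "left_ideal RB I" and J: "left_ideal RB J" and "I \<subseteq> J" "\<And>n. lead n J \<subseteq> lead n I"
  shows "J \<subseteq> I"
proof -
  have "x \<in> poly_upto A b n \<Longrightarrow> x \<in> J \<Longrightarrow> x \<in> I" for x n
  proof (induction n arbitrary: x)
    case 0
    then show ?case using ideal_B(2)[OF I] by simp
  next
    case (Suc n)
    then obtain c p where x: "c \<in> A" "p \<in> poly_upto A b n" "x = c \<otimes> b [^] n \<oplus> p" by auto
    then have "c \<in> lead n I" using assms(4)[of n] Suc.prems(2) by (auto simp: lead_def)
    then obtain q where q: "q \<in> poly_upto A b n" "c \<otimes> b [^] n \<oplus> q \<in> I" by (auto simp: lead_def)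
    have car: "p \<in> carrier R" "q \<in> carrier R" using pu_car[OF left_ideal_A] x q by auto
    have eq: "x \<ominus> (c \<otimes> b [^] n \<oplus> q) = p \<ominus> q" using x(1) car unfolding x(3) by (simp add: minus_eq minus_add a_ac r_neg2 r_neg1 r_neg)
    have "x \<ominus> (c \<otimes> b [^] n \<oplus> q) \<in> J" using ideal_B(5)[OF J Suc.prems(2)] q assms(3) by blast
    then have "p \<ominus> q \<in> I" using Suc.IH[OF pu_minus[OF left_ideal_A x(2) q(1)]] eq by simp
    then have "(p \<ominus> q) \<oplus> (c \<otimes> b [^] n \<oplus> q) \<in> I" using ideal_B(3)[OF I] q by blast
    also have "(p \<ominus> q) \<oplus> (u \<oplus> q) = u \<oplus> p" if "u \<in> carrier R" for u
      using that car by algebra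
    then have "(p \<ominus> q) \<oplus> (c \<otimes> b [^] n \<oplus> q) = x" unfolding x(3) using x(1) by simp
    finally show ?case .
  qed
  then show ?thesis using ideal_B(1)[OF J] pvE by blast
qed

text \<open>Once the diagonal chain \<open>lead m (I m)\<close> is constant from \<open>N\<close>
  on, every \<open>lead n (I m)\<close> with \<open>n \<ge> N\<close> and \<open>m \<ge> N\<close>
  is squeezed between two of its terms. Only the finitely many degrees below \<open>N\<close>
  remain, each with its own stable index, and \<open>K\<close> lies beyond all of these.\<close>

theorem hilbert_basis:
  assumes "left_noetherian RA"
  shows "left_noetherian RB"
  unfolding left_noetherian_def
proof (intro allI impI)
  fix I :: "nat \<Rightarrow> 'a set"
  assume "(\<forall>n. left_ideal RB (I n)) \<and> (\<forall>n. I n \<subseteq> I (Suc n))"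
  then have I: "\<And>n. left_ideal RB (I n)" "\<And>n. I n \<subseteq> I (Suc n)" by auto
  have mono: "I k \<subseteq> I l" if "k \<le> l" for k l using lift_Suc_mono_le[of I] I(2) that by blast
  \<comment> \<open>Taking \<open>g\<close> as the identity gives the diagonal chain; a constant
    \<open>g\<close> gives the chain in one fixed degree.\<close>
  have stab: "\<exists>n. \<forall>m\<ge>n. lead (g m) (I m) = lead (g n) (I n)" if "mono g" for g :: "nat \<Rightarrow> nat"
    using lead_ideal[OF I(1)] lead_mono[OF I(1) monoD[OF that] I(2)]
    by (intro assms[unfolded left_noetherian_def, rule_format]) auto
  obtain N where N: "\<And>m. m \<ge> N \<Longrightarrow> lead m (I m) = lead N (I N)"
    using stab[of "\<lambda>k. k"] by (auto simp: mono_def)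
  have "\<exists>M. \<forall>m\<ge>M. lead n (I m) = lead n (I M)" for n using stab[of "\<lambda>_. n"] by (simp add: mono_def)
  then obtain M where M: "\<And>n m. m \<ge> M n \<Longrightarrow> lead n (I m) = lead n (I (M n))" by metis
  define K where "K = Max (insert N (M ` {..<N}))"
  have "N \<in> insert N (M ` {..<N})" by simp
  then have K: "N \<le> K" unfolding K_def by (intro Max_ge) auto
  have KM: "M n \<le> K" if "n < N" for n unfolding K_def using that by (intro Max_ge) auto
  have "lead n (I m) \<subseteq> lead n (I K)" if m: "m \<ge> K" for n m
  proof (cases "n < N")
    case True
    then have "lead n (I m) = lead n (I (M n))" "lead n (I K) = lead n (I (M n))"
      using M KM[OF True] m by (meson le_trans)+
    then show ?thesis by blast
  next
    case False
    have "lead n (I m) \<subseteq> lead (max n m) (I (max n m))"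
      by (rule lead_mono[OF I(1)]) (use mono in auto)
    also have "\<dots> = lead N (I N)" using N[of "max n m"] False by simp
    also have "\<dots> \<subseteq> lead n (I K)"
      by (rule lead_mono[OF I(1)]) (use False K mono in auto)
    finally show ?thesis .
  qed
  then have "I m \<subseteq> I K" if "m \<ge> K" for m
    using lead_determines[OF I(1) I(1) mono[OF that]] that by blast
  then have "I m = I K" if "m \<ge> K" for m using mono[OF that] that by blast
  then show "\<exists>n. \<forall>m\<ge>n. I m = I n" by blast
qed

end

section \<open>Maximal ideals avoiding a given element\<close>

text \<open>The Jacobson radical is zero. Of the Nullstellensatz only this much is needed, and it
  passes from \<open>A\<close> to \<open>A[b]\<close> inside a domain.\<close>

definition zero_jacobson :: "('s, 'a) ring_scheme \<Rightarrow> bool" where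
  "zero_jacobson S \<longleftrightarrow> (\<forall>g\<in>carrier S. g \<noteq> \<zero>\<^bsub>S\<^esub> \<longrightarrow> (\<exists>M. left_maximal S M \<and> g \<notin> M))"

locale adjoin_domain = adjoin R A b + domain R for R (structure) and A b
begin

lemma RB_maximal_exists:
  assumes "left_noetherian RB" "left_ideal RB J" "\<one> \<notin> J"
  obtains M where "left_maximal RB M" "J \<subseteq> M"
  using ring.left_maximal_exists[OF cring.axioms(1)[OF RB_cring] assms(1,2)] assms(3) by auto

lemma RA_prime:
  assumes "left_maximal RA M" "x \<in> A" "y \<in> A" "x \<otimes> y \<in> M"
  shows "x \<in> M \<or> y \<in> M"
  using cring.left_maximal_prime[OF RA_cring assms(1)] assms(2-4) by simp

lemma RA_maximal_one: "left_maximal RA M \<Longrightarrow> \<one> \<notin> M"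
  using ring.left_maximal_one[OF cring.axioms(1)[OF RA_cring]] by auto

lemma RB_maximal_one: "left_maximal RB M \<Longrightarrow> \<one> \<notin> M"
  using ring.left_maximal_one[OF cring.axioms(1)[OF RB_cring]] by auto

lemma poly_upto_leading:
  assumes "x \<in> poly_upto A b n" "x \<noteq> \<zero>"
  obtains d c p where "d < n" "c \<in> A" "c \<noteq> \<zero>" "p \<in> poly_upto A b d" "x = c \<otimes> b [^] d \<oplus> p"
proof -
  have "x \<in> poly_upto A b n \<Longrightarrow>
    \<exists>d c p. d < n \<and> c \<in> A \<and> c \<noteq> \<zero> \<and> p \<in> poly_upto A b d \<and> x = c \<otimes> b [^] d \<oplus> p"
  proof (induction n)
    case 0
    then show ?case using assms(2) by simp
  next
    case (Suc n)
    then obtain c p where cp: "c \<in> A" "p \<in> poly_upto A b n" "x = c \<otimes> b [^] n \<oplus> p" by auto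
    show ?case
    proof (cases "c = \<zero>")
      case True
      then have "x = p" using cp pu_car[OF left_ideal_A cp(2)] by simp
      then show ?thesis using Suc.IH cp(2) less_SucI by blast
    next
      case False
      then show ?thesis using cp by blast
    qed
  qed
  then show thesis using assms(1) that by blast
qed

text \<open>Choose \<open>M\<close> maximal in \<open>A\<close> with the leading coefficient
  \<open>c\<close> of \<open>g\<close> outside \<open>M\<close>. In \<open>B/MB\<close>, a
  polynomial ring over the field \<open>A/M\<close>, the element \<open>u = 1 + b g\<close> has
  positive degree and is no unit. A maximal ideal containing \<open>MB\<close> and \<open>u\<close>
  cannot contain \<open>g\<close>, since \<open>1 = u - b g\<close>.\<close>

lemma transcendental_case:
  assumes tr: "\<And>n a p. \<lbrakk>a \<in> A; p \<in> poly_upto A b n; a \<otimes> b [^] n \<oplus> p = \<zero>\<rbrakk> \<Longrightarrow> a = \<zero>"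
    and noeth: "left_noetherian RB" and jac: "zero_jacobson RA" and g: "g \<in> B" "g \<noteq> \<zero>"
  shows "\<exists>M. left_maximal RB M \<and> g \<notin> M"
proof -
  obtain d c p where lead_g: "c \<in> A" "c \<noteq> \<zero>" "p \<in> poly_upto A b d" "g = c \<otimes> b [^] d \<oplus> p"
    using g poly_upto_leading pvE by metis
  obtain M where M: "left_maximal RA M" "c \<notin> M"
    using jac lead_g by (auto simp: zero_jacobson_def)
  have MI: "left_ideal RA M" using M(1) by (simp add: left_maximal_def)
  note MA = ideal_A[OF MI]
  note BI = ideal_B[OF left_ideal_pv[OF MI]]
  \<comment> \<open>Since \<open>b\<close> is transcendental, a representation with coefficients in
    \<open>M\<close> must agree with the given one, so the top coefficient lies in
    \<open>M\<close>.\<close>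
  have coeff: "a \<in> M" if a: "a \<in> A" "q \<in> poly_upto A b k" and z: "a \<otimes> b [^] k \<oplus> q \<in> poly_vals M b" for a q k
  proof -
    have qc: "q \<in> carrier R" using pu_car[OF left_ideal_A a(2)] .
    have "a \<otimes> b [^] k \<oplus> q \<in> poly_upto M b n \<Longrightarrow> k < n \<Longrightarrow> a \<in> M" for n
    proof (induction n)
      case (Suc n)
      then obtain m r where m: "m \<in> M" "r \<in> poly_upto M b n" "a \<otimes> b [^] k \<oplus> q = m \<otimes> b [^] n \<oplus> r" by auto
      have rA: "r \<in> poly_upto A b n" by (rule pu_mono_set[OF _ m(2)]) (use MA(1) in blast)
      have car: "m \<in> carrier R" "r \<in> carrier R" using MA(1)[OF m(1)] pu_car[OF MI m(2)] by auto
      show ?case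
      proof (cases "k = n")
        case True
        have "(a \<ominus> m) \<otimes> b [^] n \<oplus> (q \<ominus> r) = (a \<otimes> b [^] k \<oplus> q) \<ominus> (m \<otimes> b [^] n \<oplus> r)"
          using a(1) qc car True by (simp add: minus_eq l_distr l_minus minus_add a_ac)
        also have "\<dots> = \<zero>" unfolding m(3) using car by (simp add: minus_eq r_neg)
        finally have "a \<ominus> m = \<zero>"
          using tr[of "a \<ominus> m" "q \<ominus> r" n] a MA(1)[OF m(1)] pu_minus[OF left_ideal_A _ rA] True by simp
        then show ?thesis using m(1) car a(1) by simp
      next
        case False
        then have "k < n" using Suc.prems by simp
        let ?z = "a \<otimes> b [^] k \<oplus> q"
        have z: "?z \<in> poly_upto A b n"
          using pu_mono[OF left_ideal_A _ pu_SucI[OF a]] \<open>k < n\<close> by simp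
        have "m \<otimes> b [^] n \<oplus> (r \<ominus> ?z) = (m \<otimes> b [^] n \<oplus> r) \<ominus> ?z"
          using a(1) qc car by (simp add: minus_eq a_ac)
        also have "\<dots> = \<zero>" unfolding m(3) using car by (simp add: minus_eq r_neg)
        finally have "m = \<zero>"
          using tr[of m] MA(1)[OF m(1)] pu_minus[OF left_ideal_A rA z] by simp
        then have "?z = r" using m(3) car by simp
        then show ?thesis using Suc.IH m(2) \<open>k < n\<close> by simp
      qed
    qed simp
    moreover obtain n where "a \<otimes> b [^] k \<oplus> q \<in> poly_upto M b n" using z pvE by blast
    then have "a \<otimes> b [^] k \<oplus> q \<in> poly_upto M b (max n (Suc k))"
      by (intro pu_mono[OF MI max.cobounded1])
    ultimately show ?thesis by simp
  qed
  \<comment> \<open>Modulo \<open>MB\<close> every element is zero or has a leading coefficient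
    outside \<open>M\<close>; this is its degree over the field \<open>A/M\<close>.\<close>
  have reduce: "h \<in> poly_vals M b \<or> (\<exists>e a q m. a \<in> A \<and> a \<notin> M \<and> q \<in> poly_upto A b e \<and>
      m \<in> poly_vals M b \<and> h = m \<oplus> (a \<otimes> b [^] e \<oplus> q))" if "h \<in> poly_upto A b n" for h n
    using that
  proof (induction n arbitrary: h)
    case 0
    then show ?case using BI(2) by simp
  next
    case (Suc n)
    then obtain a q where aq: "a \<in> A" "q \<in> poly_upto A b n" "h = a \<otimes> b [^] n \<oplus> q" by auto
    have qc: "q \<in> carrier R" using pu_car[OF left_ideal_A aq(2)] .
    show ?case
    proof (cases "a \<in> M")
      case False
      have "h = \<zero> \<oplus> (a \<otimes> b [^] n \<oplus> q)" using aq qc by simp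
      then show ?thesis using False aq BI(2) by blast
    next
      case True
      have am: "a \<otimes> b [^] n \<in> poly_vals M b"
        using pvI[OF pu_SucI[OF True pu_zero[OF MI, of n]]] aq(1) by simp
      from Suc.IH[OF aq(2)] show ?thesis
      proof
        assume "q \<in> poly_vals M b"
        then show ?thesis using BI(3)[OF am] aq(3) by blast
      next
        assume "\<exists>e a q' m. a \<in> A \<and> a \<notin> M \<and> q' \<in> poly_upto A b e \<and>
          m \<in> poly_vals M b \<and> q = m \<oplus> (a \<otimes> b [^] e \<oplus> q')"
        then obtain e a' q' m where *: "a' \<in> A" "a' \<notin> M" "q' \<in> poly_upto A b e"
          "m \<in> poly_vals M b" "q = m \<oplus> (a' \<otimes> b [^] e \<oplus> q')" by blast
        have "h = (a \<otimes> b [^] n \<oplus> m) \<oplus> (a' \<otimes> b [^] e \<oplus> q')"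
          unfolding aq(3) *(5) using aq(1) * pu_car[OF left_ideal_A *(3)] pv_car[OF MI *(4)]
          by (simp add: a_ac)
        then show ?thesis using * BI(3)[OF am *(4)] by blast
      qed
    qed
  qed
  \<comment> \<open>The factor \<open>b\<close> makes the degree of \<open>u\<close> positive even
    when \<open>g\<close> lies in \<open>A\<close>.\<close>
  define u where "u = \<one> \<oplus> b \<otimes> g"
  have u: "u \<in> B" using g(1) b_B by (simp add: u_def)
  have pc: "p \<in> carrier R" using pu_car[OF left_ideal_A lead_g(3)] .
  define u' where "u' = b \<otimes> p \<oplus> \<one>"
  have u': "u' \<in> poly_upto A b (Suc d)"
    unfolding u'_def
    by (rule pu_add[OF left_ideal_A pu_shift1[OF left_ideal_A lead_g(3)]
          pu_mono[OF left_ideal_A _ pu_const]]) auto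
  have u_eq: "u = c \<otimes> b [^] Suc d \<oplus> u'"
    unfolding u_def u'_def lead_g(4) using lead_g(1) pc by (simp add: r_distr m_ac a_ac)
  define J where "J = ideal_plus RB (poly_vals M b) (principal_left RB u)"
  have uI: "left_ideal RB (principal_left RB u)"
    using ring.left_ideal_right_mult[OF cring.axioms(1)[OF RB_cring]
        ring.left_ideal_carrier[OF cring.axioms(1)[OF RB_cring]], of u] u by simp
  have J: "left_ideal RB J"
    unfolding J_def
    by (rule ring.left_ideal_sum[OF cring.axioms(1)[OF RB_cring] left_ideal_pv[OF MI] uI])
  have uJ: "u \<in> J"
  proof -
    have "u \<in> principal_left RB u" using u by (intro image_eqI[of _ _ \<one>]) auto
    then show ?thesis
      using ring.left_ideal_sum_upper(2)[OF cring.axioms(1)[OF RB_cring] left_ideal_pv[OF MI] uI]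
      unfolding J_def by blast
  qed
  have "\<one> \<notin> J"
  proof
    assume "\<one> \<in> J"
    then obtain m h where mh: "m \<in> poly_vals M b" "h \<in> B" "\<one> = m \<oplus> h \<otimes> u"
      by (auto simp: J_def)
    obtain n where "h \<in> poly_upto A b n" using mh(2) pvE by blast
    from reduce[OF this] show False
    proof
      assume "h \<in> poly_vals M b"
      then have "u \<otimes> h \<in> poly_vals M b" using BI(4)[OF u] by simp
      then have "\<one> \<in> poly_vals M b" using mh BI(3)[OF mh(1)] u by (simp add: m_comm)
      then have "\<one> \<otimes> b [^] (0::nat) \<oplus> \<zero> \<in> poly_vals M b" by simp
      then show False using coeff[of \<one> \<zero> 0] RA_maximal_one[OF M(1)] by simp
    next
      assume "\<exists>e a q m. a \<in> A \<and> a \<notin> M \<and> q \<in> poly_upto A b e \<and>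
        m \<in> poly_vals M b \<and> h = m \<oplus> (a \<otimes> b [^] e \<oplus> q)"
      then obtain e a q m' where *: "a \<in> A" "a \<notin> M" "q \<in> poly_upto A b e"
        "m' \<in> poly_vals M b" "h = m' \<oplus> (a \<otimes> b [^] e \<oplus> q)" by blast
      have car: "q \<in> carrier R" "m \<in> carrier R" "m' \<in> carrier R" "u' \<in> carrier R" "a \<in> carrier R"
          "c \<in> carrier R" "u \<in> carrier R"
        using pu_car[OF left_ideal_A *(3)] pv_car[OF MI *(4)] pv_car[OF MI mh(1)]
          pu_car[OF left_ideal_A u'] * lead_g u by auto
      \<comment> \<open>\<open>D\<close> is the degree of the product of \<open>u\<close> with the
        reduced part of \<open>h\<close>. As \<open>D > 0\<close>, the summand \<open>\<one>\<close>
        is absorbed into the lower terms, so \<open>\<one> = m \<oplus> h \<otimes> u\<close> forces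
        the top coefficient \<open>c \<otimes> a\<close> into the prime ideal
        \<open>M\<close>.\<close>
      define D where "D = Suc d + e"
      define w where "w = c \<otimes> (b [^] Suc d \<otimes> q) \<oplus> u' \<otimes> (a \<otimes> b [^] e \<oplus> q)"
      have w: "w \<in> poly_upto A b D"
        unfolding w_def D_def
      proof (rule pu_add[OF left_ideal_A])
        show "c \<otimes> (b [^] Suc d \<otimes> q) \<in> poly_upto A b (Suc d + e)"
          using pu_smult[OF left_ideal_A lead_g(1) pu_shift[OF left_ideal_A *(3), of "Suc d"]]
          by (simp only: add.commute)
        show "u' \<otimes> (a \<otimes> b [^] e \<oplus> q) \<in> poly_upto A b (Suc d + e)"
          by (rule pu_mult[OF left_ideal_A u' pu_SucI[OF *(1,3)]])
      qed
      have wc: "w \<in> carrier R" using pu_car[OF left_ideal_A w] .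
      have "b [^] D = b [^] Suc d \<otimes> b [^] e" unfolding D_def by (rule nat_pow_mult[OF b, symmetric])
      moreover have "u \<otimes> (a \<otimes> be \<oplus> q) = (c \<otimes> a) \<otimes> (bd \<otimes> be) \<oplus> (c \<otimes> (bd \<otimes> q) \<oplus> u' \<otimes> (a \<otimes> be \<oplus> q))"
        if "u = c \<otimes> bd \<oplus> u'" "be \<in> carrier R" "bd \<in> carrier R" for bd be
        unfolding that(1) using that(2,3) car by (simp add: l_distr r_distr m_ac a_ac)
      ultimately have prod: "u \<otimes> (a \<otimes> b [^] e \<oplus> q) = (c \<otimes> a) \<otimes> b [^] D \<oplus> w"
        using u_eq unfolding w_def by simp
      define X where "X = (c \<otimes> a) \<otimes> b [^] D"
      have Xc: "X \<in> carrier R" using car by (simp add: X_def)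
      have "\<one> = m \<oplus> (m' \<oplus> (a \<otimes> b [^] e \<oplus> q)) \<otimes> u" using mh(3) *(5) by simp
      also have "\<dots> = m \<oplus> (u \<otimes> m' \<oplus> u \<otimes> (a \<otimes> b [^] e \<oplus> q))"
        using car by (simp add: r_distr m_comm)
      finally have one: "\<one> = m \<oplus> (u \<otimes> m' \<oplus> (X \<oplus> w))" by (simp add: prod X_def)
      have "\<ominus> m \<ominus> u \<otimes> m' = \<ominus> m \<ominus> u \<otimes> m' \<oplus> (m \<oplus> (u \<otimes> m' \<oplus> (X \<oplus> w)) \<ominus> \<one>)"
        unfolding one[symmetric] using car by (simp add: r_neg minus_eq)
      also have "\<dots> = X \<oplus> (w \<ominus> \<one>)"
        using car Xc wc by algebra
      finally have "X \<oplus> (w \<ominus> \<one>) = \<ominus> m \<ominus> u \<otimes> m'" by simp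
      also have "\<dots> = \<zero> \<ominus> m \<ominus> u \<otimes> m'" using car by (simp add: minus_eq)
      also have "\<dots> \<in> poly_vals M b" using BI(5)[OF BI(5)[OF BI(2) mh(1)] BI(4)[OF u *(4)]] .
      finally have "c \<otimes> a \<in> M"
        unfolding X_def
      proof (rule coeff[rotated 2])
        show "w \<ominus> \<one> \<in> poly_upto A b D"
          by (rule pu_minus[OF left_ideal_A w pu_mono[OF left_ideal_A _ pu_const]]) (auto simp: D_def)
      qed (use lead_g * in simp)
      then show False using RA_prime[OF M(1)] lead_g(1) * M(2) by blast
    qed
  qed
  then obtain N where N: "left_maximal RB N" "J \<subseteq> N" using RB_maximal_exists[OF noeth J] by blast
  have NI: "left_ideal RB N" using N(1) by (simp add: left_maximal_def)
  have "g \<notin> N"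
  proof
    assume "g \<in> N"
    then have "u \<ominus> b \<otimes> g \<in> N" using ideal_B(5)[OF NI _ ideal_B(4)[OF NI b_B]] uJ N(2) by blast
    also have "u \<ominus> b \<otimes> g = \<one>" unfolding u_def using g(1) by (simp add: minus_eq a_assoc r_neg)
    finally show False using RB_maximal_one[OF N(1)] by simp
  qed
  then show ?thesis using N(1) by blast
qed

text \<open>The top coefficient \<open>a\<close> of the divisor need not be a unit, so each
  reduction step multiplies by \<open>a\<close> once more. The divisor \<open>y\<close> may be
  \<open>\<zero>\<close>: then the statement rewrites elements by means of an algebraic relation of
  \<open>b\<close>.\<close>

lemma pseudo_division:
  assumes y: "y = a \<otimes> b [^] k \<oplus> p" "a \<in> A" "p \<in> poly_upto A b k"
  shows "z \<in> poly_upto A b (k + m) \<Longrightarrow> \<exists>i::nat. \<exists>q\<in>poly_upto A b m. \<exists>r\<in>poly_upto A b k.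
    a [^] i \<otimes> z = q \<otimes> y \<oplus> r"
proof (induction m arbitrary: z)
  case 0
  then have "a [^] (0::nat) \<otimes> z = \<zero> \<otimes> y \<oplus> z"
    using y pu_car[OF left_ideal_A] by simp
  then show ?case using 0 by (intro exI[of _ 0] bexI[of _ \<zero>] bexI[of _ z]) auto
next
  case (Suc m)
  then obtain s t where st: "s \<in> A" "t \<in> poly_upto A b (k + m)" "z = s \<otimes> b [^] (k + m) \<oplus> t" by auto
  have car: "p \<in> carrier R" "t \<in> carrier R" using pu_car[OF left_ideal_A] y(3) st(2) by auto
  define w where "w = a \<otimes> t \<ominus> s \<otimes> (b [^] m \<otimes> p)"
  have w: "w \<in> poly_upto A b (k + m)"
    unfolding w_def using pu_minus[OF left_ideal_A pu_smult[OF left_ideal_A y(2) st(2)]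
        pu_smult[OF left_ideal_A st(1) pu_shift[OF left_ideal_A y(3), of m]]] .
  have wc: "w \<in> carrier R" "y \<in> carrier R" using pu_car[OF left_ideal_A w] y car by auto
  have "a \<otimes> (s \<otimes> (bk \<otimes> bm) \<oplus> t) = (s \<otimes> bm) \<otimes> (a \<otimes> bk \<oplus> p) \<oplus> (a \<otimes> t \<ominus> s \<otimes> (bm \<otimes> p))"
    if "bk \<in> carrier R" "bm \<in> carrier R" for bk bm
    using that car st(1)[THEN A_car] y(2)[THEN A_car] by algebra
  from this[of "b [^] k" "b [^] m"] have az: "a \<otimes> z = (s \<otimes> b [^] m) \<otimes> y \<oplus> w"
    unfolding st(3) y(1) w_def by (simp add: nat_pow_mult)
  obtain i q r where iqr: "q \<in> poly_upto A b m" "r \<in> poly_upto A b k" "a [^] (i::nat) \<otimes> w = q \<otimes> y \<oplus> r"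
    using Suc.IH[OF w] by blast
  have car2: "q \<in> carrier R" "r \<in> carrier R" "a [^] i \<in> carrier R" "s \<otimes> b [^] m \<in> carrier R" "z \<in> carrier R"
    using pu_car[OF left_ideal_A] iqr y(2) st Suc.prems by auto
  have "a [^] Suc i \<otimes> z = a [^] i \<otimes> (a \<otimes> z)" using y(2) car2 by (simp add: m_assoc)
  also have "\<dots> = a [^] i \<otimes> (s \<otimes> b [^] m) \<otimes> y \<oplus> a [^] i \<otimes> w"
    unfolding az using car2 wc by (simp add: r_distr m_assoc)
  also have "\<dots> = (a [^] i \<otimes> (s \<otimes> b [^] m) \<oplus> q) \<otimes> y \<oplus> r"
    unfolding iqr(3) using car2 wc by (simp add: l_distr a_assoc)
  finally have "a [^] Suc i \<otimes> z = ((a [^] i \<otimes> s) \<otimes> b [^] m \<oplus> q) \<otimes> y \<oplus> r"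
    using car2 st(1) by (simp add: m_assoc)
  moreover have "a [^] i \<in> A" by (induction i) (use y(2) in auto)
  then have "(a [^] i \<otimes> s) \<otimes> b [^] m \<oplus> q \<in> poly_upto A b (Suc m)"
    using pu_SucI[of "a [^] i \<otimes> s" A q m] iqr(1) st(1) by simp
  ultimately show ?case using iqr(2) by blast
qed

lemma A_pow: "a \<in> A \<Longrightarrow> a [^] (i::nat) \<in> A"
  by (induction i) auto

lemma pow_nonzero: "a \<in> carrier R \<Longrightarrow> a \<noteq> \<zero> \<Longrightarrow> a [^] (i::nat) \<noteq> \<zero>"
  by (induction i) (auto simp: integral_iff)

text \<open>Let \<open>y\<close> be a non-zero element of \<open>I\<close> of least formal degree
  \<open>d\<close>. If \<open>d > 0\<close>, dividing the minimal relation of \<open>b\<close> by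
  \<open>y\<close> gives \<open>t y + r = 0\<close> with \<open>r \<in> I\<close> of smaller degree.
  So \<open>r = 0\<close> and \<open>t = 0\<close>, although \<open>t\<close> has degree
  \<open>n - d < n\<close> and top coefficient \<open>a^i c \<noteq> 0\<close>; this contradicts the
  minimality of \<open>n\<close>.\<close>

lemma algebraic_meets:
  assumes rel: "c \<in> A" "c \<noteq> \<zero>" "p \<in> poly_upto A b n" "c \<otimes> b [^] n \<oplus> p = \<zero>"
    and min: "\<And>k a q. \<lbrakk>k < n; a \<in> A; q \<in> poly_upto A b k; a \<otimes> b [^] k \<oplus> q = \<zero>\<rbrakk> \<Longrightarrow> a = \<zero>"
    and I: "left_ideal RB I" "x \<in> I" "x \<noteq> \<zero>"
  obtains e where "e \<in> A" "e \<in> I" "e \<noteq> \<zero>"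
proof -
  have pc: "p \<in> carrier R" using pu_car[OF left_ideal_A rel(3)] .
  define k where "k = (LEAST k. \<exists>y. y \<in> I \<and> y \<noteq> \<zero> \<and> y \<in> poly_upto A b k)"
  have xB: "x \<in> B" using ideal_B(1)[OF I(1,2)] .
  then obtain n0 where n0: "x \<in> poly_upto A b n0" using pvE by blast
  then have "\<exists>y. y \<in> I \<and> y \<noteq> \<zero> \<and> y \<in> poly_upto A b n0" using I(2,3) by blast
  then have "\<exists>y. y \<in> I \<and> y \<noteq> \<zero> \<and> y \<in> poly_upto A b k"
    unfolding k_def by (rule LeastI)
  then obtain y where y: "y \<in> I" "y \<noteq> \<zero>" "y \<in> poly_upto A b k" by blast
  have least: "y' = \<zero>" if "y' \<in> I" "y' \<in> poly_upto A b j" "j < k" for y' j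
    using not_less_Least[of j "\<lambda>k. \<exists>y. y \<in> I \<and> y \<noteq> \<zero> \<and> y \<in> poly_upto A b k"] that
    unfolding k_def by blast
  obtain d a q where d: "d < k" "a \<in> A" "a \<noteq> \<zero>" "q \<in> poly_upto A b d" "y = a \<otimes> b [^] d \<oplus> q"
    using poly_upto_leading[OF y(3,2)] by metis
  have qc: "q \<in> carrier R" using pu_car[OF left_ideal_A d(4)] .
  have "y \<in> poly_upto A b (Suc d)" using pu_SucI[OF d(2,4)] d(5) by simp
  then have kd: "k = Suc d" using least[of y "Suc d"] d(1) y by (metis Suc_lessI)
  show thesis
  proof (cases "d = 0")
    case True
    then have "y = a" using d by simp
    then show thesis using that d y by blast
  next
    case False
    \<comment> \<open>Otherwise division by the relation, that is by \<open>\<zero>\<close>, turns a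
      multiple \<open>c^i y \<noteq> 0\<close> in \<open>I\<close> into an element of length
      \<open>n < k\<close>.\<close>
    have "k \<le> n"
    proof (rule ccontr)
      assume "\<not> k \<le> n"
      have "y \<in> poly_upto A b (n + (k - n))" using y(3) \<open>\<not> k \<le> n\<close> by simp
      then obtain i q' r where *: "q' \<in> poly_upto A b (k - n)" "r \<in> poly_upto A b n"
        "c [^] (i::nat) \<otimes> y = q' \<otimes> \<zero> \<oplus> r"
        using pseudo_division[OF rel(4)[symmetric] rel(1,3)] by blast
      then have "c [^] i \<otimes> y = r" using pu_car[OF left_ideal_A] by simp
      moreover have "c [^] i \<otimes> y \<in> I" using ideal_B(4)[OF I(1) A_sub_B[OF A_pow[OF rel(1)]] y(1)] .
      moreover have "c [^] i \<otimes> y \<noteq> \<zero>"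
        using pow_nonzero[of c i] rel(1,2) y(2) B_car[OF ideal_B(1)[OF I(1) y(1)]] by (simp add: integral_iff)
      ultimately show False using least[of r n] *(2) \<open>\<not> k \<le> n\<close> by simp
    qed
    then have dn: "d < n" using kd by simp
    \<comment> \<open>\<open>w\<close> is what remains of \<open>a\<close> times the relation after
      its top term has been cancelled by a multiple of \<open>y\<close>.\<close>
    define w where "w = a \<otimes> p \<ominus> c \<otimes> (b [^] (n - d) \<otimes> q)"
    have w: "w \<in> poly_upto A b (d + (n - d))"
      unfolding w_def using pu_minus[OF left_ideal_A _ pu_smult[OF left_ideal_A rel(1) pu_shift[OF left_ideal_A d(4), of "n - d"]]]
        pu_smult[OF left_ideal_A d(2) rel(3)] dn by simp
    obtain i q' r where *: "q' \<in> poly_upto A b (n - d)" "r \<in> poly_upto A b d"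
      "a [^] (i::nat) \<otimes> w = q' \<otimes> y \<oplus> r"
      using pseudo_division[OF d(5,2,4) w] by blast
    have car: "w \<in> carrier R" "q' \<in> carrier R" "r \<in> carrier R" "y \<in> carrier R" "a [^] i \<in> carrier R" "c \<in> carrier R" "a \<in> carrier R"
      using pu_car[OF left_ideal_A] w * y(3) rel(1) d(2) by auto
    have "a \<otimes> (c \<otimes> (bd \<otimes> bm) \<oplus> p) = (c \<otimes> bm) \<otimes> (a \<otimes> bd \<oplus> q) \<oplus> (a \<otimes> p \<ominus> c \<otimes> (bm \<otimes> q))"
      if "bd \<in> carrier R" "bm \<in> carrier R" for bd bm
      using that car pc qc by algebra
    from this[of "b [^] d" "b [^] (n - d)"] have "a \<otimes> \<zero> = (c \<otimes> b [^] (n - d)) \<otimes> y \<oplus> w"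
      unfolding rel(4)[symmetric] d(5) w_def using dn by (simp add: nat_pow_mult)
    then have zero: "(c \<otimes> b [^] (n - d)) \<otimes> y \<oplus> w = \<zero>" using car by simp
    define t where "t = (a [^] i \<otimes> c) \<otimes> b [^] (n - d) \<oplus> q'"
    have tc: "t \<in> carrier R" using car by (simp add: t_def)
    have "t \<otimes> y \<oplus> r = a [^] i \<otimes> ((c \<otimes> b [^] (n - d)) \<otimes> y) \<oplus> (q' \<otimes> y \<oplus> r)"
      unfolding t_def using car by (simp add: l_distr m_assoc a_assoc)
    also have "\<dots> = a [^] i \<otimes> ((c \<otimes> b [^] (n - d)) \<otimes> y \<oplus> w)"
      unfolding *(3)[symmetric] using car by (simp add: r_distr)
    also have "\<dots> = \<zero>" unfolding zero using car by simp
    finally have ty: "t \<otimes> y \<oplus> r = \<zero>" .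
    have aic: "a [^] i \<otimes> c \<in> A" using A_pow[OF d(2)] rel(1) by simp
    have tB: "t \<in> B" using pvI[OF pu_SucI[OF aic *(1)]] by (simp add: t_def)
    have "r = \<ominus> (t \<otimes> y)" using minus_equality[of r "t \<otimes> y"] ty tc car by (simp add: a_comm)
    then have "r = \<zero> \<ominus> t \<otimes> y" using tc car by (simp add: minus_eq)
    then have "r \<in> I" using ideal_B(5)[OF I(1) ideal_B(2)[OF I(1)] ideal_B(4)[OF I(1) tB y(1)]] by simp
    then have "r = \<zero>" using least *(2) d(1) by blast
    then have "t = \<zero>" using ty tc car y(2) by (simp add: integral_iff)
    then have "a [^] i \<otimes> c = \<zero>" using min[OF _ aic *(1)] dn False by (simp add: t_def)
    then show thesis using pow_nonzero[of a i] d(2,3) rel(1,2) by (simp add: integral_iff)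
  qed
qed

text \<open>The ideal \<open>gB\<close> contains some \<open>e \<noteq> 0\<close> of
  \<open>A\<close>. Choose \<open>M\<close> maximal in \<open>A\<close> with \<open>c e\<close>
  outside \<open>M\<close>. Since \<open>c\<close> is not in \<open>M\<close>, the powers of
  \<open>b\<close> can be reduced below \<open>n\<close> modulo denominators outside
  \<open>M\<close>, and so \<open>MB\<close> is proper. A maximal ideal above \<open>MB\<close> that
  contained \<open>g\<close> would contain \<open>e\<close>, hence
  \<open>M + Ae = A\<close>.\<close>

lemma algebraic_case:
  assumes rel: "c \<in> A" "c \<noteq> \<zero>" "p \<in> poly_upto A b n" "c \<otimes> b [^] n \<oplus> p = \<zero>"
    and min: "\<And>k a q. \<lbrakk>k < n; a \<in> A; q \<in> poly_upto A b k; a \<otimes> b [^] k \<oplus> q = \<zero>\<rbrakk> \<Longrightarrow> a = \<zero>"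
    and noeth: "left_noetherian RB" and jac: "zero_jacobson RA" and g: "g \<in> B" "g \<noteq> \<zero>"
  shows "\<exists>M. left_maximal RB M \<and> g \<notin> M"
proof -
  have pc: "p \<in> carrier R" using pu_car[OF left_ideal_A rel(3)] .
  have gI: "left_ideal RB (principal_left RB g)"
    using ring.left_ideal_right_mult[OF cring.axioms(1)[OF RB_cring]
        ring.left_ideal_carrier[OF cring.axioms(1)[OF RB_cring]], of g] g by simp
  have gg: "g \<in> principal_left RB g" using g by (intro image_eqI[of _ _ \<one>]) auto
  have "\<exists>e. e \<in> A \<and> e \<in> principal_left RB g \<and> e \<noteq> \<zero>"
  proof (rule algebraic_meets[OF rel _ gI gg g(2)])
    show "a = \<zero>" if "k < n" "a \<in> A" "q \<in> poly_upto A b k" "a \<otimes> b [^] k \<oplus> q = \<zero>" for k a q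
      by (rule min[OF that])
  qed blast
  then obtain e where e: "e \<in> A" "e \<in> principal_left RB g" "e \<noteq> \<zero>"
    by blast
  have "c \<otimes> e \<noteq> \<zero>" using rel(1,2) e(1,3) by (simp add: integral_iff)
  then obtain M where M: "left_maximal RA M" "c \<otimes> e \<notin> M"
    using jac rel(1) e(1) by (auto simp: zero_jacobson_def)
  have MI: "left_ideal RA M" using M(1) by (simp add: left_maximal_def)
  note MA = ideal_A[OF MI]
  have "e \<notin> M" using M(2) MA(4)[OF rel(1)] by blast
  have "c \<notin> M" using M(2) MA(4)[OF e(1), of c] rel(1) e(1) by (auto simp: m_comm)
  \<comment> \<open>Below the degree of the minimal relation coefficients are unique, so an element
    of \<open>A\<close> with coefficients in \<open>M\<close> is itself in \<open>M\<close>.\<close>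
  have low: "u \<in> poly_upto M b N \<Longrightarrow> N \<le> n \<Longrightarrow> u \<in> M" if u: "u \<in> A" for u N
  proof (induction N)
    case 0
    then show ?case using MA(2) by simp
  next
    case (Suc k)
    then obtain m q where m: "m \<in> M" "q \<in> poly_upto M b k" "u = m \<otimes> b [^] k \<oplus> q" by auto
    have car: "m \<in> carrier R" "q \<in> carrier R" using MA(1)[OF m(1)] pu_car[OF MI m(2)] by auto
    show ?case
    proof (cases k)
      case 0
      then show ?thesis using m car by simp
    next
      case (Suc k')
      have uk: "u \<in> poly_upto A b k" by (rule pu_mono[OF left_ideal_A _ pu_const[OF u A_car[OF u]]]) (use Suc in simp)
      have "m \<otimes> b [^] k \<oplus> (q \<ominus> u) = (m \<otimes> b [^] k \<oplus> q) \<ominus> u"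
        using car u by (simp add: minus_eq a_ac)
      also have "\<dots> = \<zero>" unfolding m(3)[symmetric] using u by (simp add: minus_eq r_neg)
      finally have "m = \<zero>"
        using min[of k m "q \<ominus> u"] Suc.prems MA(1)[OF m(1)]
          pu_minus[OF left_ideal_A pu_mono_set[OF _ m(2)] uk] MA(1) by auto
      then have "u = q" using m(3) car by simp
      then show ?thesis using Suc.IH Suc.prems m(2) by simp
    qed
  qed
  \<comment> \<open>In degree at least \<open>n\<close> the relation replaces \<open>c b^k\<close>
    by lower terms. This changes \<open>u\<close> into \<open>c \<otimes> u\<close>, which stays
    outside the prime ideal \<open>M\<close>.\<close>
  have no: "u \<in> A \<Longrightarrow> u \<notin> M \<Longrightarrow> u \<notin> poly_upto M b N" for u N
  proof (induction N arbitrary: u)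
    case 0
    then show ?case using MA(2) by auto
  next
    case (Suc k)
    show ?case
    proof (cases "Suc k \<le> n")
      case True
      then show ?thesis using low Suc.prems by blast
    next
      case False
      show ?thesis
      proof
        assume "u \<in> poly_upto M b (Suc k)"
        then obtain m q where m: "m \<in> M" "q \<in> poly_upto M b k" "u = m \<otimes> b [^] k \<oplus> q" by auto
        have car: "m \<in> carrier R" "q \<in> carrier R" "c \<in> carrier R"
          using MA(1)[OF m(1)] pu_car[OF MI m(2)] rel(1) by auto
        have nk: "n + (k - n) = k" using False by simp
        have P: "b [^] (k - n) \<otimes> p \<in> poly_upto A b k"
          using pu_shift[OF left_ideal_A rel(3), of "k - n"] nk by simp
        have "c \<otimes> (m \<otimes> (bn \<otimes> bk) \<oplus> q) = m \<otimes> bk \<otimes> (c \<otimes> bn \<oplus> p) \<oplus> (c \<otimes> q \<ominus> m \<otimes> (bk \<otimes> p))"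
          if "bn \<in> carrier R" "bk \<in> carrier R" for bn bk
          using that car pc by algebra
        from this[of "b [^] n" "b [^] (k - n)"]
        have "c \<otimes> u = c \<otimes> q \<ominus> m \<otimes> (b [^] (k - n) \<otimes> p)"
          unfolding m(3) rel(4) using nk car pc by (simp add: nat_pow_mult)
        moreover have "c \<otimes> q \<ominus> m \<otimes> (b [^] (k - n) \<otimes> p) \<in> poly_upto M b k"
          by (rule pu_minus[OF MI pu_smult[OF MI rel(1) m(2)] pu_smult_set[OF MI m(1) P]])
        moreover have "c \<otimes> u \<notin> M" using RA_prime[OF M(1) rel(1) Suc.prems(1)] \<open>c \<notin> M\<close> Suc.prems(2) by blast
        then have "c \<otimes> u \<notin> poly_upto M b k" using rel(1) Suc.prems(1) by (intro Suc.IH) simp_all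
        ultimately show False by simp
      qed
    qed
  qed
  have "\<one> \<notin> poly_vals M b" using no[of \<one>] RA_maximal_one[OF M(1)] pvE by auto
  then obtain N where N: "left_maximal RB N" "poly_vals M b \<subseteq> N"
    using RB_maximal_exists[OF noeth left_ideal_pv[OF MI]] by blast
  have NI: "left_ideal RB N" using N(1) by (simp add: left_maximal_def)
  have "g \<notin> N"
  proof
    assume "g \<in> N"
    then have eN: "e \<in> N" using e(2) ideal_B(4)[OF NI] by auto
    let ?K = "ideal_plus RA M (principal_left RA e)"
    interpret RA: cring RA by (rule RA_cring)
    have eI: "left_ideal RA (principal_left RA e)"
      using RA.left_ideal_right_mult[OF RA.left_ideal_carrier, of e] e(1) by simp
    have ee: "e \<in> principal_left RA e" using e(1) by (intro image_eqI[of _ _ \<one>]) auto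
    have "left_ideal RA ?K" by (rule RA.left_ideal_sum[OF MI eI])
    moreover have "M \<subseteq> ?K" "e \<in> ?K" using RA.left_ideal_sum_upper[OF MI eI] ee by blast+
    ultimately have "?K = carrier RA" using M(1) \<open>e \<notin> M\<close> unfolding left_maximal_def by blast
    then have "\<one> \<in> ?K" by simp
    then obtain m h where mh: "m \<in> M" "h \<in> A" "\<one> = m \<oplus> h \<otimes> e" by auto
    have "m \<in> N" using N(2) pvI[OF pu_const[OF mh(1)]] MA(1)[OF mh(1)] by auto
    then have "\<one> \<in> N" using mh(3) ideal_B(3)[OF NI _ ideal_B(4)[OF NI A_sub_B[OF mh(2)] eN]] by metis
    then show False using RB_maximal_one[OF N(1)] by simp
  qed
  then show ?thesis using N(1) by blast
qed

theorem zero_jacobson_adjoin: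
  assumes "left_noetherian RB" "zero_jacobson RA"
  shows "zero_jacobson RB"
  unfolding zero_jacobson_def
proof (intro ballI impI)
  fix g assume "g \<in> carrier RB" "g \<noteq> \<zero>\<^bsub>RB\<^esub>"
  then have g: "g \<in> B" "g \<noteq> \<zero>" by auto
  let ?P = "\<lambda>n. \<exists>c p. c \<in> A \<and> c \<noteq> \<zero> \<and> p \<in> poly_upto A b n \<and> c \<otimes> b [^] n \<oplus> p = \<zero>"
  show "\<exists>M. left_maximal RB M \<and> g \<notin> M"
  proof (cases "\<exists>n. ?P n")
    case True
    define n where "n = (LEAST n. ?P n)"
    have "?P n" unfolding n_def by (rule LeastI_ex[OF True])
    then obtain c p where cp: "c \<in> A" "c \<noteq> \<zero>" "p \<in> poly_upto A b n" "c \<otimes> b [^] n \<oplus> p = \<zero>" by blast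
    show ?thesis
    proof (rule algebraic_case[OF cp _ assms g])
      fix k a q assume "k < n" "a \<in> A" "q \<in> poly_upto A b k" "a \<otimes> b [^] k \<oplus> q = \<zero>"
      then show "a = \<zero>" using not_less_Least[of k ?P] unfolding n_def by blast
    qed
  next
    case False
    show ?thesis by (rule transcendental_case[OF _ assms g]) (use False in blast)
  qed
qed

end


section \<open>Affine domains\<close>

lemma (in cring) division_left_ideals:
  assumes "\<And>x. \<lbrakk>x \<in> carrier R; x \<noteq> \<zero>\<rbrakk> \<Longrightarrow> \<exists>y\<in>carrier R. y \<otimes> x = \<one>" "left_ideal R I"
  shows "I = {\<zero>} \<or> I = carrier R"
proof (cases "I = {\<zero>}")
  case False
  then obtain x where x: "x \<in> I" "x \<noteq> \<zero>" using left_idealD(3)[OF assms(2)] by blast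
  have "x \<in> carrier R" by (rule left_idealD(2)[OF assms(2) x(1)])
  then obtain y where "y \<in> carrier R" "y \<otimes> x = \<one>" using assms(1) x(2) by blast
  then show ?thesis using left_ideal_one[OF assms(2)] left_idealD(5)[OF assms(2) _ x(1), of y] by simp
qed simp

text \<open>The image of \<open>K\<close> is a field, whose only ideals are zero and itself; the
  generators are then adjoined one at a time. All intermediate rings are subrings of the domain
  \<open>R\<close>, as the adjunction step requires.\<close>

lemma (in domain) affine_noetherian_jacobson:
  fixes K :: "('k, 'c) ring_scheme"
  assumes K: "field K" and h: "h \<in> ring_hom K R"
    and F: "finite F" "F \<subseteq> carrier R"
  shows "left_noetherian (R\<lparr>carrier := generate_ring R (h ` carrier K \<union> F)\<rparr>) \<and>
    zero_jacobson (R\<lparr>carrier := generate_ring R (h ` carrier K \<union> F)\<rparr>)"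
proof -
  interpret K: field K by (rule K)
  interpret h: ring_hom_ring K R h
    using h by (intro ring_hom_ring.intro ring_hom_ring_axioms.intro K.ring_axioms ring_axioms)
  have hK: "h ` carrier K \<subseteq> carrier R" by auto
  have gen0: "generate_ring R (h ` carrier K) = h ` carrier K"
    using generate_ringI[OF hK h.img_is_subring[OF K.carrier_is_subring]] by blast
  define A where "A = h ` carrier K"
  have A: "subring A R" unfolding A_def by (rule h.img_is_subring[OF K.carrier_is_subring])
  \<comment> \<open>Adjoining \<open>\<zero>\<close> is a formality that supplies the ring structure
    on \<open>A\<close>.\<close>
  have "adjoin R A \<zero>" by (intro adjoin.intro adjoin_axioms.intro A is_cring zero_closed)
  then interpret A: cring "R\<lparr>carrier := A\<rparr>" by (rule adjoin.RA_cring)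
  have inv: "\<exists>y\<in>A. y \<otimes> x = \<one>" if "x \<in> A" "x \<noteq> \<zero>" for x
  proof -
    obtain k where k: "k \<in> carrier K" "x = h k" using \<open>x \<in> A\<close> by (auto simp: A_def)
    then have "k \<noteq> \<zero>\<^bsub>K\<^esub>" using \<open>x \<noteq> \<zero>\<close> by auto
    then have "k \<in> Units K" using k(1) K.field_Units by blast
    then have i: "inv\<^bsub>K\<^esub> k \<in> carrier K" "inv\<^bsub>K\<^esub> k \<otimes>\<^bsub>K\<^esub> k = \<one>\<^bsub>K\<^esub>" by simp_all
    have "h (inv\<^bsub>K\<^esub> k) \<otimes> x = \<one>" unfolding k(2) using h.hom_mult[OF i(1) k(1)] i(2) h.hom_one by simp
    then show ?thesis using i(1) unfolding A_def by blast
  qed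
  have ideals: "I = {\<zero>} \<or> I = A" if "left_ideal (R\<lparr>carrier := A\<rparr>) I" for I
    using A.division_left_ideals[OF _ that] inv by simp
  have base: "left_noetherian (R\<lparr>carrier := A\<rparr>)"
    unfolding left_noetherian_def
  proof (intro allI impI)
    fix H :: "nat \<Rightarrow> 'a set"
    assume H: "(\<forall>n. left_ideal (R\<lparr>carrier := A\<rparr>) (H n)) \<and> (\<forall>n. H n \<subseteq> H (Suc n))"
    have mono: "H n \<subseteq> H m" if "n \<le> m" for n m using lift_Suc_mono_le[of H] H that by blast
    have I: "H n = {\<zero>} \<or> H n = A" for n using ideals H by blast
    show "\<exists>n. \<forall>m\<ge>n. H m = H n"
    proof (cases "\<exists>n. H n = A")
      case True
      then obtain n where n: "H n = A" by blast
      have "H m = H n" if "m \<ge> n" for m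
        using mono[OF that] I[of m] n subringE(2)[OF A] by auto
      then show ?thesis by blast
    next
      case False
      then have "H n = {\<zero>}" for n using I by blast
      then show ?thesis by simp
    qed
  qed
  have base2: "zero_jacobson (R\<lparr>carrier := A\<rparr>)"
    unfolding zero_jacobson_def
  proof (intro ballI impI)
    fix g assume g: "g \<in> carrier (R\<lparr>carrier := A\<rparr>)" "g \<noteq> \<zero>\<^bsub>R\<lparr>carrier := A\<rparr>\<^esub>"
    have "left_maximal (R\<lparr>carrier := A\<rparr>) {\<zero>}"
      unfolding left_maximal_def
    proof (intro conjI allI impI)
      show "left_ideal (R\<lparr>carrier := A\<rparr>) {\<zero>}" using A.left_ideal_zero by simp
      show "{\<zero>} \<noteq> carrier (R\<lparr>carrier := A\<rparr>)" using g by auto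
      fix H assume "left_ideal (R\<lparr>carrier := A\<rparr>) H \<and> {\<zero>} \<subseteq> H"
      then show "H = {\<zero>} \<or> H = carrier (R\<lparr>carrier := A\<rparr>)" using ideals[of H] by simp
    qed
    then show "\<exists>M. left_maximal (R\<lparr>carrier := A\<rparr>) M \<and> g \<notin> M" using g by auto
  qed
  from F show ?thesis
  proof (induction F)
    case empty
    then show ?case using base base2 gen0 by (simp add: A_def)
  next
    case (insert b F)
    have sub: "h ` carrier K \<union> F \<subseteq> carrier R" using hK insert.prems by blast
    interpret adjoin_domain R "generate_ring R (h ` carrier K \<union> F)" b
      using insert.prems
      by (intro adjoin_domain.intro adjoin.intro adjoin_axioms.intro is_cring domain_axioms
          generate_ring_is_subring[OF sub]) simp
    have eq: "generate_ring R (h ` carrier K \<union> insert b F) = B"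
      using generate_ring_insert[OF sub refl] by simp
    have "left_noetherian RA" "zero_jacobson RA" using insert by auto
    then show ?case unfolding eq using hilbert_basis zero_jacobson_adjoin by blast
  qed
qed

lemma affine_hom:
  assumes "algebra K R"
  shows "(\<lambda>k. k \<odot>\<^bsub>R\<^esub> \<one>\<^bsub>R\<^esub>) \<in> ring_hom K R"
proof -
  interpret algebra K R by fact
  show ?thesis
  proof (rule ring_hom_memI)
    fix x y assume xy: "x \<in> carrier K" "y \<in> carrier K"
    have "(x \<otimes>\<^bsub>K\<^esub> y) \<odot>\<^bsub>R\<^esub> \<one>\<^bsub>R\<^esub> = x \<odot>\<^bsub>R\<^esub> (\<one>\<^bsub>R\<^esub> \<otimes>\<^bsub>R\<^esub> (y \<odot>\<^bsub>R\<^esub> \<one>\<^bsub>R\<^esub>))"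
      using xy by (simp add: smult_assoc1)
    also have "\<dots> = (x \<odot>\<^bsub>R\<^esub> \<one>\<^bsub>R\<^esub>) \<otimes>\<^bsub>R\<^esub> (y \<odot>\<^bsub>R\<^esub> \<one>\<^bsub>R\<^esub>)"
      by (rule smult_assoc2[symmetric]) (use xy in auto)
    finally show "(x \<otimes>\<^bsub>K\<^esub> y) \<odot>\<^bsub>R\<^esub> \<one>\<^bsub>R\<^esub> = (x \<odot>\<^bsub>R\<^esub> \<one>\<^bsub>R\<^esub>) \<otimes>\<^bsub>R\<^esub> (y \<odot>\<^bsub>R\<^esub> \<one>\<^bsub>R\<^esub>)" .
  qed (auto simp: smult_l_distr)
qed

theorem affine_domain:
  assumes "field K" "affine_algebra K R" "domain R"
  shows "left_noetherian R" "zero_jacobson R"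
proof -
  interpret domain R by fact
  obtain F where F: "finite F" "F \<subseteq> carrier R"
    "generate_ring R ((\<lambda>k. k \<odot>\<^bsub>R\<^esub> \<one>\<^bsub>R\<^esub>) ` carrier K \<union> F) = carrier R" and alg: "algebra K R"
    using assms(2) by (auto simp: affine_algebra_def)
  show "left_noetherian R" "zero_jacobson R"
    using affine_noetherian_jacobson[OF assms(1) affine_hom[OF alg] F(1,2)] F(3)
    by (simp_all add: left_noetherian_def zero_jacobson_def left_maximal_def left_ideal_def)
qed

text \<open>Positive integers are images of units of \<open>K\<close>. Invertibility, rather than
  mere non-vanishing, is what allows dividing by them inside a prime ideal of
  \<open>R\<close>.\<close>

lemma affine_char_zero_Units:
  assumes "field K" "affine_algebra K R" "[n] \<cdot>\<^bsub>K\<^esub> \<one>\<^bsub>K\<^esub> \<noteq> \<zero>\<^bsub>K\<^esub>"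
  shows "[(n::nat)] \<cdot>\<^bsub>R\<^esub> \<one>\<^bsub>R\<^esub> \<in> Units R"
proof -
  interpret K: field K by fact
  have alg: "algebra K R" using assms(2) by (simp add: affine_algebra_def)
  interpret R: cring R using alg by (simp add: algebra_def)
  interpret h: ring_hom_ring K R "\<lambda>k. k \<odot>\<^bsub>R\<^esub> \<one>\<^bsub>R\<^esub>"
    using affine_hom[OF alg]
    by (intro ring_hom_ring.intro ring_hom_ring_axioms.intro K.ring_axioms R.ring_axioms)
  have eq: "([n] \<cdot>\<^bsub>K\<^esub> \<one>\<^bsub>K\<^esub>) \<odot>\<^bsub>R\<^esub> \<one>\<^bsub>R\<^esub> = [n] \<cdot>\<^bsub>R\<^esub> \<one>\<^bsub>R\<^esub>" for n :: nat
    using h.hom_one by (induction n) auto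
  let ?k = "[n] \<cdot>\<^bsub>K\<^esub> \<one>\<^bsub>K\<^esub>"
  have k: "?k \<in> Units K" using assms(3) K.field_Units by auto
  then have i: "inv\<^bsub>K\<^esub> ?k \<in> carrier K" "inv\<^bsub>K\<^esub> ?k \<otimes>\<^bsub>K\<^esub> ?k = \<one>\<^bsub>K\<^esub>" "?k \<in> carrier K" by simp_all
  have "(inv\<^bsub>K\<^esub> ?k) \<odot>\<^bsub>R\<^esub> \<one>\<^bsub>R\<^esub> \<otimes>\<^bsub>R\<^esub> (?k \<odot>\<^bsub>R\<^esub> \<one>\<^bsub>R\<^esub>) = \<one>\<^bsub>R\<^esub>"
    using h.hom_mult[OF i(1,3)] i(2) h.hom_one by simp
  then show ?thesis
    using eq[of n] h.hom_closed[OF i(1)] h.hom_closed[OF i(3)]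
    unfolding Units_def by (intro CollectI conjI bexI) (simp_all add: R.m_comm)
qed

section \<open>Noetherian domains of dimension at most one\<close>

context domain
begin

lemma krull_dim_le_1_maximal:
  assumes "left_noetherian R" "krull_dim R \<le> 1" "primeideal P R" "P \<noteq> {\<zero>}"
  shows "maximalideal P R"
proof (rule ccontr)
  assume "\<not> maximalideal P R"
  have P: "left_ideal R P" using assms(3) left_ideal_iff_ideal primeideal.axioms(1) by blast
  have "\<one> \<notin> P" using left_ideal_one[OF P] primeideal.I_notcarr[OF assms(3)] by auto
  then obtain M where M: "left_maximal R M" "P \<subseteq> M" using left_maximal_exists[OF assms(1) P] by blast
  have mM: "maximalideal M R" using M(1) left_maximal_iff_maximalideal by blast
  then have "P \<subset> M" using M(2) \<open>\<not> maximalideal P R\<close> by blast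
  have "{\<zero>} \<subset> P" using assms(4) left_idealD(3)[OF P] by blast
  let ?C = "\<lambda>i::nat. if i = 0 then {\<zero>} else if i = 1 then P else M"
  have "(\<forall>i\<le>2. primeideal (?C i) R) \<and> (\<forall>i<2. ?C i \<subset> ?C (Suc i))"
    using zeroprimeideal assms(3) maximalideal_prime[OF mM] \<open>P \<subset> M\<close> \<open>{\<zero>} \<subset> P\<close>
    by (auto simp: less_2_cases_iff)
  then have "enat 2 \<in> {enat n | n. \<exists>P :: nat \<Rightarrow> 'a set.
      (\<forall>i\<le>n. primeideal (P i) R) \<and> (\<forall>i<n. P i \<subset> P (Suc i))}"
    by (intro CollectI exI[of _ 2] conjI refl exI[of _ ?C]) blast+
  then have "enat 2 \<le> krull_dim R" unfolding krull_dim_def by (rule Sup_upper)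
  then have "enat 2 \<le> 1" using assms(2) by (rule order_trans)
  then show False by (simp add: one_enat_def)
qed

text \<open>The bottom of a chain of three primes need not be zero, but it forces the middle one to
  be non-zero.\<close>

lemma krull_dim_gt_1_primes:
  assumes "\<not> krull_dim R \<le> 1"
  obtains P M where "primeideal P R" "primeideal M R" "P \<noteq> {\<zero>}" "P \<subset> M"
proof -
  have "\<exists>x\<in>{enat n | n. \<exists>P :: nat \<Rightarrow> 'a set.
      (\<forall>i\<le>n. primeideal (P i) R) \<and> (\<forall>i<n. P i \<subset> P (Suc i))}. \<not> x \<le> 1"
    using assms Sup_least unfolding krull_dim_def by blast
  then obtain n C where C: "\<forall>i\<le>n. primeideal (C i) R" "\<forall>i<n. C i \<subset> C (Suc i)" "\<not> enat n \<le> 1"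
    by blast
  then have n: "1 < n" by (simp add: one_enat_def)
  have sub: "C 0 \<subset> C 1" "C 1 \<subset> C (Suc 1)" using C(2) n by auto
  have prime: "primeideal (C 0) R" "primeideal (C 1) R" "primeideal (C (Suc 1)) R" using C(1) n by auto
  have "\<zero> \<in> C 0"
    using prime(1) by (intro additive_subgroup.zero_closed ideal.axioms(1) primeideal.axioms(1))
  then have "C 1 \<noteq> {\<zero>}" using sub(1) by auto
  then show thesis by (rule that[OF prime(2,3) _ sub(2)])
qed

text \<open>Noetherian induction: let \<open>I\<close> be maximal among the non-zero ideals that
  fail. If \<open>I\<close> is prime it is maximal, and no chain above it can fail. Otherwise
  \<open>a b \<in> I\<close> with \<open>a\<close> and \<open>b\<close> outside \<open>I\<close>,
  and both \<open>I + aR\<close> and \<open>(I : a)\<close> are strictly larger, so the chain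
  becomes stable in each of them.\<close>

lemma dcc_above_nonzero_ideal:
  assumes noeth: "left_noetherian R" and dim: "\<And>P. \<lbrakk>primeideal P R; P \<noteq> {\<zero>}\<rbrakk> \<Longrightarrow> maximalideal P R"
    and J: "left_ideal R J" "J \<noteq> {\<zero>}"
  shows "dcc_above R J"
proof (rule ccontr)
  assume bad: "\<not> dcc_above R J"
  let ?F = "{J. left_ideal R J \<and> J \<noteq> {\<zero>} \<and> \<not> dcc_above R J}"
  obtain I where I: "I \<in> ?F" "\<And>K. \<lbrakk>K \<in> ?F; I \<subseteq> K\<rbrakk> \<Longrightarrow> K = I"
    using left_noetherian_maximal[OF noeth, of ?F] bad J by blast
  have II: "left_ideal R I" "I \<noteq> {\<zero>}" "\<not> dcc_above R I" using I(1) by auto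
  have good: "dcc_above R K" if K: "left_ideal R K" "I \<subset> K" for K
  proof -
    have "K \<noteq> {\<zero>}" using K(2) II(1,2) left_idealD(3)[OF II(1)] by blast
    then show ?thesis using I(2)[of K] K by blast
  qed
  obtain H :: "nat \<Rightarrow> 'a set" where H: "\<And>n. left_ideal R (H n)" "\<And>n. I \<subseteq> H n" "\<And>n. H (Suc n) \<subseteq> H n"
    and unstable: "\<not> (\<exists>n. \<forall>m\<ge>n. H m = H n)"
    using II(3) unfolding dcc_above_def by blast
  have anti: "H m \<subseteq> H n" if "n \<le> m" for n m using lift_Suc_antimono_le[of H] H(3) that by blast
  have not1: "H n \<noteq> carrier R" if "H m = I" for n m
    using that by (metis anti H(2) unstable subset_antisym)
  show False
  proof (cases "\<exists>a b. a \<in> carrier R \<and> b \<in> carrier R \<and> a \<otimes> b \<in> I \<and> a \<notin> I \<and> b \<notin> I")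
    case False
    have "I \<noteq> carrier R"
    proof
      assume "I = carrier R"
      then have "H n = carrier R" for n using H(2)[of n] left_idealD(1)[OF H(1)[of n]] by blast
      then show False using unstable by simp
    qed
    then have "primeideal I R"
      using False II(1) left_ideal_iff_ideal by (intro primeidealI is_cring) blast+
    then have "left_maximal R I" using dim II(2) left_maximal_iff_maximalideal by blast
    then have "H n = I \<or> H n = carrier R" for n using H(1,2) by (auto simp: left_maximal_def)
    then show False using not1 unstable by metis
  next
    case True
    then obtain a b where ab: "a \<in> carrier R" "b \<in> carrier R" "b \<otimes> a \<in> I" "a \<notin> I" "b \<notin> I"
      by (auto simp: m_comm)
    let ?aR = "principal_left R a"
    have aR: "left_ideal R ?aR" by (rule left_ideal_right_mult[OF left_ideal_carrier ab(1)])
    have a_aR: "a \<in> ?aR" using ab(1) by (intro image_eqI[of _ _ \<one>]) auto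
    define s where "s K = ideal_plus R K ?aR" for K
    define t where "t K = {x \<in> carrier R. x \<otimes> a \<in> K}" for K
    have s: "left_ideal R (s K)" "K \<subseteq> s K" "a \<in> s K" if "left_ideal R K" for K
      using left_ideal_sum[OF that aR] left_ideal_sum_upper[OF that aR] a_aR unfolding s_def by blast+
    have t: "left_ideal R (t K)" if "left_ideal R K" for K
      using left_ideal_colon[OF that ab(1)] unfolding t_def .
    have "I \<subseteq> t I"
    proof
      fix x assume "x \<in> I"
      then have "x \<in> carrier R" "a \<otimes> x \<in> I" using left_idealD(2,5)[OF II(1)] ab(1) by blast+
      then show "x \<in> t I" using ab(1) by (simp add: t_def m_comm)
    qed
    moreover have "b \<in> t I" using ab by (simp add: t_def)
    ultimately have "dcc_above R (t I)" using good[OF t[OF II(1)]] ab(5) by blast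
    moreover have "t I \<subseteq> t (H n)" "t (H (Suc n)) \<subseteq> t (H n)" for n using H(2,3) by (auto simp: t_def)
    ultimately obtain n1 where n1: "\<forall>m\<ge>n1. t (H m) = t (H n1)"
      unfolding dcc_above_def using t[OF H(1)] by (elim allE[of _ "\<lambda>n. t (H n)"]) blast
    have "I \<subset> s I" using s[OF II(1)] ab(4) by blast
    then have "dcc_above R (s I)" using good[OF s(1)[OF II(1)]] by blast
    moreover have "s I \<subseteq> s (H n)" "s (H (Suc n)) \<subseteq> s (H n)" for n using H(2,3) unfolding s_def by blast+
    ultimately obtain n2 where n2: "\<forall>m\<ge>n2. s (H m) = s (H n2)"
      unfolding dcc_above_def using s(1)[OF H(1)] by (elim allE[of _ "\<lambda>n. s (H n)"]) blast
    define n where "n = max n1 n2"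
    \<comment> \<open>Modular law: \<open>x \<in> H n\<close> is \<open>h + r a\<close> with
      \<open>h \<in> H m\<close> because the sums with \<open>aR\<close> agree; then
      \<open>r a \<in> H n\<close>, and equality of the colon ideals gives
      \<open>r a \<in> H m\<close>.\<close>
    have "H m = H n" if m: "m \<ge> n" for m
    proof
      show "H m \<subseteq> H n" by (rule anti[OF m])
      show "H n \<subseteq> H m"
      proof
        fix x assume x: "x \<in> H n"
        have "s (H n) = s (H m)" "t (H n) = t (H m)"
          using n1[rule_format, of n] n1[rule_format, of m] n2[rule_format, of n] n2[rule_format, of m] m
          unfolding n_def by simp_all
        then have "x \<in> s (H m)" using x s(2)[OF H(1)] by blast
        then obtain h r where hr: "h \<in> H m" "r \<in> carrier R" "x = h \<oplus> r \<otimes> a" unfolding s_def by blast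
        have car: "h \<in> carrier R" using left_idealD(2)[OF H(1) hr(1)] .
        have "x \<ominus> h \<in> H n" using left_ideal_minus[OF H(1) x] hr(1) anti[OF m] by blast
        also have "x \<ominus> h = r \<otimes> a" unfolding hr(3) using car hr(2) ab(1) by algebra
        finally have "r \<in> t (H n)" using hr(2) by (simp add: t_def)
        then have "r \<in> t (H m)" using \<open>t (H n) = t (H m)\<close> by simp
        then have "r \<otimes> a \<in> H m" by (simp add: t_def)
        then show "x \<in> H m" unfolding hr(3) using left_idealD(4)[OF H(1) hr(1)] by blast
      qed
    qed
    then show False using unstable by blast
  qed
qed

text \<open>
  Nakayama's lemma by Noetherian induction on an ideal \<open>C \<subseteq> K\<close> that may be discarded:
  whenever \<open>e K \<subseteq> C + D\<close> for some \<open>e\<close> with \<open>1 - e \<in> J\<close>, already \<open>e K \<subseteq> D\<close> for another such \<open>e\<close>.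
\<close>

lemma nakayama_domain:
  assumes noeth: "left_noetherian R" and J: "left_ideal R J" "\<one> \<notin> J"
    and K: "left_ideal R K" "K \<noteq> {\<zero>}" and KJ: "K \<subseteq> ideal_prod R J K"
  shows False
proof -
  define sum where "sum C D = ideal_plus R C D" for C D
  define P where "P D \<longleftrightarrow> (\<exists>e\<in>carrier R. \<one> \<ominus> e \<in> J \<and> (\<forall>x\<in>K. e \<otimes> x \<in> D))" for D
  define G where "G C \<longleftrightarrow> left_ideal R C \<and> C \<subseteq> K \<and> (\<forall>D. left_ideal R D \<longrightarrow> P (sum C D) \<longrightarrow> P D)" for C
  have sum_ideal: "left_ideal R (sum C D)" if "left_ideal R C" "left_ideal R D" for C D
    using left_ideal_sum[OF that] by (simp add: sum_def)
  have PP: "P D \<Longrightarrow> D \<subseteq> D' \<Longrightarrow> P D'" for D D' unfolding P_def by blast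
  note JD = left_idealD[OF J(1)] and KD = left_idealD[OF K(1)]
  have sum0: "sum {\<zero>} D \<subseteq> D" if "left_ideal R D" for D
    using left_idealD(2)[OF that] by (auto simp: sum_def)
  have G0: "G {\<zero>}"
    unfolding G_def
  proof (intro conjI allI impI left_ideal_zero)
    show "{\<zero>} \<subseteq> K" using KD(3) by simp
    show "P D" if "left_ideal R D" "P (sum {\<zero>} D)" for D by (rule PP[OF that(2) sum0[OF that(1)]])
  qed
  \<comment> \<open>\<open>G C\<close> says that \<open>C\<close> may be discarded. A maximal such
    \<open>C\<close> absorbs \<open>xR\<close> for every \<open>x \<in> K\<close>, so it is all of
    \<open>K\<close>.\<close>
  have "\<exists>C. C \<in> Collect G \<and> (\<forall>C'. C' \<in> Collect G \<longrightarrow> C \<subseteq> C' \<longrightarrow> C' = C)"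
  proof (rule left_noetherian_maximal[OF noeth, of "Collect G"])
    show "Collect G \<noteq> {}" using G0 by blast
    show "left_ideal R H" if "H \<in> Collect G" for H using that by (simp add: G_def)
  qed blast
  then obtain C where C: "G C" "\<And>C'. \<lbrakk>G C'; C \<subseteq> C'\<rbrakk> \<Longrightarrow> C' = C" by blast
  have CI: "left_ideal R C" using C(1) by (simp add: G_def)
  note CD = left_idealD[OF CI]
  have "K \<subseteq> C"
  proof
    fix x assume x: "x \<in> K"
    have xc: "x \<in> carrier R" by (rule KD(2)[OF x])
    let ?xR = "principal_left R x"
    have xR: "left_ideal R ?xR" by (rule left_ideal_right_mult[OF left_ideal_carrier xc])
    have x_xR: "x \<in> ?xR" using xc by (intro image_eqI[of _ _ \<one>]) auto
    have "G (sum C ?xR)"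
      unfolding G_def
    proof (intro conjI allI impI sum_ideal CI xR)
      have "C \<subseteq> K" using C(1) by (simp add: G_def)
      then show "sum C ?xR \<subseteq> K" using KD(4,5) x unfolding sum_def by blast
      fix D assume D: "left_ideal R D" and PD: "P (sum (sum C ?xR) D)"
      note DD = left_idealD[OF D]
      have "sum (sum C ?xR) D \<subseteq> sum C (sum ?xR D)"
      proof
        fix z assume "z \<in> sum (sum C ?xR) D"
        then obtain c r d where crd: "c \<in> C" "r \<in> ?xR" "d \<in> D" "z = (c \<oplus> r) \<oplus> d"
          unfolding sum_def by blast
        then have car: "c \<in> carrier R" "r \<in> carrier R" "d \<in> carrier R"
          using CD(2) left_idealD(2)[OF xR] DD(2) by blast+
        then have "z = c \<oplus> (r \<oplus> d)" "z \<in> carrier R" using crd(4) by (simp_all add: a_assoc)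
        then show "z \<in> sum C (sum ?xR D)" using crd(1,2,3) car unfolding sum_def by blast
      qed
      then have "P (sum C (sum ?xR D))" using PP[OF PD] by blast
      then have "P (sum ?xR D)" using C(1) sum_ideal[OF xR D] unfolding G_def by blast
      then obtain e where e: "e \<in> carrier R" "\<one> \<ominus> e \<in> J" "\<And>y. y \<in> K \<Longrightarrow> e \<otimes> y \<in> sum ?xR D"
        unfolding P_def by blast
      \<comment> \<open>This uses the inclusion of \<open>K\<close> in \<open>JK\<close>: as
        \<open>eK\<close> lies in \<open>xR + D\<close>, the set \<open>e(JK)\<close>, and with it
        \<open>e x\<close>, lies in \<open>Jx + D\<close>.\<close>
      have "\<exists>j\<in>J. \<exists>d\<in>D. e \<otimes> z = j \<otimes> x \<oplus> d" if "z \<in> ideal_prod R J K" for z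
        using that
      proof (induction z)
        case (prod i k)
        obtain r d where rd: "r \<in> carrier R" "d \<in> D" "e \<otimes> k = r \<otimes> x \<oplus> d"
          using e(3)[OF prod(2)] unfolding sum_def by blast
        have car: "i \<in> carrier R" "k \<in> carrier R" "d \<in> carrier R"
          using JD(2) prod KD(2) DD(2) rd(2) by blast+
        have "e \<otimes> (i \<otimes> k) = i \<otimes> (e \<otimes> k)" using car e(1) by (simp add: m_ac)
        also have "\<dots> = (r \<otimes> i) \<otimes> x \<oplus> i \<otimes> d" unfolding rd(3) using car rd(1) xc by (simp add: r_distr m_ac)
        finally show ?case using JD(5)[OF rd(1) prod(1)] DD(5)[OF car(1) rd(2)] by blast
      next
        case (sum y z)
        then obtain j d j' d' where *: "j \<in> J" "d \<in> D" "e \<otimes> y = j \<otimes> x \<oplus> d"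
          "j' \<in> J" "d' \<in> D" "e \<otimes> z = j' \<otimes> x \<oplus> d'" by blast
        have "ideal_prod R J K \<subseteq> carrier R"
          using ideal_prod_is_ideal J(1) K(1) left_ideal_iff_ideal left_idealD(1) by blast
        then have yz: "y \<in> carrier R" "z \<in> carrier R" using sum by blast+
        have car: "j \<in> carrier R" "j' \<in> carrier R" "d \<in> carrier R" "d' \<in> carrier R"
          using JD(2) DD(2) * by blast+
        have "e \<otimes> (y \<oplus> z) = (j \<oplus> j') \<otimes> x \<oplus> (d \<oplus> d')"
          using yz e(1) *(3,6) car xc by (simp add: r_distr l_distr a_ac)
        then show ?case using JD(4)[OF *(1,4)] DD(4)[OF *(2,5)] by blast
      qed
      then obtain j d where jd: "j \<in> J" "d \<in> D" "e \<otimes> x = j \<otimes> x \<oplus> d" using x KJ by blast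
      have car: "j \<in> carrier R" "d \<in> carrier R" using JD(2) DD(2) jd by blast+
      have "(e \<ominus> j) \<otimes> x = e \<otimes> x \<ominus> j \<otimes> x" using e(1) car xc by algebra
      also have "\<dots> = d" unfolding jd(3) using car xc by algebra
      finally have ejx: "(e \<ominus> j) \<otimes> x \<in> D" using jd(2) by simp
      \<comment> \<open>The new multiplier is \<open>(e - j) e\<close>: the factor \<open>e\<close>
        sends \<open>K\<close> into \<open>xR + D\<close>, and \<open>e - j\<close> then sends
        \<open>x\<close> into \<open>D\<close>. It is still congruent to \<open>1\<close> modulo
        \<open>J\<close>.\<close>
      show "P D"
        unfolding P_def
      proof (intro bexI conjI ballI)
        show "(e \<ominus> j) \<otimes> e \<in> carrier R" using e(1) car by simp
        have "\<one> \<ominus> (e \<ominus> j) \<otimes> e = (\<one> \<ominus> e) \<oplus> e \<otimes> ((\<one> \<ominus> e) \<oplus> j)"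
          using e(1) car by algebra
        then show "\<one> \<ominus> (e \<ominus> j) \<otimes> e \<in> J" using JD(4)[OF e(2) JD(5)[OF e(1) JD(4)[OF e(2) jd(1)]]] by simp
        fix y assume y: "y \<in> K"
        obtain r d' where rd: "r \<in> carrier R" "d' \<in> D" "e \<otimes> y = r \<otimes> x \<oplus> d'"
          using e(3)[OF y] unfolding sum_def by blast
        have car2: "d' \<in> carrier R" "y \<in> carrier R" using DD(2) rd(2) KD(2) y by blast+
        have "(e \<ominus> j) \<otimes> e \<otimes> y = (e \<ominus> j) \<otimes> (r \<otimes> x \<oplus> d')"
          using e(1) car car2 rd(3) by (simp add: m_assoc)
        also have "\<dots> = r \<otimes> ((e \<ominus> j) \<otimes> x) \<oplus> (e \<ominus> j) \<otimes> d'"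
          using e(1) car car2 rd(1) xc by algebra
        also have "\<dots> \<in> D"
          by (rule DD(4)[OF DD(5)[OF rd(1) ejx] DD(5)[OF _ rd(2)]]) (use e(1) car in simp)
        finally show "(e \<ominus> j) \<otimes> e \<otimes> y \<in> D" .
      qed
    qed
    then have "sum C ?xR = C"
      by (rule C(2)) (unfold sum_def, rule left_ideal_sum_upper(1)[OF CI xR])
    moreover have "x \<in> sum C ?xR"
      unfolding sum_def by (rule subsetD[OF left_ideal_sum_upper(2)[OF CI xR] x_xR])
    ultimately show "x \<in> C" by simp
  qed
  have "P (sum C {\<zero>})"
    unfolding P_def
  proof (intro bexI[of _ \<one>] conjI ballI)
    show "\<one> \<ominus> \<one> \<in> J" using JD(3) by (simp add: minus_eq r_neg)
    fix x assume "x \<in> K"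
    then have "x \<in> C" "x \<in> carrier R" using \<open>K \<subseteq> C\<close> KD(2) by blast+
    then show "\<one> \<otimes> x \<in> sum C {\<zero>}" by (auto simp: sum_def intro!: bexI[of _ x])
  qed simp
  then have "P {\<zero>}" using C(1) left_ideal_zero unfolding G_def by blast
  then obtain e where e: "e \<in> carrier R" "\<one> \<ominus> e \<in> J" "\<And>x. x \<in> K \<Longrightarrow> e \<otimes> x = \<zero>"
    unfolding P_def by blast
  obtain x where x: "x \<in> K" "x \<noteq> \<zero>" using K(2) KD(3) by blast
  have "e = \<zero>" using integral[OF e(3)[OF x(1)] e(1) KD(2)[OF x(1)]] x(2) by simp
  then show False using e(2) J(2) by (simp add: minus_eq)
qed

end

section \<open>Coefficients of differential operators\<close>

locale domain_derivation = derivation_ring R \<delta> + domain R for R (structure) and \<delta>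
begin

sublocale S: ring S by (rule diff_op_ring_is_ring)

abbreviation S_mult (infixl "\<star>" 70) where "p \<star> q \<equiv> p \<otimes>\<^bsub>S\<^esub> q"

abbreviation S_add (infixl "\<boxplus>" 65) where "p \<boxplus> q \<equiv> p \<oplus>\<^bsub>S\<^esub> q"

abbreviation S_minus (infixl "\<boxminus>" 65) where "p \<boxminus> q \<equiv> p \<ominus>\<^bsub>S\<^esub> q"

text \<open>\<open>C a\<close> is \<open>a\<close> regarded in \<open>S\<close>, and
  \<open>X\<close> below is \<open>\<theta>\<close>. Both are written as coefficient sequences, so
  that identities in \<open>S\<close> can be checked coefficient by coefficient.\<close>

definition C :: "'a \<Rightarrow> nat \<Rightarrow> 'a" where "C a = (\<lambda>n. if n = 0 then a else \<zero>)"

definition X :: "nat \<Rightarrow> 'a" where "X = (\<lambda>n. if n = 1 then \<one> else \<zero>)"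

lemma mem_S: "p \<in> carrier S \<longleftrightarrow> p \<in> up R" by (simp add: S_simps)

lemma cf_closed [simp]: "p \<in> carrier S \<Longrightarrow> p n \<in> carrier R" by (simp add: mem_S mem_upD)

lemma C_closed [simp]: "a \<in> carrier R \<Longrightarrow> C a \<in> carrier S"
  using monom_up[of a 0] by (simp add: mem_S C_def)

lemma X_closed [simp]: "X \<in> carrier S"
  using monom_up[of \<one> 1] by (simp add: mem_S X_def)

lemma cf_C: "C a n = (if n = 0 then a else \<zero>)" by (simp add: C_def)

lemma cf_X: "X n = (if n = 1 then \<one> else \<zero>)" by (simp add: X_def)

lemma cf_zero: "\<zero>\<^bsub>S\<^esub> n = \<zero>" by (simp add: S_simps)

lemma cf_add: "\<lbrakk>p \<in> carrier S; q \<in> carrier S\<rbrakk> \<Longrightarrow> (p \<boxplus> q) n = p n \<oplus> q n"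
  by (simp add: S_simps mem_S)

lemma cf_inv: "p \<in> carrier S \<Longrightarrow> (\<ominus>\<^bsub>S\<^esub> p) n = \<ominus> p n"
proof -
  assume p: "p \<in> carrier S"
  have "(\<ominus>\<^bsub>S\<^esub> p) n \<oplus> p n = (\<ominus>\<^bsub>S\<^esub> p \<boxplus> p) n" using p by (simp add: cf_add)
  also have "\<dots> = \<zero>" using p by (simp add: S.l_neg cf_zero)
  finally show ?thesis using p minus_equality[of "(\<ominus>\<^bsub>S\<^esub> p) n" "p n"] by simp
qed

lemma cf_minus: "\<lbrakk>p \<in> carrier S; q \<in> carrier S\<rbrakk> \<Longrightarrow> (p \<boxminus> q) n = p n \<ominus> q n"
  by (simp add: S.minus_eq minus_eq cf_add cf_inv)

lemma S_eqI: "(\<And>n. p n = q n) \<Longrightarrow> p = q" by (rule ext)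

lemma C_one: "C \<one> = \<one>\<^bsub>S\<^esub>" and C_zero [simp]: "C \<zero> = \<zero>\<^bsub>S\<^esub>"
  by (auto simp: C_def S_simps)

lemma C_eq_zero_iff: "C a = \<zero>\<^bsub>S\<^esub> \<longleftrightarrow> a = \<zero>"
  using cf_C[of a 0] cf_zero[of 0] by auto

lemma C_add: "\<lbrakk>a \<in> carrier R; b \<in> carrier R\<rbrakk> \<Longrightarrow> C (a \<oplus> b) = C a \<boxplus> C b"
  by (rule S_eqI) (simp add: cf_add cf_C)

lemma C_minus: "\<lbrakk>a \<in> carrier R; b \<in> carrier R\<rbrakk> \<Longrightarrow> C (a \<ominus> b) = C a \<boxminus> C b"
  by (rule S_eqI) (simp add: cf_minus cf_C minus_eq)

lemma C_inv: "a \<in> carrier R \<Longrightarrow> C (\<ominus> a) = \<ominus>\<^bsub>S\<^esub> C a"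
  by (rule S_eqI) (simp add: cf_inv cf_C)

lemma cf_C_mult: "\<lbrakk>a \<in> carrier R; p \<in> carrier S\<rbrakk> \<Longrightarrow> (C a \<star> p) n = a \<otimes> p n"
  using R_mult[of a p] by (simp add: mem_S monom_simp C_def)

lemma C_mult: "\<lbrakk>a \<in> carrier R; b \<in> carrier R\<rbrakk> \<Longrightarrow> C (a \<otimes> b) = C a \<star> C b"
  by (rule S_eqI) (simp add: cf_C_mult cf_C)

lemma cf_X_mult: "p \<in> carrier S \<Longrightarrow> (X \<star> p) n = (if n = 0 then \<zero> else p (n - 1)) \<oplus> \<delta> (p n)"
  using theta_mult_eq[of p] by (simp add: mem_S monom_simp X_def theta_mult_def)

lemma X_C:
  assumes "a \<in> carrier R"
  shows "X \<star> C a = C a \<star> X \<boxplus> C (\<delta> a)"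
  by (rule S_eqI) (use assms in \<open>auto simp: cf_X_mult cf_add cf_C_mult cf_C cf_X\<close>)

text \<open>The operators of order below \<open>n\<close>. Order at most \<open>d\<close> is
  therefore \<open>U (Suc d)\<close>, and \<open>U 0\<close> contains only zero, which needs no
  degree of its own.\<close>

definition U :: "nat \<Rightarrow> (nat \<Rightarrow> 'a) set" where
  "U n = {p \<in> carrier S. \<forall>m\<ge>n. p m = \<zero>}"

lemma U_closed: "p \<in> U n \<Longrightarrow> p \<in> carrier S"
  and U_zero: "\<lbrakk>p \<in> U n; n \<le> m\<rbrakk> \<Longrightarrow> p m = \<zero>"
  and UI: "\<lbrakk>p \<in> carrier S; \<And>m. n \<le> m \<Longrightarrow> p m = \<zero>\<rbrakk> \<Longrightarrow> p \<in> U n"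
  by (auto simp: U_def)

lemma U_0: "p \<in> U 0 \<Longrightarrow> p = \<zero>\<^bsub>S\<^esub>"
  by (rule S_eqI) (simp only: U_def cf_zero mem_Collect_eq le0 simp_thms)

lemma U_mono: "n \<le> m \<Longrightarrow> p \<in> U n \<Longrightarrow> p \<in> U m" by (auto simp: U_def)

lemma U_exists: "p \<in> carrier S \<Longrightarrow> \<exists>n. p \<in> U n"
proof -
  assume p: "p \<in> carrier S"
  then obtain N where "\<forall>n>N. p n = \<zero>" using upE mem_S by metis
  then have "p \<in> U (Suc N)" using p by (auto simp: U_def)
  then show ?thesis by blast
qed

lemma U_add: "\<lbrakk>p \<in> U n; q \<in> U n\<rbrakk> \<Longrightarrow> p \<boxplus> q \<in> U n"
  and U_minus: "\<lbrakk>p \<in> U n; q \<in> U n\<rbrakk> \<Longrightarrow> p \<boxminus> q \<in> U n"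
  and U_C_mult: "\<lbrakk>a \<in> carrier R; p \<in> U n\<rbrakk> \<Longrightarrow> C a \<star> p \<in> U n"
  and zero_U: "\<zero>\<^bsub>S\<^esub> \<in> U n"
  by (auto simp: U_def cf_add cf_minus cf_C_mult minus_eq cf_zero[of "_::nat"])

lemma C_U: "a \<in> carrier R \<Longrightarrow> C a \<in> U (Suc 0)"
  by (auto simp: U_def cf_C)

lemma U_1: "p \<in> U (Suc 0) \<Longrightarrow> p = C (p 0)"
  by (rule S_eqI) (auto simp: U_def cf_C)

lemma U_SucD:
  assumes "p \<in> U (Suc n)" "p n = \<zero>"
  shows "p \<in> U n"
proof (rule UI)
  fix m assume "n \<le> m"
  then show "p m = \<zero>" using assms U_zero[OF assms(1), of m] by (cases "m = n") auto
qed (use assms U_closed in blast)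

lemma top_exists:
  assumes "p \<in> carrier S" "p \<noteq> \<zero>\<^bsub>S\<^esub>"
  obtains d where "p \<in> U (Suc d)" "p d \<noteq> \<zero>"
proof -
  obtain n where n: "p \<in> U n" using U_exists[OF assms(1)] by blast
  have "\<exists>d. p \<in> U (Suc d) \<and> p d \<noteq> \<zero>"
    using n
  proof (induction n)
    case 0
    then show ?case using U_0 assms(2) by blast
  next
    case (Suc n)
    then show ?case using U_SucD by blast
  qed
  then show thesis using that by blast
qed

lemma mult_cf:
  assumes "p \<in> U (Suc m)" "q \<in> carrier S"
  shows "(p \<star> q) n = (\<Oplus>i\<in>{..m}. p i \<otimes> (T ^^ i) q n)"
  unfolding S_simps using assms U_closed[OF assms(1)] U_zero[OF assms(1)]
  by (intro L_eq) (auto simp: mem_S)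

lemma T_Suc: "T q (Suc n) = q n \<oplus> \<delta> (q (Suc n))"
  by (simp add: theta_mult_def)

lemma Tn_top: "\<lbrakk>q \<in> carrier S; q \<in> U (Suc n)\<rbrakk> \<Longrightarrow> (T ^^ i) q (n + i) = q n"
proof (induction i)
  case (Suc i)
  have "(T ^^ i) q (Suc (n + i)) = \<zero>"
    by (rule Tn_bound[of q n]) (use Suc.prems U_zero[of q "Suc n"] in \<open>auto simp: mem_S\<close>)
  then show ?case using Suc by (simp add: T_Suc)
qed simp

text \<open>Moving \<open>\<theta>\<close> past a coefficient only creates terms of lower order, so
  in order \<open>m + n\<close> only the two leading terms contribute.\<close>

lemma mult_top:
  assumes p: "p \<in> U (Suc m)" and q: "q \<in> U (Suc n)"
  shows "p \<star> q \<in> U (Suc (m + n))" "(p \<star> q) (m + n) = p m \<otimes> q n"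
proof -
  note car = U_closed[OF p] U_closed[OF q]
  have T_car: "(T ^^ i) q k \<in> carrier R" for i k using car(2) by (auto simp: mem_S)
  have bound: "(T ^^ i) q k = \<zero>" if "n + i < k" for i k
    by (rule Tn_bound[of q n]) (use car U_zero[OF q] that in \<open>auto simp: mem_S\<close>)
  show "p \<star> q \<in> U (Suc (m + n))"
  proof (rule UI)
    fix k assume "Suc (m + n) \<le> k"
    then have "(\<Oplus>i\<in>{..m}. p i \<otimes> (T ^^ i) q k) = (\<Oplus>i\<in>{..m}. \<zero>)"
      using bound car by (intro finsum_cong') auto
    then show "(p \<star> q) k = \<zero>" using mult_cf[OF p car(2)] by simp
  qed (use car in simp)
  have "(p \<star> q) (m + n) = (\<Oplus>i\<in>{..m}. p i \<otimes> (T ^^ i) q (m + n))"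
    by (rule mult_cf[OF p car(2)])
  also have "\<dots> = (\<Oplus>i\<in>{..m}. if m = i then p i \<otimes> q n else \<zero>)"
    using bound car Tn_top[OF car(2) q, of m] T_car
    by (intro finsum_cong') (auto simp: add.commute[of n])
  also have "\<dots> = p m \<otimes> q n" using car by (subst finsum_singleton) auto
  finally show "(p \<star> q) (m + n) = p m \<otimes> q n" .
qed

lemma X_mult_U: "p \<in> U n \<Longrightarrow> X \<star> p \<in> U (Suc n)"
  by (rule UI) (auto simp: cf_X_mult U_closed U_zero)

lemma cf_pow_X: "(X [^]\<^bsub>S\<^esub> n) m = (if m = n then \<one> else \<zero>)"
proof (induction n arbitrary: m)
  case 0
  then show ?case by (simp add: C_one[symmetric] cf_C)
next
  case (Suc n)
  have "X [^]\<^bsub>S\<^esub> Suc n = X \<star> (X [^]\<^bsub>S\<^esub> n)" by (rule S.nat_pow_Suc2) simp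
  then show ?case using Suc by (cases m) (auto simp: cf_X_mult)
qed

lemma pow_X_closed [simp]: "X [^]\<^bsub>S\<^esub> (n::nat) \<in> carrier S" by simp

lemma cf_monom: "a \<in> carrier R \<Longrightarrow> (C a \<star> (X [^]\<^bsub>S\<^esub> n)) m = (if m = n then a else \<zero>)"
  by (simp add: cf_C_mult cf_pow_X)

lemma strip_top:
  assumes "p \<in> U (Suc n)"
  shows "p \<boxminus> C (p n) \<star> (X [^]\<^bsub>S\<^esub> n) \<in> U n"
proof (rule UI)
  note p = U_closed[OF assms]
  show "p \<boxminus> C (p n) \<star> (X [^]\<^bsub>S\<^esub> n) \<in> carrier S" using p by simp
  fix m assume "n \<le> m"
  then show "(p \<boxminus> C (p n) \<star> (X [^]\<^bsub>S\<^esub> n)) m = \<zero>"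
    using p U_zero[OF assms, of m] by (auto simp: cf_minus cf_monom minus_eq r_neg)
qed

lemma pow_X_C_top:
  assumes "a \<in> carrier R"
  shows "(X [^]\<^bsub>S\<^esub> n) \<star> C a \<in> U (Suc n)" "((X [^]\<^bsub>S\<^esub> n) \<star> C a) n = a"
proof -
  have X: "X [^]\<^bsub>S\<^esub> n \<in> U (Suc n)" by (rule UI) (auto simp: cf_pow_X)
  show "(X [^]\<^bsub>S\<^esub> n) \<star> C a \<in> U (Suc n)" "((X [^]\<^bsub>S\<^esub> n) \<star> C a) n = a"
    using mult_top(1)[OF X C_U[OF assms]] mult_top(2)[OF X C_U[OF assms]] assms
    by (simp_all add: cf_pow_X cf_C)
qed

lemma sub_eq_add: "\<lbrakk>p \<in> carrier S; q \<in> carrier S\<rbrakk> \<Longrightarrow> p = q \<boxplus> (p \<boxminus> q)"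
  by (simp add: S.minus_eq S.a_lcomm[of q] S.r_neg)

text \<open>\<open>R\<close> and \<open>\<theta>\<close> generate \<open>S\<close>, so closure under
  left multiplication by \<open>C a\<close> and \<open>X\<close> is enough.\<close>

lemma left_ideal_SI:
  assumes "H \<subseteq> carrier S" "\<zero>\<^bsub>S\<^esub> \<in> H" and add: "\<And>p q. \<lbrakk>p \<in> H; q \<in> H\<rbrakk> \<Longrightarrow> p \<boxplus> q \<in> H"
    and C: "\<And>a p. \<lbrakk>a \<in> carrier R; p \<in> H\<rbrakk> \<Longrightarrow> C a \<star> p \<in> H" and X: "\<And>p. p \<in> H \<Longrightarrow> X \<star> p \<in> H"
  shows "left_ideal S H"
proof (rule left_idealI[OF assms(1,2) add])
  fix s p assume s: "s \<in> carrier S" and p: "p \<in> H"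
  have pc: "p \<in> carrier S" using assms(1) p by blast
  have Xn: "(X [^]\<^bsub>S\<^esub> n) \<star> p \<in> H" for n :: nat
  proof (induction n)
    case (Suc n)
    have "X [^]\<^bsub>S\<^esub> Suc n = X \<star> (X [^]\<^bsub>S\<^esub> n)" by (rule S.nat_pow_Suc2) simp
    then have "(X [^]\<^bsub>S\<^esub> Suc n) \<star> p = X \<star> ((X [^]\<^bsub>S\<^esub> n) \<star> p)"
      using pc by (simp add: S.m_assoc)
    then show ?case using X[OF Suc] by simp
  qed (use p pc in simp)
  have "s \<in> U n \<Longrightarrow> s \<star> p \<in> H" for n
  proof (induction n arbitrary: s)
    case 0
    then show ?case using U_0[OF 0] pc assms(2) by simp
  next
    case (Suc n)
    note s = U_closed[OF Suc.prems]
    let ?m = "C (s n) \<star> (X [^]\<^bsub>S\<^esub> n)"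
    have "s \<star> p = (?m \<boxplus> (s \<boxminus> ?m)) \<star> p" using sub_eq_add[of s ?m] s by simp
    also have "\<dots> = C (s n) \<star> ((X [^]\<^bsub>S\<^esub> n) \<star> p) \<boxplus> (s \<boxminus> ?m) \<star> p"
      using s pc by (simp add: S.l_distr S.m_assoc)
    also have "\<dots> \<in> H"
      using add[OF C[OF _ Xn] Suc.IH[OF strip_top[OF Suc.prems]]] s by simp
    finally show ?case .
  qed
  then show "s \<star> p \<in> H" using U_exists[OF s] by blast
qed

text \<open>In \<open>\<theta>^n a = a \<theta>^n + n \<delta>(a) \<theta>^(n-1) + ...\<close> the
  leading terms cancel in the commutator because \<open>R\<close> is commutative. At
  \<open>n - 1\<close> the contribution of the second coefficient of \<open>f\<close> cancels in the
  same way and leaves \<open>f_n n \<delta>(a)\<close>.\<close>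

lemma comm_top:
  assumes f: "f \<in> U (Suc n)" and a: "a \<in> carrier R"
  shows "f \<star> C a \<boxminus> C a \<star> f \<in> U n"
    "n = Suc k \<Longrightarrow> (f \<star> C a \<boxminus> C a \<star> f) k = f n \<otimes> ([n] \<cdot> \<delta> a)"
proof -
  note fc = U_closed[OF f]
  have fC: "f \<star> C a \<in> U (Suc n)" "(f \<star> C a) n = f n \<otimes> a"
    using mult_top[OF f C_U[OF a]] by (simp_all add: cf_C)
  show "f \<star> C a \<boxminus> C a \<star> f \<in> U n"
  proof (rule U_SucD[OF U_minus[OF fC(1) U_C_mult[OF a f]]])
    show "(f \<star> C a \<boxminus> C a \<star> f) n = \<zero>"
      using fc a fC(2) by (simp add: cf_minus cf_C_mult m_comm[of a] minus_eq r_neg)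
  qed
  assume n: "n = Suc k"
  have Ca: "C a \<in> carrier S" using a by simp
  have top: "(T ^^ i) (C a) i = a" for i using Tn_top[OF Ca C_U[OF a], of i] by (simp add: cf_C)
  have bound: "(T ^^ i) (C a) l = \<zero>" if "i < l" for i l
    by (rule Tn_bound[of _ 0]) (use Ca that in \<open>auto simp: mem_S cf_C\<close>)
  \<comment> \<open>Each of the \<open>i + 1\<close> factors \<open>\<theta>\<close> contributes one
    \<open>\<delta> a\<close> when it is moved past \<open>a\<close>.\<close>
  have second: "(T ^^ Suc i) (C a) i = [Suc i] \<cdot> \<delta> a" for i
  proof (induction i)
    case (Suc i)
    have "(T ^^ Suc (Suc i)) (C a) (Suc i) = (T ^^ Suc i) (C a) i \<oplus> \<delta> ((T ^^ Suc i) (C a) (Suc i))"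
      by (simp add: T_Suc)
    then show ?case using Suc top[of "Suc i"] a by simp
  qed (use a in \<open>simp add: theta_mult_def cf_C\<close>)
  have T_car: "(T ^^ i) (C a) l \<in> carrier R" for i l using Ca by (auto simp: mem_S)
  have "(f \<star> C a) k = (\<Oplus>i\<in>{..Suc k}. f i \<otimes> (T ^^ i) (C a) k)"
    using mult_cf[OF f Ca] n by simp
  also have "\<dots> = f n \<otimes> ([n] \<cdot> \<delta> a) \<oplus> (\<Oplus>i\<in>{..k}. f i \<otimes> (T ^^ i) (C a) k)"
    using T_car fc second[of k] n by (subst finsum_Suc) auto
  also have "(\<Oplus>i\<in>{..k}. f i \<otimes> (T ^^ i) (C a) k) = (\<Oplus>i\<in>{..k}. if k = i then f i \<otimes> a else \<zero>)"
    using fc a T_car top[of k] bound by (intro finsum_cong') auto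
  also have "\<dots> = f k \<otimes> a" using fc a by (subst finsum_singleton) auto
  finally have "(f \<star> C a) k = f n \<otimes> ([n] \<cdot> \<delta> a) \<oplus> f k \<otimes> a" .
  then show "(f \<star> C a \<boxminus> C a \<star> f) k = f n \<otimes> ([n] \<cdot> \<delta> a)"
    using fc a by (simp add: cf_minus cf_C_mult m_comm[of a] minus_eq a_assoc r_neg)
qed

section \<open>Left ideals of the differential operator ring\<close>

text \<open>\<open>W J\<close> is the left ideal \<open>SJ\<close>: its elements \<open>\<Sum> \<theta>\<^sup>i j\<^sub>i\<close> are written in Horner form.\<close>

inductive_set W :: "'a set \<Rightarrow> (nat \<Rightarrow> 'a) set" for J where
  W_zero: "\<zero>\<^bsub>S\<^esub> \<in> W J"
| W_step: "\<lbrakk>p \<in> W J; j \<in> J\<rbrakk> \<Longrightarrow> X \<star> p \<boxplus> C j \<in> W J"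

definition cst :: "(nat \<Rightarrow> 'a) set \<Rightarrow> 'a set" where "cst H = {a \<in> carrier R. C a \<in> H}"

lemma W_mono: "J \<subseteq> J' \<Longrightarrow> W J \<subseteq> W J'"
proof
  fix p assume "J \<subseteq> J'" "p \<in> W J"
  from this(2) show "p \<in> W J'" by induction (use \<open>J \<subseteq> J'\<close> in \<open>auto intro: W.intros\<close>)
qed

lemma cst_ideal:
  assumes "left_ideal S H"
  shows "left_ideal R (cst H)"
  by (rule left_idealI) (use left_idealD[OF assms] in \<open>auto simp: cst_def C_add C_mult\<close>)

lemma cst_one: "left_ideal S H \<Longrightarrow> \<one> \<in> cst H \<longleftrightarrow> H = carrier S"
  using S.left_ideal_one[of H] by (auto simp: cst_def C_one)

context
  fixes J assumes J: "left_ideal R J"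
begin

lemma J_car: "j \<in> J \<Longrightarrow> j \<in> carrier R" using left_idealD(2)[OF J] .

lemma W_closed: "p \<in> W J \<Longrightarrow> p \<in> carrier S"
  by (induction rule: W.induct) (auto simp: J_car)

lemma W_C: "j \<in> J \<Longrightarrow> C j \<in> W J"
  using W_step[OF W_zero, of j J] J_car[of j] by simp

lemma W_add: "\<lbrakk>p \<in> W J; q \<in> W J\<rbrakk> \<Longrightarrow> p \<boxplus> q \<in> W J"
proof (induction arbitrary: q rule: W.induct)
  case W_zero
  then show ?case using W_closed by simp
next
  case (W_step p j)
  from W_step.prems show ?case
  proof cases
    case W_zero
    then show ?thesis using W.W_step[OF W_step.hyps] W_closed[OF W_step.hyps(1)] J_car[OF W_step.hyps(2)] by simp
  next
    case (W_step q' i)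
    note car = W_closed[OF \<open>p \<in> W J\<close>] W_closed[OF \<open>q' \<in> W J\<close>] J_car[OF \<open>j \<in> J\<close>] J_car[OF \<open>i \<in> J\<close>]
    have "X \<star> p \<boxplus> C j \<boxplus> q = X \<star> (p \<boxplus> q') \<boxplus> C (j \<oplus> i)"
      unfolding W_step(1) using car by (simp add: C_add S.r_distr S.a_ac)
    then show ?thesis
      using W.W_step[OF \<open>\<And>q. q \<in> W J \<Longrightarrow> p \<boxplus> q \<in> W J\<close>[OF W_step(2)]] left_idealD(4)[OF J \<open>j \<in> J\<close> \<open>i \<in> J\<close>]
      by simp
  qed
qed

lemma W_X: "p \<in> W J \<Longrightarrow> X \<star> p \<in> W J"
  using W_step[of p J \<zero>] left_idealD(3)[OF J] W_closed[of p] by simp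

text \<open>By \<open>a \<theta> = \<theta> a - \<delta>(a)\<close> a left factor moves inside the
  Horner form. This brings in the factor \<open>\<delta> a\<close>, so the induction has to be for
  all \<open>a\<close> at once.\<close>

lemma W_C_mult: "p \<in> W J \<Longrightarrow> a \<in> carrier R \<Longrightarrow> C a \<star> p \<in> W J"
proof (induction arbitrary: a rule: W.induct)
  case W_zero
  then show ?case by (simp add: W.W_zero)
next
  case (W_step p j)
  note car = W_closed[OF \<open>p \<in> W J\<close>] J_car[OF \<open>j \<in> J\<close>] W_step.prems
  have "C a \<star> X = X \<star> C a \<boxminus> C (\<delta> a)"
    unfolding X_C[OF car(3)] using car by (simp add: S.minus_eq S.a_assoc S.r_neg)
  then have "C a \<star> (X \<star> p) = X \<star> (C a \<star> p) \<boxplus> C (\<ominus> \<delta> a) \<star> p"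
    using car by (simp add: S.m_assoc[symmetric] S.minus_eq S.l_distr C_inv)
  then have eq: "C a \<star> (X \<star> p \<boxplus> C j) =
      X \<star> (C a \<star> p) \<boxplus> C (\<ominus> \<delta> a) \<star> p \<boxplus> C (a \<otimes> j)"
    using car by (simp add: S.r_distr C_mult)
  have "a \<otimes> j \<in> J" by (rule left_idealD(5)[OF J car(3) W_step.hyps(2)])
  then show ?case
    unfolding eq using car by (intro W_add W_X W_C W_step.IH) auto
qed

lemma W_left_ideal: "left_ideal S (W J)"
  by (rule left_ideal_SI) (auto intro: W_closed W_add W_X W_C_mult W_zero)

lemma W_least:
  assumes "left_ideal S H" "\<And>j. j \<in> J \<Longrightarrow> C j \<in> H"
  shows "W J \<subseteq> H"
proof
  fix p assume "p \<in> W J"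
  then show "p \<in> H"
    by induction (use left_idealD[OF assms(1)] assms(2) in auto)
qed

text \<open>Elements of \<open>SJ\<close> have coefficients in \<open>J\<close> when these are
  written on the right of the powers of \<open>\<theta>\<close>. Moving them to the left preserves
  only the leading one, which is why the conclusion concerns the top coefficient alone.\<close>

lemma W_top: "p \<in> W J \<Longrightarrow> p \<in> U (Suc m) \<Longrightarrow> p m \<in> J"
proof (induction arbitrary: m rule: W.induct)
  case W_zero
  then show ?case using left_idealD(3)[OF J] by (simp only: cf_zero)
next
  case (W_step p j)
  note car = W_closed[OF \<open>p \<in> W J\<close>] J_car[OF \<open>j \<in> J\<close>]
  obtain N where N: "p \<in> U N" using U_exists[OF car(1)] by blast
  have cf: "(X \<star> p \<boxplus> C j) (Suc n) = p n \<oplus> \<delta> (p (Suc n))" for n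
    using car by (simp add: cf_add cf_X_mult cf_C)
  \<comment> \<open>Multiplication by \<open>\<theta>\<close> raises the order by exactly one, so
    the bound \<open>m\<close> on the order of \<open>X \<star> p \<boxplus> C j\<close> bounds the
    order of \<open>p\<close> strictly below \<open>m\<close>.\<close>
  have "p \<in> U (m + n) \<Longrightarrow> p \<in> U m" for n
  proof (induction n)
    case (Suc n)
    then have p: "p \<in> U (Suc (m + n))" by simp
    have "(X \<star> p \<boxplus> C j) (Suc (m + n)) = \<zero>" by (rule U_zero[OF W_step.prems]) simp
    then have "p (m + n) = \<zero>" using cf[of "m + n"] U_zero[OF p, of "Suc (m + n)"] car by simp
    then show ?case using U_SucD[OF p] Suc.IH by blast
  qed simp
  then have pm: "p \<in> U m" using U_mono[OF _ N, of "m + N"] by simp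
  show ?case
  proof (cases m)
    case 0
    then have "p = \<zero>\<^bsub>S\<^esub>" using pm U_0 by simp
    then show ?thesis using 0 W_step.hyps(2) car by (simp add: cf_C)
  next
    case (Suc k)
    then have "p k \<in> J" using W_step.IH pm by simp
    moreover have "(X \<star> p \<boxplus> C j) m = p k" using cf[of k] Suc U_zero[OF pm, of m] car by simp
    ultimately show ?thesis by simp
  qed
qed

lemma cst_W: "cst (W J) = J"
proof
  show "cst (W J) \<subseteq> J" using W_top[OF _ C_U, of _] by (force simp: cst_def cf_C)
  show "J \<subseteq> cst (W J)" using W_C J_car by (auto simp: cst_def)
qed

end

text \<open>For a \<open>\<delta>\<close>-ideal the side of the coefficients is immaterial:
  \<open>a \<theta> = \<theta> a - \<delta>(a)\<close> gives
  \<open>Q\<theta>^n \<subseteq> SQ\<close> by induction on \<open>n\<close>.\<close>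

lemma coefficients_in_delta_ideal:
  assumes H: "left_ideal S H" and Q: "delta_ideal R \<delta> Q" "\<And>a. a \<in> Q \<Longrightarrow> C a \<in> H"
    and p: "p \<in> carrier S" "\<And>n. p n \<in> Q"
  shows "p \<in> H"
proof -
  have QI: "left_ideal R Q" using Q(1) left_ideal_iff_ideal by (simp add: delta_ideal_def)
  have dQ: "\<delta> a \<in> Q" if "a \<in> Q" for a using Q(1) that by (auto simp: delta_ideal_def)
  have mon: "C a \<star> (X [^]\<^bsub>S\<^esub> n) \<in> H" if "a \<in> Q"
    for a and n :: nat
    using that
  proof (induction n arbitrary: a)
    case 0
    then show ?case using Q(2) left_idealD(2)[OF QI] by simp
  next
    case (Suc n)
    have a: "a \<in> carrier R" using left_idealD(2)[OF QI Suc.prems] .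
    have X: "X [^]\<^bsub>S\<^esub> Suc n = X \<star> (X [^]\<^bsub>S\<^esub> n)" by (rule S.nat_pow_Suc2) simp
    have "C a \<star> X = X \<star> C a \<boxminus> C (\<delta> a)"
      unfolding X_C[OF a] using a by (simp add: S.minus_eq S.a_assoc S.r_neg)
    then have "C a \<star> (X [^]\<^bsub>S\<^esub> Suc n) = X \<star> (C a \<star> (X [^]\<^bsub>S\<^esub> n)) \<boxminus> C (\<delta> a) \<star> (X [^]\<^bsub>S\<^esub> n)"
      unfolding X using a by (simp add: S.m_assoc[symmetric] S.minus_eq S.l_distr S.l_minus)
    then show ?case
      using S.left_ideal_minus[OF H left_idealD(5)[OF H X_closed Suc.IH[OF Suc.prems]] Suc.IH[OF dQ[OF Suc.prems]]]
      by simp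
  qed
  have "p \<in> U n \<Longrightarrow> p \<in> carrier S \<Longrightarrow> (\<And>n. p n \<in> Q) \<Longrightarrow> p \<in> H" for n
  proof (induction n arbitrary: p)
    case 0
    then show ?case using U_0 left_idealD(3)[OF H] by simp
  next
    case (Suc n)
    let ?m = "C (p n) \<star> (X [^]\<^bsub>S\<^esub> n)"
    have "p \<boxminus> ?m \<in> H"
    proof (rule Suc.IH[OF strip_top[OF Suc.prems(1)]])
      show "p \<boxminus> ?m \<in> carrier S" using Suc.prems(2) by simp
      show "(p \<boxminus> ?m) k \<in> Q" for k
        using left_ideal_minus[OF QI, of "p k" "p k"] left_idealD(3)[OF QI] Suc.prems(2,3)
        by (auto simp: cf_minus cf_monom minus_eq)
    qed
    then show ?case
      using S.left_ideal_diff_cancel[OF H Suc.prems(2) mon[OF Suc.prems(3)]] by blast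
  qed
  then show ?thesis using U_exists[OF p(1)] p by blast
qed

text \<open>
  Commuting an element of minimal order in a two-sided ideal with a suitable \<open>b \<in> R\<close> lowers its
  order, so such an element has order \<open>0\<close>.
\<close>

lemma two_sided_ideal_meets:
  assumes char0: "\<And>n::nat. n > 0 \<Longrightarrow> [n] \<cdot> \<one> \<in> Units R"
    and b: "b \<in> carrier R" "\<delta> b \<noteq> \<zero>"
    and I: "left_ideal S I" "\<And>p. p \<in> I \<Longrightarrow> p \<star> C b \<in> I" "p \<in> I" "p \<noteq> \<zero>\<^bsub>S\<^esub>"
  obtains a where "a \<in> cst I" "a \<noteq> \<zero>"
proof -
  have "p \<in> I \<Longrightarrow> p \<in> U (Suc n) \<Longrightarrow> p n \<noteq> \<zero> \<Longrightarrow> \<exists>a. a \<in> cst I \<and> a \<noteq> \<zero>" for n p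
  proof (induction n arbitrary: p)
    case 0
    have "p = C (p 0)" by (rule U_1[OF 0(2)])
    then have "p 0 \<in> cst I" using 0(1) left_idealD(2)[OF I(1) 0(1)] by (auto simp: cst_def)
    then show ?case using 0(3) by blast
  next
    case (Suc n)
    let ?q = "p \<star> C b \<boxminus> C b \<star> p"
    have pc: "p \<in> carrier S" by (rule left_idealD(2)[OF I(1) Suc.prems(1)])
    have q: "?q \<in> I"
      by (rule S.left_ideal_minus[OF I(1) I(2)[OF Suc.prems(1)] left_idealD(5)[OF I(1) _ Suc.prems(1)]])
        (use b in simp)
    have "[Suc n] \<cdot> \<delta> b = ([Suc n] \<cdot> \<one>) \<otimes> \<delta> b" using b by (subst add_pow_ldistr) auto
    moreover have "[Suc n] \<cdot> \<one> \<noteq> \<zero>"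
      using char0[of "Suc n"] Units_l_inv[of "\<zero>"] Units_inv_closed[of "\<zero>"] by auto
    ultimately have "[Suc n] \<cdot> \<delta> b \<noteq> \<zero>" using b by (simp add: integral_iff del: add.nat_pow_Suc)
    then have "?q n \<noteq> \<zero>"
      using comm_top(2)[OF Suc.prems(2) b(1) refl] Suc.prems(3) pc b
      by (simp add: integral_iff del: add.nat_pow_Suc)
    then show ?case using Suc.IH[OF q comm_top(1)[OF Suc.prems(2) b(1)]] by blast
  qed
  moreover obtain d where "p \<in> U (Suc d)" "p d \<noteq> \<zero>"
    using top_exists[OF left_idealD(2)[OF I(1,3)] I(4)] by blast
  ultimately show thesis using that I(3) by blast
qed

text \<open>Take \<open>q \<in> Q\<close> with \<open>\<delta>(q)\<close> outside \<open>Q\<close>.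
  For \<open>h \<in> H\<close> of order \<open>n > 0\<close> the commutator \<open>h q - q h\<close>
  is again in \<open>H\<close>, because \<open>h q \<in> SQ\<close>, and it has smaller order. By
  induction it lies in \<open>SQ\<close>, so its leading coefficient gives
  \<open>n h_n \<delta>(q) \<in> Q\<close> and hence \<open>h_n \<in> Q\<close>.\<close>

lemma left_ideal_eq_W:
  assumes char0: "\<And>n::nat. n > 0 \<Longrightarrow> [n] \<cdot> \<one> \<in> Units R"
    and Q: "primeideal Q R" "\<not> \<delta> ` Q \<subseteq> Q" and H: "left_ideal S H" "cst H = Q"
  shows "H = W Q"
proof
  have QI: "left_ideal R Q" using primeideal.axioms(1)[OF Q(1)] left_ideal_iff_ideal by blast
  have WH: "W Q \<subseteq> H" by (rule W_least[OF QI H(1)]) (use H(2) in \<open>auto simp: cst_def\<close>)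
  then show "W Q \<subseteq> H" .
  obtain q where q: "q \<in> Q" "\<delta> q \<notin> Q" using Q(2) by blast
  have qc: "q \<in> carrier R" by (rule left_idealD(2)[OF QI q(1)])
  have prime: "a \<in> Q" if "a \<in> carrier R" "x \<in> carrier R" "x \<notin> Q" "a \<otimes> x \<in> Q" for a x
    using primeideal.I_prime[OF Q(1)] that by blast
  have nd: "[n] \<cdot> \<delta> q \<notin> Q" if n: "n > 0" for n :: nat
  proof
    assume "[n] \<cdot> \<delta> q \<in> Q"
    moreover have eq: "[n] \<cdot> \<delta> q = ([n] \<cdot> \<one>) \<otimes> \<delta> q" using qc by (subst add_pow_ldistr) auto
    ultimately have "inv ([n] \<cdot> \<one>) \<otimes> (([n] \<cdot> \<one>) \<otimes> \<delta> q) \<in> Q"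
      using left_idealD(5)[OF QI Units_inv_closed[OF char0[OF n]]] by simp
    also have "inv ([n] \<cdot> \<one>) \<otimes> (([n] \<cdot> \<one>) \<otimes> \<delta> q) = \<delta> q"
      using char0[OF n] qc by (simp add: m_assoc[symmetric])
    finally show False using q(2) by simp
  qed
  have "h \<in> H \<Longrightarrow> h \<in> U n \<Longrightarrow> h \<in> W Q" for h n
  proof (induction n arbitrary: h)
    case 0
    then show ?case using U_0 W_zero by metis
  next
    case (Suc n)
    have hc: "h \<in> carrier S" by (rule left_idealD(2)[OF H(1) Suc.prems(1)])
    have "h n \<in> Q"
    proof (cases n)
      case 0
      have "h = C (h 0)" using U_1 Suc.prems(2) 0 by simp
      then have "h 0 \<in> cst H" using Suc.prems(1) hc by (auto simp: cst_def)
      then show ?thesis using H(2) 0 by simp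
    next
      case (Suc k)
      let ?c = "h \<star> C q \<boxminus> C q \<star> h"
      note comm = comm_top[OF Suc.prems(2) qc]
      have "h \<star> C q \<in> H" using left_idealD(5)[OF W_left_ideal[OF QI] hc W_C[OF QI q(1)]] WH by blast
      then have "?c \<in> H"
        using S.left_ideal_minus[OF H(1) _ left_idealD(5)[OF H(1) C_closed[OF qc] \<open>h \<in> H\<close>]] by blast
      then have "?c \<in> W Q" using Suc.IH comm(1) by blast
      then have "?c k \<in> Q" using W_top[OF QI] comm(1) Suc by blast
      then have "h n \<otimes> ([n] \<cdot> \<delta> q) \<in> Q" using comm(2)[OF Suc] by simp
      then show ?thesis using prime[OF _ _ nd[of n]] hc qc Suc by simp
    qed
    \<comment> \<open>With \<open>h n\<close> on the right, \<open>t\<close> lies in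
      \<open>SQ\<close> and has the same leading coefficient as \<open>h\<close>; with
      \<open>h n\<close> on the left it might lie outside \<open>SQ\<close>.\<close>
    define t where "t = (X [^]\<^bsub>S\<^esub> n) \<star> C (h n)"
    have t: "t \<in> W Q"
      unfolding t_def by (rule left_idealD(5)[OF W_left_ideal[OF QI] pow_X_closed W_C[OF QI \<open>h n \<in> Q\<close>]])
    have tc: "t \<in> carrier S" using hc by (simp add: t_def)
    have "h \<boxminus> t \<in> U n"
    proof (rule U_SucD)
      show "h \<boxminus> t \<in> U (Suc n)"
        unfolding t_def by (rule U_minus[OF Suc.prems(2) pow_X_C_top(1)]) (use hc in simp)
      show "(h \<boxminus> t) n = \<zero>"
        using hc tc pow_X_C_top(2)[of "h n" n] by (simp add: cf_minus t_def minus_eq r_neg)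
    qed
    moreover have "h \<boxminus> t \<in> H" using S.left_ideal_minus[OF H(1) Suc.prems(1)] t WH by blast
    ultimately have "h \<boxminus> t \<in> W Q" using Suc.IH by blast
    then show ?case using S.left_ideal_diff_cancel[OF W_left_ideal[OF QI] hc t] by blast
  qed
  then show "H \<subseteq> W Q" using U_exists left_idealD(2)[OF H(1)] by blast
qed

end

section \<open>Primitivity\<close>

locale char_zero_derivation = domain_derivation +
  assumes char0: "\<And>n::nat. n > 0 \<Longrightarrow> [n] \<cdot> \<one> \<in> Units R"
    and nontrivial: "\<exists>b\<in>carrier R. \<delta> b \<noteq> \<zero>"
begin

text \<open>The annihilator of \<open>S/G\<close>, which is the largest two-sided ideal contained in
  the left ideal \<open>G\<close>.\<close>

definition core :: "(nat \<Rightarrow> 'a) set \<Rightarrow> (nat \<Rightarrow> 'a) set" where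
  "core G = {p \<in> carrier S. \<forall>s\<in>carrier S. p \<star> s \<in> G}"

text \<open>This is \<open>S\<theta>\<close>, as \<open>vanish0_eq\<close> shows. The constant term
  identifies \<open>S/S\<theta>\<close> with \<open>R\<close>, on which \<open>\<theta>\<close> acts
  as \<open>\<delta>\<close>.\<close>

definition vanish0 :: "(nat \<Rightarrow> 'a) set" where "vanish0 = {p \<in> carrier S. p 0 = \<zero>}"

lemma left_ideal_core:
  assumes "left_ideal S G"
  shows "left_ideal S (core G)"
  by (rule left_idealI)
     (use left_idealD[OF assms] in \<open>auto simp: core_def S.l_distr S.m_assoc\<close>)

lemma core_right: "left_ideal S G \<Longrightarrow> p \<in> core G \<Longrightarrow> s \<in> carrier S \<Longrightarrow> p \<star> s \<in> core G"
  by (simp add: core_def S.m_assoc)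

lemma core_subset: "core G \<subseteq> G"
proof
  fix p assume "p \<in> core G"
  then have "p \<star> \<one>\<^bsub>S\<^esub> \<in> G" "p \<in> carrier S" unfolding core_def by blast+
  then show "p \<in> G" by simp
qed

lemma delta_idealD:
  assumes "delta_ideal R \<delta> I"
  shows "left_ideal R I" "\<And>a. a \<in> I \<Longrightarrow> \<delta> a \<in> I"
  using assms left_ideal_iff_ideal by (auto simp: delta_ideal_def)

lemma delta_idealI:
  assumes "left_ideal R I" "\<And>a. a \<in> I \<Longrightarrow> \<delta> a \<in> I"
  shows "delta_ideal R \<delta> I"
  using assms left_ideal_iff_ideal by (auto simp: delta_ideal_def)

lemma C_X: "a \<in> carrier R \<Longrightarrow> C a \<star> X = X \<star> C a \<boxminus> C (\<delta> a)"
  by (simp add: X_C S.minus_eq S.a_assoc S.r_neg)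

lemma C_d: "a \<in> carrier R \<Longrightarrow> C (\<delta> a) = X \<star> C a \<boxminus> C a \<star> X"
proof -
  assume a: "a \<in> carrier R"
  have "u \<boxplus> v \<boxminus> u = v" if "u \<in> carrier S" "v \<in> carrier S" for u v
    using that by (simp add: S.minus_eq S.a_comm[of u] S.a_assoc S.r_neg)
  then show ?thesis using a by (simp add: X_C)
qed

text \<open>\<open>\<delta>(a) = \<theta> a - a \<theta>\<close> stays in any two-sided ideal that
  contains \<open>a\<close>.\<close>

lemma cst_core_delta_ideal:
  assumes "left_ideal S G"
  shows "delta_ideal R \<delta> (cst (core G))"
proof (rule delta_idealI)
  note K = left_ideal_core[OF assms]
  show "left_ideal R (cst (core G))" by (rule cst_ideal[OF K])
  fix a assume "a \<in> cst (core G)"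
  then have a: "a \<in> carrier R" "C a \<in> core G" by (auto simp: cst_def)
  have "C (\<delta> a) \<in> core G"
    unfolding C_d[OF a(1)]
    by (rule S.left_ideal_minus[OF K left_idealD(5)[OF K X_closed a(2)] core_right[OF assms a(2) X_closed]])
  then show "\<delta> a \<in> cst (core G)" using a(1) by (simp add: cst_def)
qed

text \<open>The faithfulness criterion for \<open>S/G\<close>: a non-zero annihilator would meet
  \<open>R\<close> in a non-zero \<open>\<delta>\<close>-ideal contained in
  \<open>G\<close>.\<close>

lemma core_zero:
  assumes G: "left_ideal S G" and P: "\<And>I. \<lbrakk>delta_ideal R \<delta> I; I \<subseteq> cst G\<rbrakk> \<Longrightarrow> I = {\<zero>}"
    and p: "p \<in> core G"
  shows "p = \<zero>\<^bsub>S\<^esub>"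
proof (rule ccontr)
  assume "p \<noteq> \<zero>\<^bsub>S\<^esub>"
  obtain b where b: "b \<in> carrier R" "\<delta> b \<noteq> \<zero>" using nontrivial by blast
  obtain a where a: "a \<in> cst (core G)" "a \<noteq> \<zero>"
    by (rule two_sided_ideal_meets[OF char0 b left_ideal_core[OF G] _ p \<open>p \<noteq> \<zero>\<^bsub>S\<^esub>\<close>])
      (use core_right[OF G] b in auto)
  have "cst (core G) \<subseteq> cst G" using core_subset by (auto simp: cst_def)
  then have "cst (core G) = {\<zero>}" using P cst_core_delta_ideal[OF G] by blast
  then show False using a by blast
qed

text \<open>A left ideal above \<open>SP\<close> contracts to \<open>P\<close> or to
  \<open>R\<close>; in the first case the uniqueness of \<open>SP\<close> applies.\<close>

lemma left_maximal_W:
  assumes "maximalideal P R" "\<not> \<delta> ` P \<subseteq> P"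
  shows "left_maximal S (W P)"
  unfolding left_maximal_def
proof (intro conjI allI impI)
  have M: "left_maximal R P" using assms(1) left_maximal_iff_maximalideal by blast
  then have P: "left_ideal R P" by (simp add: left_maximal_def)
  show W: "left_ideal S (W P)" by (rule W_left_ideal[OF P])
  show "W P \<noteq> carrier S" using cst_one[OF W] cst_W[OF P] left_maximal_one[OF M] by simp
  fix H assume H: "left_ideal S H \<and> W P \<subseteq> H"
  have "cst (W P) \<subseteq> cst H" using H by (auto simp: cst_def)
  then have "cst H = P \<or> cst H = carrier R"
    using cst_W[OF P] cst_ideal[of H] H M unfolding left_maximal_def by metis
  then show "H = W P \<or> H = carrier S"
    using left_ideal_eq_W[OF char0 maximalideal_prime[OF assms(1)] assms(2)] H cst_one[of H] by auto
qed

lemma left_ideal_vanish0: "left_ideal S vanish0"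
proof (rule left_ideal_SI)
  show "X \<star> p \<in> vanish0" if "p \<in> vanish0" for p
    using that by (simp add: vanish0_def cf_X_mult)
qed (auto simp: vanish0_def cf_add cf_C_mult cf_zero)

lemma X_vanish0: "X \<in> vanish0" and one_vanish0: "\<one>\<^bsub>S\<^esub> \<notin> vanish0"
  by (auto simp: vanish0_def cf_X C_one[symmetric] cf_C)

text \<open>This settles the case that \<open>R\<close> is a field. For \<open>P = 0\<close> the
  left ideal \<open>SP\<close> is zero and not maximal, and \<open>S\<theta>\<close>, which also
  meets \<open>R\<close> in zero, replaces it.\<close>

lemma left_maximal_vanish0:
  assumes "maximalideal {\<zero>} R"
  shows "left_maximal S vanish0"
  unfolding left_maximal_def
proof (intro conjI allI impI left_ideal_vanish0)
  show "vanish0 \<noteq> carrier S" using one_vanish0 by auto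
  fix H assume H: "left_ideal S H \<and> vanish0 \<subseteq> H"
  show "H = vanish0 \<or> H = carrier S"
  proof (cases "H \<subseteq> vanish0")
    case False
    then obtain h where h: "h \<in> H" "h \<notin> vanish0" by blast
    have hc: "h \<in> carrier S" using left_idealD(2)[OF conjunct1[OF H] h(1)] .
    have "h \<boxminus> C (h 0) \<in> vanish0" using hc by (simp add: vanish0_def cf_minus cf_C minus_eq r_neg)
    then have "h \<boxminus> (h \<boxminus> C (h 0)) \<in> H" using S.left_ideal_minus[OF _ h(1)] H by blast
    also have "h \<boxminus> (h \<boxminus> C (h 0)) = C (h 0)"
      using hc by (intro S_eqI) (simp add: cf_minus, simp add: minus_eq minus_add r_neg1 r_neg2)
    finally have "h 0 \<in> cst H" using hc by (simp add: cst_def)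
    moreover have "h 0 \<noteq> \<zero>" using h(2) hc by (simp add: vanish0_def)
    moreover have "left_maximal R {\<zero>}" using assms left_maximal_iff_maximalideal by blast
    ultimately have "cst H = carrier R"
      using cst_ideal[of H] H left_idealD(3)[OF cst_ideal[of H]] unfolding left_maximal_def by blast
    then show ?thesis using cst_one[of H] H by auto
  qed (use H in blast)
qed

theorem delta_primitive_imp_primitive:
  assumes "delta_primitive R \<delta>"
  shows "primitive_ring S"
proof -
  obtain P where P: "maximalideal P R" "\<And>I. \<lbrakk>delta_ideal R \<delta> I; I \<subseteq> P\<rbrakk> \<Longrightarrow> I = {\<zero>}"
    using assms by (auto simp: delta_primitive_def)
  have PI: "left_ideal R P" using P(1) left_maximal_iff_maximalideal by (auto simp: left_maximal_def)
  have "\<exists>G. left_maximal S G \<and> cst G = P"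
  proof (cases "P = {\<zero>}")
    case True
    then have "cst vanish0 = P" by (auto simp: cst_def vanish0_def cf_C)
    then show ?thesis using left_maximal_vanish0 P(1) True by auto
  next
    case False
    then have "\<not> \<delta> ` P \<subseteq> P" using P(2)[OF delta_idealI[OF PI]] by blast
    then show ?thesis using left_maximal_W[OF P(1)] cst_W[OF PI] by blast
  qed
  then obtain G where G: "left_maximal S G" "cst G = P" by blast
  have LI: "left_ideal S G" using G(1) by (simp add: left_maximal_def)
  have "a = \<zero>\<^bsub>S\<^esub>" if "a \<in> carrier S" "\<forall>s\<in>carrier S. a \<star> s \<in> G" for a
    by (rule core_zero[OF LI]) (use P(2) G(2) that in \<open>auto simp: core_def\<close>)
  then show ?thesis using primitive_ring_iff[OF S.ring_axioms] G(1) by blast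
qed

section \<open>Division by an operator of minimal order\<close>

lemma left_ideal_coefficients:
  assumes "delta_ideal R \<delta> I"
  shows "left_ideal S {p \<in> carrier S. \<forall>n. p n \<in> I}"
proof (rule left_ideal_SI)
  note D = left_idealD[OF delta_idealD(1)[OF assms]]
  show "X \<star> p \<in> {p \<in> carrier S. \<forall>n. p n \<in> I}" if "p \<in> {p \<in> carrier S. \<forall>n. p n \<in> I}" for p
    using that D(3,4) delta_idealD(2)[OF assms] by (auto simp: cf_X_mult)
qed (use left_idealD[OF delta_idealD(1)[OF assms]] in \<open>auto simp: cf_add cf_C_mult cf_zero\<close>)

text \<open>Right division by \<open>g\<close>: the leading coefficient of \<open>g\<close> need not
  be invertible, so each of the \<open>m\<close> steps multiplies the dividend by it on the left.
  The exponent depends only on the order bound, not on \<open>p\<close>.\<close>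

lemma pseudo_division:
  assumes g: "g \<in> U (Suc d)"
  shows "p \<in> U (d + m) \<Longrightarrow> \<exists>q\<in>U m. C (g d [^] m) \<star> p \<boxminus> q \<star> g \<in> U d"
proof (induction m arbitrary: p)
  case 0
  have "C (g d [^] (0::nat)) \<star> p \<boxminus> \<zero>\<^bsub>S\<^esub> \<star> g = p"
    using U_closed[OF g] U_closed[OF 0] by (simp add: C_one S.minus_eq)
  then show ?case using zero_U[of 0] 0 by (intro bexI[of _ "\<zero>\<^bsub>S\<^esub>"]) simp_all
next
  case (Suc m)
  note car = U_closed[OF g] U_closed[OF Suc.prems]
  let ?e = "d + m"
  have p: "p \<in> U (Suc ?e)" using Suc.prems by simp
  define M where "M = C (p ?e) \<star> (X [^]\<^bsub>S\<^esub> m)"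
  have M: "M \<in> U (Suc m)" unfolding M_def by (rule UI) (use car in \<open>auto simp: cf_monom\<close>)
  have Mm: "M m = p ?e" using car by (simp add: M_def cf_monom)
  have Mc: "M \<in> carrier S" by (rule U_closed[OF M])
  define p1 where "p1 = C (g d) \<star> p \<boxminus> M \<star> g"
  have p1c: "p1 \<in> carrier S" using car Mc by (simp add: p1_def)
  have Mg: "M \<star> g \<in> U (Suc ?e)" "(M \<star> g) ?e = p ?e \<otimes> g d"
    using mult_top[OF M g] Mm by (simp_all add: add.commute)
  have "p1 \<in> U ?e"
  proof (rule U_SucD)
    show "p1 \<in> U (Suc ?e)"
      unfolding p1_def using U_minus[OF U_C_mult[OF _ p] Mg(1)] car by simp
    show "p1 ?e = \<zero>"
      unfolding p1_def using car Mc Mg(2) by (simp add: cf_minus cf_C_mult m_comm minus_eq r_neg)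
  qed
  then obtain q where q: "q \<in> U m" "C (g d [^] m) \<star> p1 \<boxminus> q \<star> g \<in> U d"
    using Suc.IH by blast
  note qc = U_closed[OF q(1)]
  let ?c = "C (g d [^] m)"
  have cc: "?c \<in> carrier S" using car by simp
  have "C (g d [^] Suc m) = ?c \<star> C (g d)" using car by (simp add: C_mult)
  then have "C (g d [^] Suc m) \<star> p \<boxminus> (?c \<star> M \<boxplus> q) \<star> g =
      ?c \<star> p1 \<boxminus> q \<star> g"
    unfolding p1_def using car Mc qc cc
    by (simp add: S.minus_eq S.l_distr S.r_distr S.m_assoc S.minus_add S.a_assoc S.r_minus)
  moreover have "?c \<star> M \<boxplus> q \<in> U (Suc m)"
    using U_add[OF U_C_mult[OF _ M] U_mono[OF _ q(1)]] car by simp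
  ultimately show ?case using q(2) by metis
qed

lemma min_order_exists:
  assumes "left_ideal S G" "G \<noteq> {\<zero>\<^bsub>S\<^esub>}"
  obtains d g where "g \<in> G" "g \<in> U (Suc d)" "g d \<noteq> \<zero>" "\<And>r. \<lbrakk>r \<in> G; r \<in> U d\<rbrakk> \<Longrightarrow> r = \<zero>\<^bsub>S\<^esub>"
proof -
  let ?P = "\<lambda>d. \<exists>g. g \<in> G \<and> g \<in> U (Suc d) \<and> g d \<noteq> \<zero>"
  have ex: "\<exists>d. ?P d \<and> (\<forall>k. r \<in> U k \<longrightarrow> d < k)" if r: "r \<in> G" "r \<noteq> \<zero>\<^bsub>S\<^esub>" for r
  proof -
    obtain d where d: "r \<in> U (Suc d)" "r d \<noteq> \<zero>"
      using top_exists[OF left_idealD(2)[OF assms(1) r(1)] r(2)] by blast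
    then show ?thesis using r(1) U_zero by (metis not_le)
  qed
  obtain r where "r \<in> G" "r \<noteq> \<zero>\<^bsub>S\<^esub>" using assms left_idealD(3)[OF assms(1)] by blast
  then have "\<exists>d. ?P d" using ex by blast
  then have P: "?P (LEAST d. ?P d)" by (rule LeastI_ex)
  then obtain g where g: "g \<in> G" "g \<in> U (Suc (LEAST d. ?P d))" "g (LEAST d. ?P d) \<noteq> \<zero>" by blast
  have "r = \<zero>\<^bsub>S\<^esub>" if r: "r \<in> G" "r \<in> U (LEAST d. ?P d)" for r
  proof (rule ccontr)
    assume "r \<noteq> \<zero>\<^bsub>S\<^esub>"
    then obtain d where "?P d" "d < (LEAST d. ?P d)" using ex[OF r(1)] r(2) by blast
    then show False using not_less_Least[of d ?P] by blast
  qed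
  then show thesis using that g by blast
qed

lemma prime_pow:
  assumes "left_maximal R P" "a \<in> carrier R" "a [^] (n::nat) \<in> P"
  shows "a \<in> P"
  using assms(3)
proof (induction n)
  case 0
  then show ?case using left_maximal_one[OF assms(1)] by simp
next
  case (Suc n)
  then show ?case using left_maximal_prime[OF assms(1), of "a [^] n" a] assms(2) by auto
qed

text \<open>\<open>f\<close> is the leading coefficient of an element of \<open>G\<close> of minimal order.\<close>

lemma power_in_delta_ideal:
  assumes G: "left_maximal S G" and core: "core G = {\<zero>\<^bsub>S\<^esub>}" and cst: "cst G = {\<zero>}"
  obtains f where "f \<in> carrier R" "f \<noteq> \<zero>"
    "\<And>I. \<lbrakk>delta_ideal R \<delta> I; I \<noteq> {\<zero>}\<rbrakk> \<Longrightarrow> \<exists>k::nat. f [^] k \<in> I"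
proof -
  have LI: "left_ideal S G" using G by (simp add: left_maximal_def)
  have "G \<noteq> {\<zero>\<^bsub>S\<^esub>}"
  proof
    assume "G = {\<zero>\<^bsub>S\<^esub>}"
    then have "vanish0 = {\<zero>\<^bsub>S\<^esub>} \<or> vanish0 = carrier S"
      using G left_ideal_vanish0 left_idealD(3)[OF left_ideal_vanish0] unfolding left_maximal_def by simp
    moreover have "X \<noteq> \<zero>\<^bsub>S\<^esub>" using cf_X[of 1] cf_zero[of 1] by auto
    ultimately show False using X_vanish0 one_vanish0 by auto
  qed
  then obtain d g where g: "g \<in> G" "g \<in> U (Suc d)" "g d \<noteq> \<zero>"
    and least: "\<And>r. \<lbrakk>r \<in> G; r \<in> U d\<rbrakk> \<Longrightarrow> r = \<zero>\<^bsub>S\<^esub>" using min_order_exists[OF LI] by metis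
  have gc: "g \<in> carrier S" by (rule U_closed[OF g(2)])
  define f where "f = g d"
  have f: "f \<in> carrier R" "f \<noteq> \<zero>" using g(3) gc by (auto simp: f_def)
  \<comment> \<open>An element of order zero would be a non-zero constant in \<open>G\<close>,
    against \<open>cst G = {\<zero>}\<close>.\<close>
  have d: "d > 0"
  proof (rule ccontr)
    assume "\<not> d > 0"
    then have "g = C f" using U_1 g(2) by (simp add: f_def)
    then have "f \<in> cst G" using g(1) f(1) by (simp add: cst_def)
    then show False using cst f(2) by simp
  qed
  show thesis
  proof (rule that[OF f])
    fix I assume I: "delta_ideal R \<delta> I" "I \<noteq> {\<zero>}"
    let ?I = "{p \<in> carrier S. \<forall>n. p n \<in> I}"
    note II = delta_idealD(1)[OF I(1)]
    note D = left_idealD[OF II] and II' = left_ideal_coefficients[OF I(1)]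
    note D' = left_idealD[OF II']
    have mI: "C a \<star> s \<in> ?I" if "a \<in> I" "s \<in> carrier S" for a s
      using that D(2,5) by (auto simp: cf_C_mult m_comm[of a])
    \<comment> \<open>Modulo operators with coefficients in \<open>I\<close>, \<open>q g\<close>
      equals \<open>f^k\<close>. As \<open>d > 0\<close>, the coefficient of \<open>q g\<close> in
      the top order \<open>m + d\<close> lies in \<open>I\<close>, so \<open>f\<close> times the
      leading coefficient of \<open>q\<close> does. Multiplying by \<open>f\<close> thus removes the
      leading term of \<open>q\<close> and raises \<open>k\<close> by one; for \<open>q = 0\<close>
      a power of \<open>f\<close> lies in \<open>I\<close>.\<close>
    have descend: "q \<in> U m \<Longrightarrow> q \<star> g \<boxminus> C (f [^] k) \<in> ?I \<Longrightarrow> \<exists>k::nat. f [^] k \<in> I"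
      for q m and k :: nat
    proof (induction m arbitrary: q k)
      case 0
      then have "(\<zero>\<^bsub>S\<^esub> \<star> g \<boxminus> C (f [^] k)) 0 \<in> I" using U_0 by blast
      then have "\<ominus> (f [^] k) \<in> I" using f gc by (simp add: cf_minus cf_zero cf_C minus_eq)
      then show ?case using left_ideal_a_inv[OF II] f(1) by (metis minus_minus nat_pow_closed)
    next
      case (Suc m)
      note qc = U_closed[OF Suc.prems(1)]
      have "(q \<star> g \<boxminus> C (f [^] k)) (m + d) \<in> I" using Suc.prems(2) by blast
      then have qm: "q m \<otimes> f \<in> I"
        using mult_top(2)[OF Suc.prems(1) g(2)] qc gc f d by (simp add: cf_minus cf_C f_def minus_eq)
      let ?M = "C (q m) \<star> (X [^]\<^bsub>S\<^esub> m)"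
      define q' where "q' = C f \<star> (q \<boxminus> ?M)"
      have q': "q' \<in> U m" unfolding q'_def by (rule U_C_mult[OF f(1) strip_top[OF Suc.prems(1)]])
      have Mc: "?M \<in> carrier S" using qc by simp
      have "C f \<star> C (q m) = C (q m \<otimes> f)" using f qc by (simp add: C_mult[symmetric] m_comm)
      then have M: "C f \<star> (?M \<star> g) = C (q m \<otimes> f) \<star> ((X [^]\<^bsub>S\<^esub> m) \<star> g)"
        using f qc gc by (simp add: S.m_assoc[symmetric])
      have fk: "C (f [^] Suc k) = C f \<star> C (f [^] k)" using f by (simp add: C_mult[symmetric] m_comm)
      have "q' \<star> g \<boxminus> C (f [^] Suc k) =
          C f \<star> (q \<star> g \<boxminus> C (f [^] k)) \<boxminus> C f \<star> (?M \<star> g)"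
      proof -
        have "(u \<star> (v \<boxminus> w)) \<star> g \<boxminus> u \<star> z = u \<star> (v \<star> g \<boxminus> z) \<boxminus> u \<star> (w \<star> g)"
          if "u \<in> carrier S" "v \<in> carrier S" "w \<in> carrier S" "z \<in> carrier S" for u v w z
          using that gc by (simp add: S.minus_eq S.l_distr S.r_distr S.m_assoc S.l_minus S.r_minus S.a_ac)
        then show ?thesis unfolding q'_def fk using f qc Mc by simp
      qed
      also have "\<dots> \<in> ?I"
        unfolding M
        by (rule S.left_ideal_minus[OF II' D'(5)[OF C_closed[OF f(1)] Suc.prems(2)] mI[OF qm]])
          (use gc in simp)
      finally show ?case by (rule Suc.IH[OF q'])
    qed
    obtain a where a: "a \<in> I" "a \<noteq> \<zero>" using I(2) D(3) by blast
    \<comment> \<open>Faithfulness enters here: the operators with coefficients in \<open>I\<close>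
      are not all in \<open>G\<close>, so together with the maximal left ideal \<open>G\<close> they
      generate \<open>S\<close>. A resulting equation \<open>1 = l + h\<close>, multiplied by
      \<open>f^m\<close> and divided by \<open>g\<close>, starts the descent.\<close>
    have "C a \<notin> core G" using core a(2) C_eq_zero_iff by simp
    then obtain s where s: "s \<in> carrier S" "C a \<star> s \<notin> G" using D(2)[OF a(1)] by (auto simp: core_def)
    let ?sum = "ideal_plus S G ?I"
    note up = S.left_ideal_sum_upper[OF LI II']
    have "C a \<star> s \<in> ?sum" by (rule subsetD[OF up(2) mI[OF a(1) s(1)]])
    then have "?sum \<noteq> G" using s(2) by blast
    then have "?sum = carrier S"
      using G S.left_ideal_sum[OF LI II'] up(1) unfolding left_maximal_def by blast
    then have "\<one>\<^bsub>S\<^esub> \<in> ?sum" by simp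
    then obtain l h where lh: "l \<in> G" "h \<in> ?I" "\<one>\<^bsub>S\<^esub> = l \<boxplus> h" by blast
    have lc: "l \<in> carrier S" and hc: "h \<in> carrier S" using left_idealD(2)[OF LI lh(1)] lh(2) by auto
    obtain m where "l \<in> U m" using U_exists[OF lc] by blast
    then have "l \<in> U (d + m)" using U_mono[of m "d + m"] by simp
    then obtain q where q: "q \<in> U m" "C (f [^] m) \<star> l \<boxminus> q \<star> g \<in> U d"
      using pseudo_division[OF g(2)] unfolding f_def by blast
    note qc = U_closed[OF q(1)]
    let ?fm = "C (f [^] m)"
    have fmc: "?fm \<in> carrier S" using f by simp
    have "?fm \<star> l \<boxminus> q \<star> g = \<zero>\<^bsub>S\<^esub>"
      by (rule least[OF S.left_ideal_minus[OF LI left_idealD(5)[OF LI fmc lh(1)] left_idealD(5)[OF LI qc g(1)]] q(2)])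
    then have eq: "?fm \<star> l = q \<star> g" using fmc lc qc gc by simp
    have "?fm = ?fm \<star> (l \<boxplus> h)" unfolding lh(3)[symmetric] using fmc by simp
    also have "\<dots> = q \<star> g \<boxplus> ?fm \<star> h" using fmc lc hc eq by (simp add: S.r_distr)
    finally have "q \<star> g \<boxminus> ?fm = q \<star> g \<boxminus> (q \<star> g \<boxplus> ?fm \<star> h)" by simp
    also have "\<dots> = \<zero>\<^bsub>S\<^esub> \<boxminus> ?fm \<star> h"
      using fmc qc gc hc by (simp add: S.minus_eq S.minus_add S.a_assoc[symmetric] S.r_neg)
    also have "\<dots> \<in> ?I" by (rule S.left_ideal_minus[OF II' D'(3) D'(5)[OF fmc lh(2)]])
    finally show "\<exists>k::nat. f [^] k \<in> I" by (rule descend[OF q(1)])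
  qed
qed

text \<open>When \<open>G\<close> meets \<open>R\<close> non-trivially, \<open>G\<close> may be
  replaced by \<open>(G : s)\<close> for any \<open>s\<close> outside \<open>G\<close>: this only
  changes the generator of the simple module \<open>S/G\<close>. Choosing \<open>s\<close> with
  \<open>(G : s) \<inter> R\<close> maximal among the non-zero contractions makes this contraction a
  prime ideal.\<close>

theorem primitive_imp_delta_primitive:
  assumes noeth: "left_noetherian R" and jac: "zero_jacobson R" and prim: "primitive_ring S"
  shows "delta_primitive R \<delta>"
proof -
  obtain G where G: "left_maximal S G"
    and "\<And>a. \<lbrakk>a \<in> carrier S; \<forall>s\<in>carrier S. a \<star> s \<in> G\<rbrakk> \<Longrightarrow> a = \<zero>\<^bsub>S\<^esub>"
    using prim primitive_ring_iff[OF S.ring_axioms] by blast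
  then have core0: "\<And>a. a \<in> core G \<Longrightarrow> a = \<zero>\<^bsub>S\<^esub>" by (simp add: core_def)
  have LI: "left_ideal S G" using G by (simp add: left_maximal_def)
  have core: "core G = {\<zero>\<^bsub>S\<^esub>}" using core0 left_idealD(3)[OF left_ideal_core[OF LI]] by blast
  show ?thesis
  proof (cases "cst G = {\<zero>}")
    case True
    obtain f where f: "f \<in> carrier R" "f \<noteq> \<zero>"
      "\<And>I. \<lbrakk>delta_ideal R \<delta> I; I \<noteq> {\<zero>}\<rbrakk> \<Longrightarrow> \<exists>k::nat. f [^] k \<in> I"
      using power_in_delta_ideal[OF G core True] by blast
    obtain P where P: "left_maximal R P" "f \<notin> P" using jac f(1,2) by (auto simp: zero_jacobson_def)
    have "I = {\<zero>}" if "delta_ideal R \<delta> I" "I \<subseteq> P" for I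
      using f(3)[OF that(1)] prime_pow[OF P(1) f(1)] P(2) that(2) by blast
    then show ?thesis
      using P(1) left_maximal_iff_maximalideal unfolding delta_primitive_def by blast
  next
    case False
    \<comment> \<open>\<open>col s\<close> is \<open>(G : s)\<close>, the annihilator of the coset
      of \<open>s\<close> in \<open>S/G\<close>.\<close>
    define col where "col s = {t \<in> carrier S. t \<star> s \<in> G}" for s
    have colI: "left_ideal S (col s)" if "s \<in> carrier S" for s
      using S.left_ideal_colon[OF LI that] by (simp add: col_def)
    let ?F = "{cst (col s) | s. s \<in> carrier S \<and> s \<notin> G \<and> cst (col s) \<noteq> {\<zero>}}"
    have one: "\<one>\<^bsub>S\<^esub> \<notin> G" using S.left_maximal_one[OF G] .
    have "col \<one>\<^bsub>S\<^esub> = G" using left_idealD(1)[OF LI] by (auto simp: col_def)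
    then have ne: "?F \<noteq> {}" using one False by blast
    have "\<exists>Q. Q \<in> ?F \<and> (\<forall>K. K \<in> ?F \<longrightarrow> Q \<subseteq> K \<longrightarrow> K = Q)"
      by (rule left_noetherian_maximal[OF noeth ne]) (use cst_ideal colI in blast)+
    then obtain s where s: "s \<in> carrier S" "s \<notin> G" "cst (col s) \<noteq> {\<zero>}"
      and max: "\<And>K. \<lbrakk>K \<in> ?F; cst (col s) \<subseteq> K\<rbrakk> \<Longrightarrow> K = cst (col s)" by blast
    define G' where "G' = col s"
    define Q where "Q = cst G'"
    have G'I: "left_ideal S G'" unfolding G'_def by (rule colI[OF s(1)])
    have QI: "left_ideal R Q" unfolding Q_def by (rule cst_ideal[OF G'I])
    have Q0: "Q \<noteq> {\<zero>}" using s(3) by (simp add: Q_def G'_def)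
    have Qiff: "a \<in> Q \<longleftrightarrow> a \<in> carrier R \<and> C a \<star> s \<in> G" for a
      by (auto simp: Q_def G'_def cst_def col_def)
    have prime: "primeideal Q R"
    proof (rule primeidealI)
      show "ideal Q R" using QI left_ideal_iff_ideal by blast
      show "carrier R \<noteq> Q" using Qiff[of \<one>] s by (auto simp: C_one)
      fix a b assume ab: "a \<in> carrier R" "b \<in> carrier R" "a \<otimes> b \<in> Q"
      \<comment> \<open>If \<open>a\<close> is not in \<open>Q\<close>, then \<open>a s\<close> is
        another generator. Its contraction contains \<open>Q\<close>, so it equals \<open>Q\<close>
        by maximality; and it contains \<open>b\<close>.\<close>
      show "a \<in> Q \<or> b \<in> Q"
      proof (cases "a \<in> Q")
        case False
        let ?s = "C a \<star> s"
        have as: "?s \<notin> G" using False ab(1) Qiff by blast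
        have comm: "C c \<star> ?s = C a \<star> (C c \<star> s)" if "c \<in> carrier R" for c
          using that ab(1) s(1) by (simp add: S.m_assoc[symmetric] C_mult[symmetric] m_comm)
        have sub: "Q \<subseteq> cst (col ?s)"
        proof
          fix c assume "c \<in> Q"
          then have c: "c \<in> carrier R" "C c \<star> s \<in> G" using Qiff by auto
          then have "C c \<star> ?s \<in> G" using comm[OF c(1)] left_idealD(5)[OF LI _ c(2)] ab(1) by simp
          then show "c \<in> cst (col ?s)" using c(1) by (simp add: cst_def col_def)
        qed
        have sc: "?s \<in> carrier S" using ab(1) s(1) by simp
        have "cst (col ?s) \<noteq> {\<zero>}" using sub Q0 left_idealD(3)[OF QI] by blast
        then have "cst (col ?s) \<in> ?F" using as sc by blast
        then have eq: "cst (col ?s) = Q" using max sub unfolding Q_def G'_def by blast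
        have "C (a \<otimes> b) \<star> s \<in> G" using ab(3) Qiff by blast
        then have "C b \<star> ?s \<in> G"
          using ab(1,2) s(1) by (simp add: S.m_assoc[symmetric] C_mult[symmetric] m_comm)
        then have "b \<in> cst (col ?s)" using ab(2) by (simp add: cst_def col_def)
        then show ?thesis using eq by simp
      qed simp
    qed (rule is_cring)
    \<comment> \<open>Since \<open>G + Ss = S\<close>, whatever kills \<open>S s\<close> modulo
      \<open>G\<close> kills all of \<open>S/G\<close>.\<close>
    have G'core: "p = \<zero>\<^bsub>S\<^esub>" if p: "p \<in> core G'" for p
    proof (rule core0)
      have pc: "p \<in> carrier S" "\<And>t. t \<in> carrier S \<Longrightarrow> (p \<star> t) \<star> s \<in> G"
        using p by (auto simp: core_def G'_def col_def)
      let ?Ss = "principal_left S s"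
      let ?sum = "ideal_plus S G ?Ss"
      have Ss: "left_ideal S ?Ss" by (rule S.left_ideal_right_mult[OF S.left_ideal_carrier s(1)])
      have "s \<in> ?Ss" using s(1) by (intro image_eqI[of _ _ "\<one>\<^bsub>S\<^esub>"]) auto
      then have "s \<in> ?sum" by (rule subsetD[OF S.left_ideal_sum_upper(2)[OF LI Ss]])
      then have "?sum \<noteq> G" using s(2) by blast
      then have full: "?sum = carrier S"
        using G S.left_ideal_sum[OF LI Ss] S.left_ideal_sum_upper(1)[OF LI Ss]
        unfolding left_maximal_def by blast
      have "p \<star> u \<in> G" if "u \<in> carrier S" for u
      proof -
        have "u \<in> ?sum" using full that by simp
        then obtain l t where lt: "l \<in> G" "t \<in> carrier S" "u = l \<boxplus> t \<star> s" by blast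
        have "p \<star> u = p \<star> l \<boxplus> (p \<star> t) \<star> s"
          unfolding lt(3) using pc(1) lt(2) s(1) left_idealD(2)[OF LI lt(1)]
          by (simp add: S.r_distr S.m_assoc)
        then show ?thesis
          using left_idealD(4)[OF LI left_idealD(5)[OF LI pc(1) lt(1)] pc(2)[OF lt(2)]] by simp
      qed
      then show "p \<in> core G" using pc(1) by (simp add: core_def)
    qed
    \<comment> \<open>If \<open>a\<close> lies in a \<open>\<delta>\<close>-ideal
      \<open>I \<subseteq> Q\<close>, then \<open>aS\<close> has coefficients in \<open>I\<close>
      and so lies in \<open>(G : s)\<close>; thus \<open>a\<close> is in its zero core.\<close>
    have no_delta: "I = {\<zero>}" if I: "delta_ideal R \<delta> I" "I \<subseteq> Q" for I
    proof -
      note D = left_idealD[OF delta_idealD(1)[OF I(1)]]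
      have "a = \<zero>" if a: "a \<in> I" for a
      proof -
        have ac: "a \<in> carrier R" by (rule D(2)[OF a])
        have "C a \<star> t \<in> G'" if t: "t \<in> carrier S" for t
        proof (rule coefficients_in_delta_ideal[OF G'I I(1)])
          show "C b \<in> G'" if "b \<in> I" for b using that I(2) by (auto simp: Q_def cst_def)
          show "(C a \<star> t) n \<in> I" for n
            using ac t D(5)[OF _ a, of "t n"] by (simp add: cf_C_mult m_comm)
        qed (use ac t in simp)
        then have "C a \<in> core G'" using ac by (simp add: core_def)
        then show ?thesis using G'core C_eq_zero_iff by blast
      qed
      then show ?thesis using D(3) by blast
    qed
    have unstable: "\<not> \<delta> ` Q \<subseteq> Q" using no_delta[OF delta_idealI[OF QI]] Q0 by blast
    have G'W: "G' = W Q" using left_ideal_eq_W[OF char0 prime unstable G'I] by (simp add: Q_def)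
    have G'max: "H = carrier S" if H: "left_ideal S H" "G' \<subseteq> H" "H \<noteq> G'" for H
    proof -
      obtain h where h: "h \<in> H" "h \<notin> G'" using H by blast
      have hc: "h \<in> carrier S" by (rule left_idealD(2)[OF H(1) h(1)])
      let ?Hs = "(\<lambda>t. t \<star> s) ` H"
      let ?sum = "ideal_plus S G ?Hs"
      have Hs: "left_ideal S ?Hs" by (rule S.left_ideal_right_mult[OF H(1) s(1)])
      have "h \<star> s \<in> ?sum" using h(1) by (intro subsetD[OF S.left_ideal_sum_upper(2)[OF LI Hs]]) blast
      moreover have "h \<star> s \<notin> G" using h(2) hc by (simp add: G'_def col_def)
      ultimately have "?sum \<noteq> G" by blast
      then have "?sum = carrier S"
        using G S.left_ideal_sum[OF LI Hs] S.left_ideal_sum_upper(1)[OF LI Hs]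
        unfolding left_maximal_def by blast
      then have "s \<in> ?sum" using s(1) by simp
      then obtain l t where lt: "l \<in> G" "t \<in> H" "s = l \<boxplus> t \<star> s" by blast
      have car: "l \<in> carrier S" "t \<in> carrier S" using left_idealD(2)[OF LI lt(1)] left_idealD(2)[OF H(1) lt(2)] .
      have "(\<one>\<^bsub>S\<^esub> \<boxminus> t) \<star> s = s \<boxminus> t \<star> s"
        using car s(1) by (simp add: S.minus_eq S.l_distr S.l_minus)
      also have "\<dots> = (l \<boxplus> t \<star> s) \<boxminus> t \<star> s" using lt(3) by simp
      also have "\<dots> = l" using car s(1) by (simp add: S.minus_eq S.a_assoc S.r_neg)
      finally have "\<one>\<^bsub>S\<^esub> \<boxminus> t \<in> G'" using lt(1) car by (simp add: G'_def col_def)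
      then have "\<one>\<^bsub>S\<^esub> \<in> H" using S.left_ideal_diff_cancel[OF H(1) _ lt(2), of "\<one>\<^bsub>S\<^esub>"] H(2) by auto
      then show ?thesis by (rule S.left_ideal_one[OF H(1)])
    qed
    \<comment> \<open>Maximality descends from \<open>SQ\<close> to \<open>Q\<close>, since an ideal
      \<open>J\<close> is recovered from \<open>SJ\<close> as its contraction.\<close>
    have "left_maximal R Q"
      unfolding left_maximal_def
    proof (intro conjI allI impI QI)
      show "Q \<noteq> carrier R" using primeideal.I_notcarr[OF prime] by simp
      fix J assume J: "left_ideal R J \<and> Q \<subseteq> J"
      have "G' \<subseteq> W J" unfolding G'W using J W_mono by blast
      then have "W J = G' \<or> W J = carrier S" using G'max W_left_ideal J by blast
      then show "J = Q \<or> J = carrier R"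
      proof
        assume "W J = G'"
        then show ?thesis using cst_W[OF conjunct1[OF J]] by (simp add: Q_def)
      next
        assume "W J = carrier S"
        then have "J = cst (carrier S)" using cst_W[OF conjunct1[OF J]] by simp
        then show ?thesis by (auto simp: cst_def)
      qed
    qed
    then show ?thesis
      using no_delta left_maximal_iff_maximalideal unfolding delta_primitive_def by blast
  qed
qed

section \<open>The simple case in dimension at most one\<close>

text \<open>Leading coefficients in order \<open>n\<close>, with zero included. Multiplication by
  \<open>\<theta>\<close> makes them increase with \<open>n\<close>, so their union
  \<open>lam_inf\<close> is again an ideal and, \<open>R\<close> being Noetherian, is reached at
  some finite order.\<close>

definition lam :: "nat \<Rightarrow> (nat \<Rightarrow> 'a) set \<Rightarrow> 'a set" where
  "lam n H = (\<lambda>p. p n) ` (H \<inter> U (Suc n))"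

definition lam_inf :: "(nat \<Rightarrow> 'a) set \<Rightarrow> 'a set" where
  "lam_inf H = (\<Union>n. lam n H)"

lemma lam_ideal:
  assumes H: "left_ideal S H"
  shows "left_ideal R (lam n H)"
proof (rule left_idealI)
  note D = left_idealD[OF H]
  show "lam n H \<subseteq> carrier R" using D(2) by (auto simp: lam_def)
  have "\<zero>\<^bsub>S\<^esub> \<in> H \<inter> U (Suc n)" using D(3) zero_U by blast
  from imageI[OF this, of "\<lambda>p. p n"] show "\<zero> \<in> lam n H" by (simp only: lam_def cf_zero)
  fix x assume "x \<in> lam n H"
  then obtain p where p: "p \<in> H" "p \<in> U (Suc n)" "x = p n" by (auto simp: lam_def)
  show "x \<oplus> y \<in> lam n H" if "y \<in> lam n H" for y
  proof -
    obtain q where q: "q \<in> H" "q \<in> U (Suc n)" "y = q n"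
      using \<open>y \<in> lam n H\<close> by (auto simp: lam_def)
    show ?thesis
      unfolding lam_def using p q D(2,4) U_add[OF p(2) q(2)]
      by (intro image_eqI[of _ _ "p \<boxplus> q"]) (auto simp: cf_add)
  qed
  show "s \<otimes> x \<in> lam n H" if s: "s \<in> carrier R" for s
    unfolding lam_def using p D(2,5) U_C_mult[OF s p(2)] s
    by (intro image_eqI[of _ _ "C s \<star> p"]) (auto simp: cf_C_mult)
qed

lemma lam_Suc:
  assumes H: "left_ideal S H"
  shows "lam n H \<subseteq> lam (Suc n) H"
proof
  fix x assume "x \<in> lam n H"
  then obtain p where p: "p \<in> H" "p \<in> U (Suc n)" "x = p n" by (auto simp: lam_def)
  have pc: "p \<in> carrier S" by (rule U_closed[OF p(2)])
  have "(X \<star> p) (Suc n) = x" using pc p(3) U_zero[OF p(2), of "Suc n"] by (simp add: cf_X_mult)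
  moreover have "X \<star> p \<in> H" by (rule left_idealD(5)[OF H X_closed p(1)])
  ultimately show "x \<in> lam (Suc n) H"
    unfolding lam_def using X_mult_U[OF p(2)] by blast
qed

lemma lam_mono: "left_ideal S H \<Longrightarrow> n \<le> m \<Longrightarrow> lam n H \<subseteq> lam m H"
  by (rule lift_Suc_mono_le[of "\<lambda>n. lam n H"]) (use lam_Suc in auto)

lemma lam_inf_ideal:
  assumes H: "left_ideal S H"
  shows "left_ideal R (lam_inf H)"
proof (rule left_idealI)
  note D = left_idealD[OF lam_ideal[OF H]]
  show "lam_inf H \<subseteq> carrier R" using D(1) unfolding lam_inf_def by blast
  show "\<zero> \<in> lam_inf H" using D(3) unfolding lam_inf_def by blast
  fix x assume "x \<in> lam_inf H"
  then obtain n where n: "x \<in> lam n H" by (auto simp: lam_inf_def)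
  show "s \<otimes> x \<in> lam_inf H" if "s \<in> carrier R" for s
    using D(5)[OF that n] unfolding lam_inf_def by blast
  fix y assume "y \<in> lam_inf H"
  then obtain m where "y \<in> lam m H" by (auto simp: lam_inf_def)
  then have "x \<in> lam (max n m) H" "y \<in> lam (max n m) H"
    using n lam_mono[OF H, of n "max n m"] lam_mono[OF H, of m "max n m"] by auto
  then show "x \<oplus> y \<in> lam_inf H" using D(4) unfolding lam_inf_def by blast
qed

lemma lam_inf_attained:
  assumes noeth: "left_noetherian R" and H: "left_ideal S H"
  obtains m where "\<And>n. n \<ge> m \<Longrightarrow> lam n H = lam_inf H"
proof -
  have "\<exists>m. \<forall>n\<ge>m. lam n H = lam m H"
    using lam_ideal[OF H] lam_Suc[OF H]
    by (intro noeth[unfolded left_noetherian_def, rule_format]) blast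
  then obtain m where m: "\<And>n. n \<ge> m \<Longrightarrow> lam n H = lam m H" by blast
  have "lam k H \<subseteq> lam m H" for k
    using lam_mono[OF H, of k "max k m"] m[of "max k m"] by simp
  then have "lam m H = lam_inf H" unfolding lam_inf_def by blast
  then have "lam n H = lam_inf H" if "n \<ge> m" for n by (rule trans[OF m[OF that]])
  then show thesis by (rule that)
qed

text \<open>Subtracting elements of \<open>H\<close> brings any \<open>p \<in> H'\<close> below a
  fixed order \<open>m\<close>. Right division by \<open>g \<in> H\<close> then leaves a remainder
  in \<open>H'\<close> of order below \<open>d\<close>, hence zero. So the single power
  \<open>(g d)^m\<close> carries \<open>H'\<close> into \<open>H\<close>, independently of
  \<open>p\<close>.\<close>

lemma left_ideal_eq_of_lam_inf:
  assumes noeth: "left_noetherian R" and simple: "delta_simple R \<delta>"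
    and H: "left_ideal S H" "left_ideal S H'" "H \<subseteq> H'" "lam_inf H' \<subseteq> lam_inf H"
    and g: "g \<in> H" "g \<in> U (Suc d)" "g d \<noteq> \<zero>" and least: "\<And>r. \<lbrakk>r \<in> H'; r \<in> U d\<rbrakk> \<Longrightarrow> r = \<zero>\<^bsub>S\<^esub>"
  shows "H' \<subseteq> H"
proof -
  note D = left_idealD[OF H(1)] and D' = left_idealD[OF H(2)]
  obtain m where m: "\<And>n. n \<ge> m \<Longrightarrow> lam n H = lam_inf H" using lam_inf_attained[OF noeth H(1)] by blast
  \<comment> \<open>From order \<open>m\<close> on, the leading coefficients of \<open>H'\<close>
    are attained in \<open>H\<close> in the same order, so leading terms can be cancelled down to
    order below \<open>m\<close>.\<close>
  have low: "p \<in> H' \<Longrightarrow> p \<in> U k \<Longrightarrow> \<exists>h\<in>H. p \<boxminus> h \<in> H' \<inter> U m" for p k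
  proof (induction k arbitrary: p)
    case 0
    then have "p \<in> U m" using U_mono by blast
    then show ?case using 0 D'(2) D(3) by (intro bexI[of _ "\<zero>\<^bsub>S\<^esub>"]) (auto simp: S.minus_eq)
  next
    case (Suc k)
    show ?case
    proof (cases "Suc k \<le> m")
      case True
      then have "p \<in> U m" using U_mono Suc.prems(2) by blast
      then show ?thesis using Suc.prems(1) D'(2) D(3) by (intro bexI[of _ "\<zero>\<^bsub>S\<^esub>"]) (auto simp: S.minus_eq)
    next
      case False
      have "p k \<in> lam_inf H'" using Suc.prems unfolding lam_inf_def lam_def by blast
      then have "p k \<in> lam k H" using H(4) m[of k] False by auto
      then obtain h where h: "h \<in> H" "h \<in> U (Suc k)" "h k = p k" by (auto simp: lam_def)
      have car: "p \<in> carrier S" "h \<in> carrier S" using D'(2)[OF Suc.prems(1)] D(2)[OF h(1)] .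
      have "p \<boxminus> h \<in> U k"
        by (rule U_SucD[OF U_minus[OF Suc.prems(2) h(2)]])
          (use car h(3) in \<open>simp add: cf_minus minus_eq r_neg\<close>)
      moreover have "p \<boxminus> h \<in> H'" using S.left_ideal_minus[OF H(2) Suc.prems(1)] h(1) H(3) by blast
      ultimately obtain h' where h': "h' \<in> H" "p \<boxminus> h \<boxminus> h' \<in> H' \<inter> U m" using Suc.IH by blast
      have "p \<boxminus> h \<boxminus> h' = p \<boxminus> (h \<boxplus> h')"
        using car D(2)[OF h'(1)] by (simp add: S.minus_eq S.minus_add S.a_assoc)
      then show ?thesis using h'(2) D(4)[OF h(1) h'(1)] by metis
    qed
  qed
  define A where "A = {a \<in> carrier R. \<forall>p\<in>H'. C a \<star> p \<in> H}"
  have AI: "left_ideal R A"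
    by (rule left_idealI)
      (use D D'(2) in \<open>auto simp: A_def C_add C_mult S.l_distr S.m_assoc\<close>)
  have "delta_ideal R \<delta> A"
  proof (rule delta_idealI[OF AI])
    fix a assume "a \<in> A"
    then have a: "a \<in> carrier R" "\<And>p. p \<in> H' \<Longrightarrow> C a \<star> p \<in> H" by (auto simp: A_def)
    have "C (\<delta> a) \<star> p \<in> H" if p: "p \<in> H'" for p
    proof -
      have pc: "p \<in> carrier S" by (rule D'(2)[OF p])
      have "C (\<delta> a) \<star> p = X \<star> (C a \<star> p) \<boxminus> C a \<star> (X \<star> p)"
        unfolding C_d[OF a(1)] using a(1) pc by (simp add: S.minus_eq S.l_distr S.l_minus S.m_assoc)
      also have "\<dots> \<in> H"
        by (rule S.left_ideal_minus[OF H(1) D(5)[OF X_closed a(2)[OF p]] a(2)[OF D'(5)[OF X_closed p]]])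
      finally show ?thesis .
    qed
    then show "\<delta> a \<in> A" using a(1) by (simp add: A_def)
  qed
  moreover have "g d [^] m \<in> A"
  proof -
    have gc: "g \<in> carrier S" by (rule U_closed[OF g(2)])
    let ?c = "C (g d [^] m)"
    have cc: "?c \<in> carrier S" using gc by simp
    have "?c \<star> p \<in> H" if p: "p \<in> H'" for p
    proof -
      have pc: "p \<in> carrier S" by (rule D'(2)[OF p])
      obtain h where h: "h \<in> H" "p \<boxminus> h \<in> H'" "p \<boxminus> h \<in> U m"
        using low[OF p] U_exists[OF pc] by blast
      have hc: "h \<in> carrier S" by (rule D(2)[OF h(1)])
      have "p \<boxminus> h \<in> U (d + m)" using U_mono[OF _ h(3), of "d + m"] by simp
      then obtain q where q: "q \<in> U m" "?c \<star> (p \<boxminus> h) \<boxminus> q \<star> g \<in> U d"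
        using pseudo_division[OF g(2)] by blast
      note qc = U_closed[OF q(1)]
      have qg: "q \<star> g \<in> H" by (rule D(5)[OF qc g(1)])
      have "?c \<star> (p \<boxminus> h) \<boxminus> q \<star> g = \<zero>\<^bsub>S\<^esub>"
        by (rule least[OF S.left_ideal_minus[OF H(2) D'(5)[OF cc h(2)] subsetD[OF H(3) qg]] q(2)])
      then have eq: "?c \<star> (p \<boxminus> h) = q \<star> g" using cc pc hc qc gc by simp
      have "?c \<star> p \<boxminus> ?c \<star> h = q \<star> g"
        unfolding eq[symmetric] using cc pc hc by (simp add: S.minus_eq S.r_distr S.r_minus)
      then show ?thesis
        using S.left_ideal_diff_cancel[OF H(1) _ D(5)[OF cc h(1)], of "?c \<star> p"] qg cc pc by simp
    qed
    then show ?thesis using gc by (simp add: A_def)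
  qed
  moreover have "g d [^] m \<noteq> \<zero>"
    using U_closed[OF g(2)] g(3) by (induction m) (auto simp: integral_iff)
  ultimately have "A = carrier R" using simple unfolding delta_simple_def by blast
  then have "\<one> \<in> A" by simp
  then have "C \<one> \<star> p \<in> H" if "p \<in> H'" for p using that by (simp add: A_def)
  then show "H' \<subseteq> H" using D'(2) by (auto simp: C_one)
qed

text \<open>Two invariants control a descending chain. The ideals \<open>lam_inf (H n)\<close>
  contain \<open>lam_inf G \<noteq> 0\<close> and become stable in \<open>R\<close>. The minimal
  orders cannot decrease along the chain and are bounded by the order of an element of
  \<open>G\<close>.\<close>

theorem dcc_above_nonzero:
  assumes noeth: "left_noetherian R" and simple: "delta_simple R \<delta>" and dim: "krull_dim R \<le> 1"
    and G: "left_ideal S G" "G \<noteq> {\<zero>\<^bsub>S\<^esub>}"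
  shows "dcc_above S G"
  unfolding dcc_above_def
proof (intro allI impI)
  fix H :: "nat \<Rightarrow> (nat \<Rightarrow> 'a) set"
  assume "(\<forall>n. left_ideal S (H n) \<and> G \<subseteq> H n) \<and> (\<forall>n. H (Suc n) \<subseteq> H n)"
  then have H: "\<And>n. left_ideal S (H n)" "\<And>n. G \<subseteq> H n" "\<And>n. H (Suc n) \<subseteq> H n" by auto
  have anti: "H m \<subseteq> H n" if "n \<le> m" for n m using lift_Suc_antimono_le[of H] H(3) that by blast
  obtain d0 g0 where g0: "g0 \<in> G" "g0 \<in> U (Suc d0)" "g0 d0 \<noteq> \<zero>" using min_order_exists[OF G] by metis
  have "g0 d0 \<in> lam_inf G" using g0 unfolding lam_inf_def lam_def by blast
  then have "lam_inf G \<noteq> {\<zero>}" using g0(3) by blast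
  then have "dcc_above R (lam_inf G)"
    by (intro dcc_above_nonzero_ideal[OF noeth krull_dim_le_1_maximal[OF noeth dim]] lam_inf_ideal[OF G(1)])
  moreover have lam_mono': "lam_inf A \<subseteq> lam_inf B" if "A \<subseteq> B" for A B
    using that unfolding lam_inf_def lam_def by blast
  ultimately have "\<exists>n. \<forall>m\<ge>n. lam_inf (H m) = lam_inf (H n)"
    unfolding dcc_above_def using lam_inf_ideal[OF H(1)] lam_mono'[OF H(2)] lam_mono'[OF H(3)]
    by (elim allE[of _ "\<lambda>n. lam_inf (H n)"]) blast
  then obtain n1 where n1: "\<And>m. m \<ge> n1 \<Longrightarrow> lam_inf (H m) = lam_inf (H n1)" by blast
  have "\<exists>d g. g \<in> H j \<and> g \<in> U (Suc d) \<and> g d \<noteq> \<zero> \<and> (\<forall>r. r \<in> H j \<longrightarrow> r \<in> U d \<longrightarrow> r = \<zero>\<^bsub>S\<^esub>)" for j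
  proof -
    have "H j \<noteq> {\<zero>\<^bsub>S\<^esub>}" using H(2)[of j] G left_idealD(3)[OF G(1)] by blast
    then show ?thesis using min_order_exists[OF H(1)] by metis
  qed
  then obtain d g where dg: "\<And>j. g j \<in> H j" "\<And>j. g j \<in> U (Suc (d j))" "\<And>j. g j (d j) \<noteq> \<zero>"
    "\<And>j r. \<lbrakk>r \<in> H j; r \<in> U (d j)\<rbrakk> \<Longrightarrow> r = \<zero>\<^bsub>S\<^esub>" by metis
  have bound: "d j \<le> k" if r: "r \<in> H j" "r \<in> U (Suc k)" "r k \<noteq> \<zero>" for j r k
  proof (rule ccontr)
    assume "\<not> d j \<le> k"
    then have "r \<in> U (d j)" using U_mono[OF _ r(2)] by simp
    then have "r = \<zero>\<^bsub>S\<^esub>" using dg(4) r(1) by blast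
    then show False using r(3) cf_zero by blast
  qed
  have "d j \<le> d0" for j using bound[of g0 j d0] g0 H(2) by blast
  \<comment> \<open>From the index of a largest minimal order onwards the minimal orders are
    constant.\<close>
  then obtain j0 where j0: "\<And>j. d j \<le> d j0"
    using ex_has_greatest_nat[of "\<lambda>_. True" 0 d "Suc d0"] by (auto simp: less_Suc_eq_le)
  define n where "n = max n1 j0"
  have "H m = H n" if m: "m \<ge> n" for m
  proof
    show "H m \<subseteq> H n" by (rule anti[OF m])
    have "d j0 \<le> d m" using bound[of "g m" j0 "d m"] dg(1,2,3)[of m] anti[of j0 m] m by (auto simp: n_def)
    moreover have "d n \<le> d m" using bound[of "g m" n "d m"] dg(1,2,3)[of m] anti[OF m] by auto
    moreover have "d j0 \<le> d n" using bound[of "g n" j0 "d n"] dg(1,2,3)[of n] anti[of j0 n] by (auto simp: n_def)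
    ultimately have "d m = d n" using j0[of m] j0[of n] by simp
    then have least: "r = \<zero>\<^bsub>S\<^esub>" if "r \<in> H n" "r \<in> U (d m)" for r using dg(4) that by simp
    show "H n \<subseteq> H m"
      by (rule left_ideal_eq_of_lam_inf[OF noeth simple H(1) H(1) anti[OF m] _ dg(1,2,3) least])
        (use n1[of m] n1[of n] m in \<open>auto simp: n_def\<close>)
  qed
  then show "\<exists>n. \<forall>m\<ge>n. H m = H n" by blast
qed

text \<open>It remains to exclude \<open>G = 0\<close>, where \<open>N\<close> would be a simple
  left ideal of \<open>S\<close>. For \<open>n \<noteq> 0\<close> in \<open>N\<close> simplicity
  would give \<open>n \<in> S\<theta>n\<close>, which is impossible because orders add up under
  multiplication.\<close>

theorem diamond_of_dim_le_1:
  assumes noeth: "left_noetherian R" and simple: "delta_simple R \<delta>" and dim: "krull_dim R \<le> 1"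
  shows "diamond S"
proof (rule diamondI[OF S.ring_axioms])
  fix G N assume LN: "essential_simple_pair S G N"
  then have G: "left_ideal S G" and N: "left_ideal S N" "G \<subset> N"
    and min: "\<And>H. \<lbrakk>left_ideal S H; G \<subseteq> H; H \<subseteq> N\<rbrakk> \<Longrightarrow> H = G \<or> H = N"
    by (auto simp: essential_simple_pair_def)
  have "G \<noteq> {\<zero>\<^bsub>S\<^esub>}"
  proof
    assume L0: "G = {\<zero>\<^bsub>S\<^esub>}"
    then obtain n where n: "n \<in> N" "n \<noteq> \<zero>\<^bsub>S\<^esub>" using N by blast
    have nc: "n \<in> carrier S" by (rule left_idealD(2)[OF N(1) n(1)])
    obtain b where b: "n \<in> U (Suc b)" "n b \<noteq> \<zero>" using top_exists[OF nc n(2)] by blast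
    let ?y = "X \<star> n"
    let ?H = "principal_left S ?y"
    have yc: "?y \<in> carrier S" using nc by simp
    have y: "?y \<in> U (Suc (Suc b))" "?y (Suc b) = n b"
      using X_mult_U[OF b(1)] nc U_zero[OF b(1), of "Suc b"] by (simp_all add: cf_X_mult)
    have HI: "left_ideal S ?H" by (rule S.left_ideal_right_mult[OF S.left_ideal_carrier yc])
    have "?H \<subseteq> N" using left_idealD(5)[OF N(1) _ left_idealD(5)[OF N(1) X_closed n(1)]] by blast
    moreover have "?y \<in> ?H" using yc by (intro image_eqI[of _ _ "\<one>\<^bsub>S\<^esub>"]) auto
    moreover have "?y \<noteq> \<zero>\<^bsub>S\<^esub>" using y(2) b(2) cf_zero by metis
    ultimately have "?H = N" using min[OF HI] L0 left_idealD(3)[OF HI] by blast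
    then obtain s where s: "s \<in> carrier S" "n = s \<star> ?y" using n(1) by blast
    have "s \<noteq> \<zero>\<^bsub>S\<^esub>" using s(2) n(2) yc by auto
    then obtain a where a: "s \<in> U (Suc a)" "s a \<noteq> \<zero>" using top_exists[OF s(1)] by blast
    have "n (a + Suc b) = s a \<otimes> n b" using mult_top(2)[OF a(1) y(1)] s(2) y(2) by simp
    moreover have "n (a + Suc b) = \<zero>" by (rule U_zero[OF b(1)]) simp
    ultimately show False using a(2) b(2) s(1) nc by (simp add: integral_iff)
  qed
  then show "dcc_above S G" by (rule dcc_above_nonzero[OF noeth simple dim G])
qed

end

section \<open>Non-Artinian essential extensions\<close>

context char_zero_derivation
begin

section \<open>Right multiplication by \<open>\<theta>\<close>\<close>

lemma cf_mult_X:
  assumes "p \<in> carrier S"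
  shows "(p \<star> X) n = (if n = 0 then \<zero> else p (n - 1))"
proof -
  have "p \<in> U k \<Longrightarrow> (p \<star> X) n = (if n = 0 then \<zero> else p (n - 1))" for k n
  proof (induction k arbitrary: p n)
    case 0
    have p: "p = \<zero>\<^bsub>S\<^esub>" by (rule U_0[OF 0])
    have "p \<star> X = \<zero>\<^bsub>S\<^esub>" unfolding p by (rule S.l_null) simp
    then have "(p \<star> X) n = \<zero>\<^bsub>S\<^esub> n" by (rule fun_cong)
    moreover have "p (n - 1) = \<zero>\<^bsub>S\<^esub> (n - 1)" using p by (rule fun_cong)
    ultimately show ?case by (simp only: cf_zero if_cancel)
  next
    case (Suc k)
    note pc = U_closed[OF Suc.prems]
    let ?m = "C (p k) \<star> (X [^]\<^bsub>S\<^esub> k)"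
    have "p \<star> X = (?m \<boxplus> (p \<boxminus> ?m)) \<star> X" using sub_eq_add[of p ?m] pc by simp
    also have "\<dots> = C (p k) \<star> (X [^]\<^bsub>S\<^esub> Suc k) \<boxplus> (p \<boxminus> ?m) \<star> X"
      using pc by (simp add: S.l_distr S.m_assoc)
    finally have "(p \<star> X) n = (C (p k) \<star> (X [^]\<^bsub>S\<^esub> Suc k)) n \<oplus> ((p \<boxminus> ?m) \<star> X) n"
      using pc by (simp add: cf_add del: S.nat_pow_Suc)
    also have "(C (p k) \<star> (X [^]\<^bsub>S\<^esub> Suc k)) n = (if n = Suc k then p k else \<zero>)"
      by (rule cf_monom) (use pc in simp)
    finally have sum: "(p \<star> X) n =
        (if n = Suc k then p k else \<zero>) \<oplus> ((p \<boxminus> ?m) \<star> X) n" .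
    have "(p \<boxminus> ?m) j = p j \<ominus> (if j = k then p k else \<zero>)" for j
      using pc cf_monom[of "p k" k j] by (simp add: cf_minus)
    then show ?case
      unfolding sum Suc.IH[OF strip_top[OF Suc.prems]] using pc
      by (cases n) (auto simp: minus_eq r_neg)
  qed
  then show ?thesis using U_exists[OF assms] by blast
qed

lemma mult_X_cancel:
  assumes "p \<in> carrier S" "q \<in> carrier S" "p \<star> X = q \<star> X"
  shows "p = q"
proof (rule S_eqI)
  fix n
  show "p n = q n"
    using cf_mult_X[OF assms(1), of "Suc n"] cf_mult_X[OF assms(2), of "Suc n"] assms(3) by simp
qed

lemma vanish0_eq: "vanish0 = principal_left S X"
proof
  show "(principal_left S X) \<subseteq> vanish0" by (auto simp: vanish0_def cf_mult_X)
  show "vanish0 \<subseteq> principal_left S X"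
  proof
    fix p assume p: "p \<in> vanish0"
    then have pc: "p \<in> carrier S" by (simp add: vanish0_def)
    obtain N where N: "p \<in> U N" using U_exists[OF pc] by blast
    define q where "q = (\<lambda>n. p (Suc n))"
    have q: "q \<in> carrier S"
      unfolding mem_S q_def by (rule upI[of _ N]) (use pc U_zero[OF N] in auto)
    have "p = q \<star> X"
    proof (rule S_eqI)
      fix n
      show "p n = (q \<star> X) n"
        using cf_mult_X[OF q, of n] p by (cases n) (simp_all add: q_def vanish0_def)
    qed
    then show "p \<in> principal_left S X" using q by blast
  qed
qed

lemma X_mult_const:
  assumes "z \<in> carrier S" "X \<star> z = C c"
  shows "c = \<zero>"
proof -
  have "z = \<zero>\<^bsub>S\<^esub>"
  proof (rule ccontr)
    assume "z \<noteq> \<zero>\<^bsub>S\<^esub>"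
    then obtain d where d: "z \<in> U (Suc d)" "z d \<noteq> \<zero>" using top_exists[OF assms(1)] by blast
    have "(X \<star> z) (Suc d) = z d" using assms(1) U_zero[OF d(1), of "Suc d"] by (simp add: cf_X_mult)
    then show False using d(2) assms(2) by (simp add: cf_C)
  qed
  then have "C c = \<zero>\<^bsub>S\<^esub>" using assms(2) by simp
  then show ?thesis by (rule iffD1[OF C_eq_zero_iff])
qed

text \<open>The failure of surjectivity of \<open>\<theta>\<close> on \<open>S/SP\<close>: in
  \<open>1 + \<theta>q = \<theta>p + j\<close> the constant \<open>1 - j\<close> is a left multiple
  by \<open>\<theta>\<close>, hence zero, although \<open>1\<close> is not in
  \<open>P\<close>.\<close>

lemma one_plus_X_notin_W:
  assumes P: "left_ideal R P" "\<one> \<notin> P" and q: "q \<in> carrier S"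
  shows "\<one>\<^bsub>S\<^esub> \<boxplus> X \<star> q \<notin> W P"
proof
  assume "\<one>\<^bsub>S\<^esub> \<boxplus> X \<star> q \<in> W P"
  then have "\<exists>p\<in>W P. \<exists>j\<in>P. \<one>\<^bsub>S\<^esub> \<boxplus> X \<star> q = X \<star> p \<boxplus> C j"
  proof cases
    case W_zero
    have "\<zero>\<^bsub>S\<^esub> = X \<star> \<zero>\<^bsub>S\<^esub> \<boxplus> C \<zero>" by simp
    then show ?thesis using W_zero left_idealD(3)[OF P(1)] W.W_zero by metis
  qed blast
  then obtain p j where pj: "p \<in> W P" "j \<in> P" "\<one>\<^bsub>S\<^esub> \<boxplus> X \<star> q = X \<star> p \<boxplus> C j" by blast
  have car: "p \<in> carrier S" "j \<in> carrier R" using W_closed[OF P(1) pj(1)] left_idealD(2)[OF P(1) pj(2)] .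
  have move: "a = (c \<boxplus> d) \<boxminus> b" if "a \<boxplus> b = c \<boxplus> d" "a \<in> carrier S" "b \<in> carrier S" for a b c d
    unfolding that(1)[symmetric] using that(2,3) by (simp add: S.minus_eq S.a_assoc S.r_neg)
  have "\<one>\<^bsub>S\<^esub> = (X \<star> p \<boxplus> C j) \<boxminus> X \<star> q" using move[OF pj(3)] q by simp
  then have "C (\<one> \<ominus> j) = (X \<star> p \<boxplus> C j) \<boxminus> X \<star> q \<boxminus> C j" using car by (simp add: C_minus C_one)
  also have "u \<boxplus> c \<boxminus> v \<boxminus> c = u \<boxminus> v" if "u \<in> carrier S" "v \<in> carrier S" "c \<in> carrier S" for u v c
    using that by (simp add: S.minus_eq S.a_assoc S.a_comm[of "\<ominus>\<^bsub>S\<^esub> v" "\<ominus>\<^bsub>S\<^esub> c"] S.r_neg1 S.r_neg2)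
  then have "(X \<star> p \<boxplus> C j) \<boxminus> X \<star> q \<boxminus> C j = X \<star> (p \<boxminus> q)"
    using car q by (simp add: S.minus_eq S.r_distr S.r_minus)
  finally have "\<one> \<ominus> j = \<zero>" using X_mult_const[of "p \<boxminus> q"] car q by simp
  then have "\<one> = j" using car(2) by simp
  then show False using pj(2) P(2) by simp
qed

section \<open>Multiplication by elements outside \<open>P\<close> on \<open>S/SP\<close>\<close>

context
  fixes P r
  assumes P: "left_maximal R P" and r: "r \<in> carrier R" "r \<notin> P"
begin

lemma P_ideal: "left_ideal R P" using P by (simp add: left_maximal_def)

lemma unit_mod_P:
  obtains u where "u \<in> carrier R" "\<one> \<ominus> r \<otimes> u \<in> P"
proof -
  let ?rR = "principal_left R r"
  let ?sum = "ideal_plus R P ?rR"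
  have rR: "left_ideal R ?rR" by (rule left_ideal_right_mult[OF left_ideal_carrier r(1)])
  have "r \<in> ?rR" using r(1) by (intro image_eqI[of _ _ \<one>]) auto
  then have "r \<in> ?sum" by (rule subsetD[OF left_ideal_sum_upper(2)[OF P_ideal rR]])
  then have "?sum \<noteq> P" using r(2) by blast
  then have "?sum = carrier R"
    using P left_ideal_sum[OF P_ideal rR] left_ideal_sum_upper(1)[OF P_ideal rR]
    unfolding left_maximal_def by blast
  then have "\<one> \<in> ?sum" by simp
  then obtain h u where hu: "h \<in> P" "u \<in> carrier R" "\<one> = h \<oplus> u \<otimes> r" by blast
  have "h \<in> carrier R" by (rule left_idealD(2)[OF P_ideal hu(1)])
  then have "\<one> \<ominus> r \<otimes> u = h"
    unfolding hu(3) using hu(2) r(1) by (simp add: minus_eq a_assoc m_comm[of u] r_neg)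
  then show thesis using that hu by metis
qed

text \<open>Surjectivity of \<open>r\<close>: with \<open>u\<close> inverse to \<open>r\<close>
  modulo \<open>P\<close>, the leading coefficient of \<open>p\<close> is \<open>r u p_n\<close>
  plus some \<open>e \<in> P\<close>. The second part is removed by
  \<open>\<theta>^n e \<in> SP\<close> and the first by a multiple of \<open>C r\<close>; the order
  drops.\<close>

lemma div_mod_W:
  assumes "p \<in> carrier S"
  shows "\<exists>q\<in>carrier S. p \<boxminus> C r \<star> q \<in> W P"
proof -
  obtain u where u: "u \<in> carrier R" "\<one> \<ominus> r \<otimes> u \<in> P" by (rule unit_mod_P)
  note WI = W_left_ideal[OF P_ideal]
  have "p \<in> U n \<Longrightarrow> \<exists>q\<in>carrier S. p \<boxminus> C r \<star> q \<in> W P" for n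
  proof (induction n arbitrary: p)
    case 0
    have p: "p = \<zero>\<^bsub>S\<^esub>" by (rule U_0[OF 0])
    have "p \<boxminus> C r \<star> \<zero>\<^bsub>S\<^esub> = \<zero>\<^bsub>S\<^esub>" unfolding p using r(1) by (simp add: S.minus_eq)
    then show ?case using W_zero by (intro bexI[of _ "\<zero>\<^bsub>S\<^esub>"]) auto
  next
    case (Suc n)
    note pc = U_closed[OF Suc.prems]
    define e where "e = (\<one> \<ominus> r \<otimes> u) \<otimes> p n"
    have e: "e \<in> carrier R" "e \<in> P"
      using pc u r left_idealD(5)[OF P_ideal _ u(2), of "p n"] by (simp_all add: e_def m_comm)
    define w where "w = (X [^]\<^bsub>S\<^esub> n) \<star> C e"
    have w: "w \<in> W P" unfolding w_def by (rule left_idealD(5)[OF WI pow_X_closed W_C[OF P_ideal e(2)]])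
    have wU: "w \<in> U (Suc n)" "w n = e" unfolding w_def using pow_X_C_top[OF e(1)] by auto
    have wc: "w \<in> carrier S" by (rule U_closed[OF wU(1)])
    define m where "m = C (u \<otimes> p n) \<star> (X [^]\<^bsub>S\<^esub> n)"
    have mc: "m \<in> carrier S" using u pc by (simp add: m_def)
    have mn: "m n = u \<otimes> p n" using cf_monom[of "u \<otimes> p n" n n] u pc by (simp add: m_def)
    have mU: "m \<in> U (Suc n)" by (rule UI[OF mc]) (use u pc in \<open>auto simp: m_def cf_monom\<close>)
    define p' where "p' = p \<boxminus> w \<boxminus> C r \<star> m"
    have "p' \<in> U n"
    proof (rule U_SucD)
      show "p' \<in> U (Suc n)"
        unfolding p'_def by (rule U_minus[OF U_minus[OF Suc.prems wU(1)] U_C_mult[OF r(1) mU]])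
      have "p n \<ominus> e \<ominus> r \<otimes> (u \<otimes> p n) = \<zero>"
        unfolding e_def using cf_closed[OF pc, of n] u(1) r(1) by algebra
      then show "p' n = \<zero>"
        unfolding p'_def using pc wc mc r wU(2) mn by (simp add: cf_minus cf_C_mult)
    qed
    then obtain q where q: "q \<in> carrier S" "p' \<boxminus> C r \<star> q \<in> W P" using Suc.IH by blast
    have rc: "C r \<in> carrier S" using r by simp
    have "p \<boxminus> C r \<star> (m \<boxplus> q) = w \<boxplus> (p' \<boxminus> C r \<star> q)"
      unfolding p'_def using pc wc mc q(1) rc
      by (simp add: S.minus_eq S.r_distr S.minus_add S.a_ac S.r_neg S.r_neg1 S.r_neg2)
    then show ?case using left_idealD(4)[OF WI w q(2)] mc q(1) by (intro bexI[of _ "m \<boxplus> q"]) auto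
  qed
  then show ?thesis using U_exists[OF assms] by blast
qed

text \<open>Injectivity of \<open>r\<close>: the leading coefficient \<open>r y_n\<close> is in
  \<open>P\<close>, so \<open>y_n\<close> is, and subtracting \<open>\<theta>^n y_n \<in> SP\<close>
  lowers the order.\<close>

lemma cancel_mod_W:
  assumes "y \<in> carrier S" "C r \<star> y \<in> W P"
  shows "y \<in> W P"
proof -
  note WI = W_left_ideal[OF P_ideal]
  have rc: "C r \<in> carrier S" using r by simp
  have "y \<in> U n \<Longrightarrow> C r \<star> y \<in> W P \<Longrightarrow> y \<in> W P" for n
  proof (induction n arbitrary: y)
    case 0
    then show ?case using U_0 W_zero by metis
  next
    case (Suc n)
    note yc = U_closed[OF Suc.prems(1)]
    have "r \<otimes> y n \<in> P"
      using W_top[OF P_ideal Suc.prems(2) U_C_mult[OF r(1) Suc.prems(1)]] yc r(1) by (simp add: cf_C_mult)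
    then have yn: "y n \<in> P" using left_maximal_prime[OF P r(1) cf_closed[OF yc]] r(2) by blast
    define w where "w = (X [^]\<^bsub>S\<^esub> n) \<star> C (y n)"
    have w: "w \<in> W P" unfolding w_def by (rule left_idealD(5)[OF WI pow_X_closed W_C[OF P_ideal yn]])
    have wU: "w \<in> U (Suc n)" "w n = y n" unfolding w_def using pow_X_C_top[of "y n" n] yc by auto
    have wc: "w \<in> carrier S" by (rule U_closed[OF wU(1)])
    have "y \<boxminus> w \<in> U n"
      by (rule U_SucD[OF U_minus[OF Suc.prems(1) wU(1)]]) (use yc wc wU(2) in \<open>simp add: cf_minus minus_eq r_neg\<close>)
    moreover have "C r \<star> (y \<boxminus> w) = C r \<star> y \<boxminus> C r \<star> w"
      using yc wc rc by (simp add: S.minus_eq S.r_distr S.r_minus)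
    then have "C r \<star> (y \<boxminus> w) \<in> W P"
      using S.left_ideal_minus[OF WI Suc.prems(2) left_idealD(5)[OF WI rc w]] by simp
    ultimately have "y \<boxminus> w \<in> W P" by (rule Suc.IH)
    then show ?case by (rule S.left_ideal_diff_cancel[OF WI yc w])
  qed
  then show ?thesis using U_exists[OF assms(1)] assms(2) by blast
qed

end

text \<open>
  \<open>S/SP\<theta>\<close> is an extension of \<open>S/S\<theta> \<cong> R\<close> by the simple module \<open>S\<theta>/SP\<theta> \<cong> S/SP\<close>. It is essential
  because \<open>\<theta>\<close> does not act surjectively on \<open>S/SP\<close>, while every \<open>r \<in> R - P\<close> acts bijectively.
\<close>

lemma essential_W_X:
  assumes P: "maximalideal P R" and noP: "\<And>I. \<lbrakk>delta_ideal R \<delta> I; I \<subseteq> P\<rbrakk> \<Longrightarrow> I = {\<zero>}"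
    and P0: "P \<noteq> {\<zero>}"
  shows "essential_simple_pair S ((\<lambda>w. w \<star> X) ` W P) vanish0"
  unfolding essential_simple_pair_def
proof (intro conjI allI impI left_ideal_vanish0)
  have PM: "left_maximal R P" using P left_maximal_iff_maximalideal by blast
  have PI: "left_ideal R P" using PM by (simp add: left_maximal_def)
  have P1: "\<one> \<notin> P" by (rule left_maximal_one[OF PM])
  have "\<not> \<delta> ` P \<subseteq> P" using noP[OF delta_idealI[OF PI]] P0 by blast
  then have Wmax: "left_maximal S (W P)" by (rule left_maximal_W[OF P])
  note WI = W_left_ideal[OF PI]
  let ?G = "(\<lambda>w. w \<star> X) ` W P"
  have in_G: "w \<in> W P" if w: "w \<in> carrier S" "w \<star> X \<in> ?G" for w
  proof -
    obtain w' where w': "w' \<in> W P" "w \<star> X = w' \<star> X" using w(2) by blast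
    show ?thesis using mult_X_cancel[OF w(1) W_closed[OF PI w'(1)] w'(2)] w'(1) by simp
  qed
  show G: "left_ideal S ?G" by (rule S.left_ideal_right_mult[OF WI X_closed])
  show "?G \<subset> vanish0"
  proof
    show "?G \<subseteq> vanish0" unfolding vanish0_eq using W_closed[OF PI] by blast
    show "?G \<noteq> vanish0"
    proof
      assume "?G = vanish0"
      then have "\<one>\<^bsub>S\<^esub> \<star> X \<in> ?G" using X_vanish0 by simp
      then have "\<one>\<^bsub>S\<^esub> \<in> W P" using in_G[of "\<one>\<^bsub>S\<^esub>"] by simp
      then show False using S.left_maximal_one[OF Wmax] by simp
    qed
  qed
  fix H
  {
    assume H: "left_ideal S H \<and> ?G \<subseteq> H \<and> H \<subseteq> vanish0"
    let ?H = "{s \<in> carrier S. s \<star> X \<in> H}"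
    have "left_ideal S ?H" using S.left_ideal_colon[OF _ X_closed] H by blast
    moreover have "W P \<subseteq> ?H" using H W_closed[OF PI] by blast
    ultimately have H_cases: "?H = W P \<or> ?H = carrier S" using Wmax unfolding left_maximal_def by blast
    have H_eq: "H = (\<lambda>s. s \<star> X) ` ?H"
    proof
      show "H \<subseteq> (\<lambda>s. s \<star> X) ` ?H"
      proof
        fix h assume h: "h \<in> H"
        then have "h \<in> principal_left S X" using H vanish0_eq by auto
        then show "h \<in> (\<lambda>s. s \<star> X) ` ?H" using h by blast
      qed
    qed blast
    note H_image = trans[OF H_eq arg_cong[of _ _ "\<lambda>A. (\<lambda>s. s \<star> X) ` A"]]
    show "H = ?G \<or> H = vanish0"
    proof (rule disjE[OF H_cases])
      assume "?H = W P"
      then show ?thesis by (rule disjI1[OF H_image])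
    next
      assume "?H = carrier S"
      then show ?thesis by (rule disjI2[OF trans[OF H_image vanish0_eq[symmetric]]])
    qed
  next
    assume H: "left_ideal S H \<and> ?G \<subset> H"
    show "H \<inter> vanish0 \<noteq> ?G"
    proof
      assume int: "H \<inter> vanish0 = ?G"
      have HI: "left_ideal S H" using H by blast
      note D = left_idealD[OF HI]
      \<comment> \<open>The image of \<open>H\<close> in \<open>S/S\<theta> = R\<close>. It is a
        non-zero \<open>\<delta>\<close>-ideal, so the choice of \<open>P\<close> yields an element
        outside \<open>P\<close>.\<close>
      let ?J = "(\<lambda>p. p 0) ` H"
      have JI: "left_ideal R ?J"
      proof (rule left_idealI)
        show "?J \<subseteq> carrier R" using D(2) by auto
        show "\<zero> \<in> ?J" using imageI[OF D(3), of "\<lambda>p. p 0"] by (simp only: cf_zero)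
        fix a assume "a \<in> ?J"
        then obtain p where p: "p \<in> H" "a = p 0" by blast
        show "b \<otimes> a \<in> ?J" if b: "b \<in> carrier R" for b
          using p D(2,5) b by (intro image_eqI[of _ _ "C b \<star> p"]) (auto simp: cf_C_mult)
        fix b assume "b \<in> ?J"
        then obtain q where q: "q \<in> H" "b = q 0" by blast
        show "a \<oplus> b \<in> ?J"
          using p q D(2,4) by (intro image_eqI[of _ _ "p \<boxplus> q"]) (auto simp: cf_add)
      qed
      have "delta_ideal R \<delta> ?J"
      proof (rule delta_idealI[OF JI])
        fix a assume "a \<in> ?J"
        then obtain p where p: "p \<in> H" "a = p 0" by blast
        then show "\<delta> a \<in> ?J"
          using D(2,5) by (intro image_eqI[of _ _ "X \<star> p"]) (auto simp: cf_X_mult)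
      qed
      moreover have "?J \<noteq> {\<zero>}"
      proof
        assume "?J = {\<zero>}"
        then have "H \<subseteq> vanish0" using D(2) unfolding vanish0_def by blast
        then show False using int H by blast
      qed
      ultimately have "\<not> ?J \<subseteq> P" using noP by blast
      then obtain s where s: "s \<in> H" "s 0 \<notin> P" by blast
      have sc: "s \<in> carrier S" by (rule D(2)[OF s(1)])
      define r where "r = s 0"
      have r: "r \<in> carrier R" "r \<notin> P" using sc s(2) by (auto simp: r_def)
      have "s \<boxminus> C r \<in> vanish0" using sc r by (simp add: vanish0_def cf_minus cf_C r_def minus_eq r_neg)
      then obtain q where q: "q \<in> carrier S" "s \<boxminus> C r = q \<star> X" unfolding vanish0_eq by blast
      have s_eq: "s = C r \<boxplus> q \<star> X" using sub_eq_add[of s "C r"] sc r(1) q(2) by simp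
      \<comment> \<open>\<open>t\<close> is chosen with \<open>t r \<in> S\<theta>\<close>. Hence
        \<open>t s\<close> lies in both \<open>H\<close> and \<open>S\<theta>\<close>, which by
        assumption places its quotient \<open>y\<close> by \<open>\<theta>\<close> in
        \<open>SP\<close>.\<close>
      define t where "t = C r \<star> X \<boxminus> C (\<delta> r)"
      have tc: "t \<in> carrier S" using r by (simp add: t_def)
      have rrc: "C (r \<otimes> r) \<in> carrier S" using r by simp
      have tr: "t \<star> C r = C (r \<otimes> r) \<star> X"
      proof -
        have "t \<star> C r = C r \<star> (X \<star> C r) \<boxminus> C (\<delta> r) \<star> C r"
          unfolding t_def using r by (simp add: S.minus_eq S.l_distr S.l_minus S.m_assoc)
        also have "\<dots> = C r \<star> (C r \<star> X) \<boxplus> C r \<star> C (\<delta> r) \<boxminus> C (\<delta> r) \<star> C r"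
          unfolding X_C[OF r(1)] using r by (simp add: S.r_distr)
        also have "C (\<delta> r) \<star> C r = C r \<star> C (\<delta> r)" using r by (simp add: C_mult[symmetric] m_comm)
        also have "C r \<star> (C r \<star> X) \<boxplus> C r \<star> C (\<delta> r) \<boxminus> C r \<star> C (\<delta> r) = C r \<star> (C r \<star> X)"
          using r by (simp add: S.minus_eq S.a_assoc S.r_neg)
        also have "\<dots> = C (r \<otimes> r) \<star> X" using r by (simp add: C_mult S.m_assoc)
        finally show ?thesis .
      qed
      define y where "y = C (r \<otimes> r) \<boxplus> t \<star> q"
      have yc: "y \<in> carrier S" using rrc tc q by (simp add: y_def)
      have "t \<star> s = t \<star> C r \<boxplus> t \<star> (q \<star> X)"
        unfolding s_eq using tc r q(1) by (simp add: S.r_distr)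
      also have "\<dots> = y \<star> X" unfolding tr y_def using rrc tc q(1) by (simp add: S.l_distr S.m_assoc)
      finally have ts: "t \<star> s = y \<star> X" .
      have "y \<star> X \<in> H" using D(5)[OF tc s(1)] ts by simp
      moreover have "y \<star> X \<in> vanish0" unfolding vanish0_eq using yc by blast
      ultimately have yW: "y \<in> W P" using in_G[OF yc] int by blast
      \<comment> \<open>Replacing \<open>q\<close> by \<open>r q'\<close> modulo \<open>SP\<close>
        turns \<open>r^2 + t q\<close> into \<open>r^2 (1 + \<theta>q')\<close>; cancelling
        \<open>r^2\<close> gives the contradiction.\<close>
      obtain q' where q': "q' \<in> carrier S" "q \<boxminus> C r \<star> q' \<in> W P" using div_mod_W[OF PM r q(1)] by blast
      have Crc: "C r \<in> carrier S" using r by simp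
      have "C (r \<otimes> r) \<star> (\<one>\<^bsub>S\<^esub> \<boxplus> X \<star> q') = C (r \<otimes> r) \<boxplus> (t \<star> C r) \<star> q'"
        unfolding tr using rrc q'(1) by (simp add: S.r_distr S.m_assoc)
      also have "\<dots> = y \<boxminus> t \<star> (q \<boxminus> C r \<star> q')"
        unfolding y_def using rrc tc q(1) q'(1) Crc
        by (simp add: S.minus_eq S.r_distr S.r_minus S.minus_add S.m_assoc S.a_assoc S.r_neg1 S.r_neg2)
      also have "\<dots> \<in> W P" by (rule S.left_ideal_minus[OF WI yW left_idealD(5)[OF WI tc q'(2)]])
      finally have rr: "C (r \<otimes> r) \<star> (\<one>\<^bsub>S\<^esub> \<boxplus> X \<star> q') \<in> W P" .
      have "r \<otimes> r \<notin> P" using left_maximal_prime[OF PM r(1) r(1)] r(2) by blast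
      then have "\<one>\<^bsub>S\<^esub> \<boxplus> X \<star> q' \<in> W P"
        using cancel_mod_W[OF PM _ _ _ rr] r(1) q'(1) by simp
      then show False using one_plus_X_notin_W[OF PI P1 q'(1)] by blast
    qed
  }
qed

text \<open>For \<open>P = 0\<close> the ring \<open>R\<close> is a field and there is nothing to
  show. Otherwise the powers of a proper non-zero \<open>\<delta>\<close>-ideal are non-zero,
  because \<open>R\<close> is a domain, and they decrease strictly by Nakayama's lemma.\<close>

theorem diamond_imp_delta_simple:
  assumes noeth: "left_noetherian R" and dia: "diamond S" and prim: "delta_primitive R \<delta>"
  shows "delta_simple R \<delta>"
proof -
  obtain P where P: "maximalideal P R" "\<And>I. \<lbrakk>delta_ideal R \<delta> I; I \<subseteq> P\<rbrakk> \<Longrightarrow> I = {\<zero>}"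
    using prim by (auto simp: delta_primitive_def)
  have PM: "left_maximal R P" using P(1) left_maximal_iff_maximalideal by blast
  show ?thesis
  proof (cases "P = {\<zero>}")
    case True
    have "I = {\<zero>} \<or> I = carrier R" if "delta_ideal R \<delta> I" for I
      using PM delta_idealD(1)[OF that] left_idealD(3)[OF delta_idealD(1)[OF that]] True
      unfolding left_maximal_def by blast
    then show ?thesis by (simp add: delta_simple_def)
  next
    case False
    have "essential_simple_pair S ((\<lambda>w. w \<star> X) ` W P) vanish0"
      by (rule essential_W_X[OF P(1) _ False]) (rule P(2))
    note dcc = diamond_imp_dcc_above[OF dia this]
    have "I = carrier R" if I: "delta_ideal R \<delta> I" "I \<noteq> {\<zero>}" for I
    proof (rule ccontr)
      assume "I \<noteq> carrier R"
      note II = delta_idealD(1)[OF I(1)]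
      have one: "\<one> \<notin> I" using left_ideal_one[OF II] \<open>I \<noteq> carrier R\<close> by blast
      \<comment> \<open>\<open>J n\<close> is the power of \<open>I\<close> with exponent
        \<open>n + 1\<close>.\<close>
      define J where "J n = (ideal_prod R I ^^ n) I" for n
      have prod_sub: "ideal_prod R I K \<subseteq> K" if K: "left_ideal R K" for K
      proof
        fix x assume "x \<in> ideal_prod R I K"
        then show "x \<in> K"
          by induction (use left_idealD[OF K] left_idealD(2)[OF II] in auto)
      qed
      have step: "delta_ideal R \<delta> (ideal_prod R I K) \<and> ideal_prod R I K \<noteq> {\<zero>}"
        if K: "delta_ideal R \<delta> K" "K \<noteq> {\<zero>}" for K
      proof
        note KI = delta_idealD(1)[OF K(1)]
        have prodI: "left_ideal R (ideal_prod R I K)"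
          using ideal_prod_is_ideal II KI left_ideal_iff_ideal by blast
        show "delta_ideal R \<delta> (ideal_prod R I K)"
        proof (rule delta_idealI[OF prodI])
          fix x assume "x \<in> ideal_prod R I K"
          then show "\<delta> x \<in> ideal_prod R I K"
          proof induction
            case (prod i j)
            have "\<delta> (i \<otimes> j) = \<delta> i \<otimes> j \<oplus> i \<otimes> \<delta> j"
              using left_idealD(2)[OF II prod(1)] left_idealD(2)[OF KI prod(2)] by (rule d_mult)
            then show ?case
              using prod delta_idealD(2)[OF I(1)] delta_idealD(2)[OF K(1)]
              by (auto intro!: ideal_prod.intros)
          next
            case (sum a b)
            have "a \<in> carrier R" "b \<in> carrier R" using left_idealD(2)[OF prodI] sum by blast+
            then show ?case using sum by (simp add: d_add ideal_prod.sum)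
          qed
        qed
        obtain i k where ik: "i \<in> I" "i \<noteq> \<zero>" "k \<in> K" "k \<noteq> \<zero>"
          using I(2) K(2) left_idealD(3)[OF II] left_idealD(3)[OF KI] by blast
        then have "i \<otimes> k \<noteq> \<zero>"
          using left_idealD(2)[OF II ik(1)] left_idealD(2)[OF KI ik(3)] by (simp add: integral_iff)
        then show "ideal_prod R I K \<noteq> {\<zero>}" using ideal_prod.prod[OF ik(1,3)] by blast
      qed
      have J: "delta_ideal R \<delta> (J n) \<and> J n \<noteq> {\<zero>}" for n
        unfolding J_def by (induction n) (use I step in auto)
      have JI: "left_ideal R (J n)" for n using delta_idealD(1) J by blast
      have J_Suc: "J (Suc n) = ideal_prod R I (J n)" for n by (simp add: J_def)
      \<comment> \<open>The preimage of \<open>J n\<close> under the constant term map; it is a left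
        ideal because \<open>\<theta>\<close> acts on constant terms as
        \<open>\<delta>\<close>.\<close>
      define H where "H n = {p \<in> carrier S. p 0 \<in> J n}" for n
      have HI: "left_ideal S (H n)" for n
      proof (rule left_ideal_SI)
        note D = left_idealD[OF JI[of n]]
        show "\<zero>\<^bsub>S\<^esub> \<in> H n" unfolding H_def using D(3) by (simp only: mem_Collect_eq cf_zero S.zero_closed simp_thms)
        show "X \<star> p \<in> H n" if "p \<in> H n" for p
          using that delta_idealD(2)[OF conjunct1[OF J[of n]]] by (auto simp: H_def cf_X_mult)
      qed (use left_idealD[OF JI[of n]] in \<open>auto simp: H_def cf_add cf_C_mult\<close>)
      have sub: "(\<lambda>w. w \<star> X) ` W P \<subseteq> H n" for n
      proof -
        have "left_ideal R P" using PM by (simp add: left_maximal_def)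
        then show ?thesis
          using W_closed left_idealD(3)[OF JI[of n]] by (auto simp: H_def cf_mult_X)
      qed
      have desc: "H (Suc n) \<subseteq> H n" for n
        using prod_sub[OF JI[of n]] by (auto simp: H_def J_Suc)
      have "\<exists>n. \<forall>m\<ge>n. H m = H n"
        by (rule dcc[unfolded dcc_above_def, rule_format]) (intro conjI allI HI sub desc)
      then obtain n where n: "H (Suc n) = H n" by (meson le_SucI order_refl)
      have "J n \<subseteq> ideal_prod R I (J n)"
      proof
        fix a assume a: "a \<in> J n"
        have ac: "a \<in> carrier R" by (rule left_idealD(2)[OF JI a])
        then have "C a \<in> H n" using a by (simp add: H_def cf_C)
        then have "C a \<in> H (Suc n)" using n by simp
        then show "a \<in> ideal_prod R I (J n)" by (simp add: H_def cf_C J_Suc)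
      qed
      then show False using nakayama_domain[OF noeth II one JI] J by blast
    qed
    then show ?thesis unfolding delta_simple_def by blast
  qed
qed

section \<open>Saturation and the module generated by a fraction\<close>

text \<open>The contraction of the extension of \<open>H\<close> to the Ore localisation of \<open>S\<close> at \<open>R - {0}\<close>.\<close>

definition sat :: "(nat \<Rightarrow> 'a) set \<Rightarrow> (nat \<Rightarrow> 'a) set" where
  "sat H = {p \<in> carrier S. \<exists>c\<in>carrier R. c \<noteq> \<zero> \<and> C c \<star> p \<in> H}"

text \<open>For closure under \<open>\<theta>\<close> the multiplier \<open>c\<close> is replaced by
  its square: \<open>c^2 \<theta>p = \<theta>c^2 p - 2 c \<delta>(c) p\<close>, and both terms on
  the right are left multiples of \<open>c p\<close>.\<close>

lemma left_ideal_sat: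
  assumes H: "left_ideal S H"
  shows "left_ideal S (sat H)"
proof (rule left_ideal_SI)
  note D = left_idealD[OF H]
  show "sat H \<subseteq> carrier S" by (auto simp: sat_def)
  show "\<zero>\<^bsub>S\<^esub> \<in> sat H" unfolding sat_def using D(3) by (auto intro!: bexI[of _ \<one>])
  fix p assume "p \<in> sat H"
  then obtain c where p: "p \<in> carrier S" and c: "c \<in> carrier R" "c \<noteq> \<zero>" "C c \<star> p \<in> H"
    by (auto simp: sat_def)
  show "C a \<star> p \<in> sat H" if a: "a \<in> carrier R" for a
  proof -
    have "C c \<star> (C a \<star> p) = C a \<star> (C c \<star> p)"
      using a c p by (simp add: S.m_assoc[symmetric] C_mult[symmetric] m_comm)
    also have "\<dots> \<in> H" using D(5)[OF _ c(3)] a by simp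
    finally show ?thesis using a c p by (auto simp: sat_def)
  qed
  show "X \<star> p \<in> sat H"
  proof -
    have cc: "C (c \<otimes> c) \<star> p = C c \<star> (C c \<star> p)" using c p by (simp add: C_mult S.m_assoc)
    have "\<delta> (c \<otimes> c) = (\<delta> c \<oplus> \<delta> c) \<otimes> c" using c by (simp add: d_mult l_distr m_comm[of c "\<delta> c"])
    then have dcc: "C (\<delta> (c \<otimes> c)) \<star> p = C (\<delta> c \<oplus> \<delta> c) \<star> (C c \<star> p)"
      using c p by (simp add: C_mult S.m_assoc)
    have "C (c \<otimes> c) \<star> (X \<star> p) = X \<star> (C (c \<otimes> c) \<star> p) \<boxminus> C (\<delta> (c \<otimes> c)) \<star> p"
      using c p C_X[of "c \<otimes> c"] by (simp add: S.m_assoc[symmetric] S.minus_eq S.l_distr S.l_minus)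
    also have "\<dots> = X \<star> (C c \<star> (C c \<star> p)) \<boxminus> C (\<delta> c \<oplus> \<delta> c) \<star> (C c \<star> p)"
      unfolding cc dcc ..
    also have "\<dots> \<in> H"
      by (rule S.left_ideal_minus[OF H D(5)[OF X_closed D(5)[OF _ c(3)]] D(5)[OF _ c(3)]]) (use c in simp_all)
    finally show ?thesis using c p unfolding sat_def
      by (auto intro!: bexI[of _ "c \<otimes> c"] simp: integral_iff)
  qed
  fix q assume "q \<in> sat H"
  then obtain e where q: "q \<in> carrier S" and e: "e \<in> carrier R" "e \<noteq> \<zero>" "C e \<star> q \<in> H"
    by (auto simp: sat_def)
  show "p \<boxplus> q \<in> sat H"
  proof -
    have ce: "C (c \<otimes> e) = C e \<star> C c" "C (c \<otimes> e) = C c \<star> C e"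
      using c e by (simp_all add: C_mult[symmetric] m_comm)
    have "C (c \<otimes> e) \<star> (p \<boxplus> q) = C (c \<otimes> e) \<star> p \<boxplus> C (c \<otimes> e) \<star> q"
      using c e p q by (simp add: S.r_distr)
    also have "C (c \<otimes> e) \<star> p = C e \<star> (C c \<star> p)" unfolding ce(1) using c e p by (simp add: S.m_assoc)
    also have "C (c \<otimes> e) \<star> q = C c \<star> (C e \<star> q)" unfolding ce(2) using c e q by (simp add: S.m_assoc)
    also have "C e \<star> (C c \<star> p) \<boxplus> C c \<star> (C e \<star> q) \<in> H"
      using c e by (intro D(4) D(5)[OF _ c(3)] D(5)[OF _ e(3)]) auto
    finally show ?thesis using c e p q unfolding sat_def
      by (auto intro!: bexI[of _ "c \<otimes> e"] simp: integral_iff)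
  qed
qed

lemma sat_mult: "\<lbrakk>c \<in> carrier R; c \<noteq> \<zero>; p \<in> carrier S; C c \<star> p \<in> sat H\<rbrakk> \<Longrightarrow> p \<in> sat H"
proof -
  assume c: "c \<in> carrier R" "c \<noteq> \<zero>" and p: "p \<in> carrier S" "C c \<star> p \<in> sat H"
  obtain e where e: "e \<in> carrier R" "e \<noteq> \<zero>" "C e \<star> (C c \<star> p) \<in> H" using p(2) by (auto simp: sat_def)
  have "C (e \<otimes> c) \<star> p \<in> H" using e(3) c e(1) p(1) by (simp add: C_mult S.m_assoc)
  then show "p \<in> sat H" using c e p(1) unfolding sat_def
    by (auto intro!: bexI[of _ "e \<otimes> c"] simp: integral_iff)
qed

lemma sat_carrier:
  assumes H: "left_ideal S H" and x: "x \<in> carrier R" "x \<noteq> \<zero>" "C x \<in> H"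
  shows "sat H = carrier S"
proof (rule S.left_ideal_one[OF left_ideal_sat[OF H]])
  show "\<one>\<^bsub>S\<^esub> \<in> sat H" using x by (auto simp: sat_def)
qed

text \<open>Take \<open>(xR : a)\<close> maximal among those colon ideals that lie inside
  \<open>Q1\<close>. If \<open>b c\<close> is in it and neither factor is, then
  \<open>(xR : b a)\<close> is strictly larger and so leaves \<open>Q1\<close>: some
  \<open>e\<close> outside \<open>Q1\<close> has \<open>e b \<in> (xR : a)\<close>. The same step
  for \<open>e\<close> gives \<open>f\<close> outside \<open>Q1\<close> with
  \<open>f e \<in> (xR : a) \<subseteq> Q1\<close>, against the primality of
  \<open>Q1\<close>.\<close>

lemma associated_prime_below:
  assumes noeth: "left_noetherian R" and Q1: "primeideal Q1 R" and x: "x \<in> Q1"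
  obtains a Q where "a \<in> carrier R" "primeideal Q R" "Q \<subseteq> Q1"
    "Q = {b \<in> carrier R. \<exists>s\<in>carrier R. b \<otimes> a = s \<otimes> x}"
proof -
  define col where "col a = {b \<in> carrier R. \<exists>s\<in>carrier R. b \<otimes> a = s \<otimes> x}" for a
  have Q1I: "left_ideal R Q1" using primeideal.axioms(1)[OF Q1] left_ideal_iff_ideal by blast
  have xc: "x \<in> carrier R" by (rule left_idealD(2)[OF Q1I x])
  have xR: "left_ideal R (principal_left R x)"
    by (rule left_ideal_right_mult[OF left_ideal_carrier xc])
  have colI: "left_ideal R (col a)" if "a \<in> carrier R" for a
  proof -
    have "col a = {b \<in> carrier R. b \<otimes> a \<in> principal_left R x}" by (auto simp: col_def)
    then show ?thesis using left_ideal_colon[OF xR that] by simp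
  qed
  let ?F = "{col a | a. a \<in> carrier R \<and> col a \<subseteq> Q1}"
  have "col \<one> \<subseteq> Q1" using left_idealD(5)[OF Q1I _ x] by (auto simp: col_def)
  then have ne: "?F \<noteq> {}" by blast
  have "\<exists>Q. Q \<in> ?F \<and> (\<forall>K. K \<in> ?F \<longrightarrow> Q \<subseteq> K \<longrightarrow> K = Q)"
    by (rule left_noetherian_maximal[OF noeth ne]) (use colI in blast)+
  then obtain a where a: "a \<in> carrier R" "col a \<subseteq> Q1"
    and max: "\<And>K. \<lbrakk>K \<in> ?F; col a \<subseteq> K\<rbrakk> \<Longrightarrow> K = col a" by blast
  have swap: "c \<in> col (b \<otimes> a) \<longleftrightarrow> c \<otimes> b \<in> col a" if "b \<in> carrier R" "c \<in> carrier R" for b c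
    using that a(1) m_assoc[of c b a] by (simp add: col_def)
  have up: "col a \<subseteq> col (b \<otimes> a)" if b: "b \<in> carrier R" for b
  proof
    fix c assume "c \<in> col a"
    then obtain s where s: "c \<in> carrier R" "s \<in> carrier R" "c \<otimes> a = s \<otimes> x" by (auto simp: col_def)
    have "c \<otimes> (b \<otimes> a) = b \<otimes> (c \<otimes> a)" using s(1) a(1) b by (simp add: m_lcomm)
    also have "\<dots> = (b \<otimes> s) \<otimes> x" unfolding s(3) using s(2) b xc by (simp add: m_assoc)
    finally show "c \<in> col (b \<otimes> a)" using s(1,2) b unfolding col_def by blast
  qed
  have esc: "\<exists>e\<in>carrier R. e \<notin> Q1 \<and> e \<otimes> b \<in> col a"
    if b: "b \<in> carrier R" and c: "c \<in> col (b \<otimes> a)" "c \<notin> col a" for b c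
  proof -
    have "\<not> col (b \<otimes> a) \<subseteq> Q1"
    proof
      assume "col (b \<otimes> a) \<subseteq> Q1"
      then have "col (b \<otimes> a) \<in> ?F" using a(1) b by blast
      then have "col (b \<otimes> a) = col a" using max up[OF b] by blast
      then show False using c by simp
    qed
    then obtain e where e: "e \<in> col (b \<otimes> a)" "e \<notin> Q1" by blast
    then have "e \<in> carrier R" by (simp add: col_def)
    then show ?thesis using swap[OF b] e by blast
  qed
  have "primeideal (col a) R"
  proof (rule primeidealI)
    show "ideal (col a) R" using colI[OF a(1)] left_ideal_iff_ideal by blast
    show "carrier R \<noteq> col a" using a(2) primeideal.I_notcarr[OF Q1] left_idealD(1)[OF Q1I] by auto
    fix b c assume bc: "b \<in> carrier R" "c \<in> carrier R" "b \<otimes> c \<in> col a"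
    show "b \<in> col a \<or> c \<in> col a"
    proof (rule ccontr)
      assume not: "\<not> (b \<in> col a \<or> c \<in> col a)"
      have "c \<in> col (b \<otimes> a)" using swap[OF bc(1,2)] bc(3) m_comm[OF bc(1,2)] by simp
      then obtain e where e: "e \<in> carrier R" "e \<notin> Q1" "e \<otimes> b \<in> col a" using esc bc(1) not by blast
      have "b \<in> col (e \<otimes> a)" using swap[OF e(1) bc(1)] e(3) m_comm[OF e(1) bc(1)] by simp
      then obtain f where f: "f \<in> carrier R" "f \<notin> Q1" "f \<otimes> e \<in> col a" using esc e(1) not by blast
      then show False using primeideal.I_prime[OF Q1 f(1) e(1)] a(2) e(2) by blast
    qed
  qed (rule is_cring)
  then show thesis using that[OF a(1) _ a(2)] by (simp add: col_def)
qed

text \<open>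
  Let \<open>Q = (xR : a)\<close>. In the fraction field of \<open>R\<close> the cyclic \<open>S\<close>-module generated by \<open>a/x\<close>
  is an essential extension of the simple module \<open>R\<close>, and its quotient by \<open>R\<close> is \<open>S/SQ\<close>.
  No fractions are formed: \<open>1/x\<close> is represented by the generator of \<open>S/sat (S\<theta>x)\<close>.
\<close>

context
  fixes a x Q
  assumes simple: "delta_simple R \<delta>"
    and a: "a \<in> carrier R" and x: "x \<in> carrier R" "x \<noteq> \<zero>"
    and Q: "primeideal Q R" "Q = {b \<in> carrier R. \<exists>s\<in>carrier R. b \<otimes> a = s \<otimes> x}"
begin

text \<open>\<open>V\<close> stands for the annihilator of \<open>1/x\<close>: the operator
  \<open>\<theta>x\<close> kills it since \<open>\<delta>(1) = 0\<close>, and saturation accounts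
  for denominators. Accordingly \<open>Ann\<close> is the annihilator of \<open>a/x\<close>, and
  \<open>Num\<close> consists of the operators that send \<open>a/x\<close> into
  \<open>R\<close>.\<close>

definition V :: "(nat \<Rightarrow> 'a) set" where "V = sat (principal_left S (X \<star> C x))"

definition Ann :: "(nat \<Rightarrow> 'a) set" where "Ann = {s \<in> carrier S. s \<star> C a \<in> V}"

definition Num :: "(nat \<Rightarrow> 'a) set" where
  "Num = {s \<in> carrier S. \<exists>r\<in>carrier R. s \<star> C a \<boxminus> C (r \<otimes> x) \<in> V}"

lemma Xx_ideal: "left_ideal S (principal_left S (X \<star> C x))"
  by (rule S.left_ideal_right_mult[OF S.left_ideal_carrier]) (use x in simp)

lemma V_ideal: "left_ideal S V"
  unfolding V_def by (rule left_ideal_sat[OF Xx_ideal])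

lemmas VD = left_idealD[OF V_ideal]

lemma Xx_V: "X \<star> C x \<in> V"
proof -
  have "X \<star> C x \<in> (principal_left S (X \<star> C x))"
    using x by (intro image_eqI[of _ _ "\<one>\<^bsub>S\<^esub>"]) auto
  then show ?thesis unfolding V_def sat_def using x by (auto intro!: bexI[of _ \<one>] simp: C_one)
qed

text \<open>A non-zero multiple of \<open>\<theta>x\<close> has order at least one, so
  \<open>V\<close> contains no non-zero constant.\<close>

lemma C_V: "c \<in> carrier R \<Longrightarrow> C c \<in> V \<Longrightarrow> c = \<zero>"
proof -
  assume c: "c \<in> carrier R" "C c \<in> V"
  then obtain e s where e: "e \<in> carrier R" "e \<noteq> \<zero>" and s: "s \<in> carrier S"
    "C e \<star> C c = s \<star> (X \<star> C x)" unfolding V_def sat_def by blast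
  let ?y = "X \<star> C x"
  have y: "?y \<in> U (Suc 1)" "?y 1 = x"
    using X_mult_U[OF C_U[OF x(1)]] x(1) by (simp_all add: cf_X_mult cf_C)
  have "s = \<zero>\<^bsub>S\<^esub>"
  proof (rule ccontr)
    assume "s \<noteq> \<zero>\<^bsub>S\<^esub>"
    then obtain d where d: "s \<in> U (Suc d)" "s d \<noteq> \<zero>" using top_exists[OF s(1)] by blast
    have "(s \<star> ?y) (d + 1) = s d \<otimes> x" using mult_top(2)[OF d(1) y(1)] y(2) by simp
    moreover have "(C e \<star> C c) (d + 1) = \<zero>" using e c by (simp add: cf_C_mult cf_C)
    ultimately show False using s d(2) x by (simp add: integral_iff)
  qed
  then have "C (e \<otimes> c) = \<zero>\<^bsub>S\<^esub>" using s(2) e c x by (simp add: C_mult)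
  then show "c = \<zero>" using C_eq_zero_iff e c by (simp add: integral_iff)
qed

lemma Ann_ideal: "left_ideal S Ann"
  unfolding Ann_def by (rule S.left_ideal_colon[OF V_ideal]) (use a in simp)

text \<open>The relation \<open>s \<star> C a \<boxminus> C (r \<otimes> x) \<in> V\<close>
  expresses \<open>s(a/x) = r\<close>. Since \<open>\<theta>x \<in> V\<close>, applying
  \<open>\<theta>\<close> to both sides turns \<open>r\<close> into
  \<open>\<delta>(r)\<close>.\<close>

lemma num_rel_X:
  assumes s: "s \<in> carrier S" and r: "r \<in> carrier R" and rel: "s \<star> C a \<boxminus> C (r \<otimes> x) \<in> V"
  shows "(X \<star> s) \<star> C a \<boxminus> C (\<delta> r \<otimes> x) \<in> V"
proof -
  have Xrx: "X \<star> C (r \<otimes> x) = C r \<star> (X \<star> C x) \<boxplus> C (\<delta> r \<otimes> x)"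
    using r x X_C[OF r] by (simp add: C_mult S.m_assoc[symmetric] S.l_distr)
  have "(X \<star> s) \<star> C a \<boxminus> C (\<delta> r \<otimes> x) =
      X \<star> (s \<star> C a \<boxminus> C (r \<otimes> x)) \<boxplus> C r \<star> (X \<star> C x)"
  proof -
    have shift: "u \<boxminus> w = (u \<boxminus> (v \<boxplus> w)) \<boxplus> v"
      if "u \<in> carrier S" "v \<in> carrier S" "w \<in> carrier S" for u v w
      using that by (simp add: S.minus_eq S.minus_add S.a_ac S.r_neg S.r_neg1 S.r_neg2)
    have "X \<star> (s \<star> C a \<boxminus> C (r \<otimes> x)) = (X \<star> s) \<star> C a \<boxminus> X \<star> C (r \<otimes> x)"
      using s r x a by (simp add: S.minus_eq S.r_distr S.r_minus S.m_assoc)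
    then show ?thesis unfolding Xrx by (simp only:) (rule shift, use s r x a in simp_all)
  qed
  also have "\<dots> \<in> V" using VD(4)[OF VD(5)[OF X_closed rel] VD(5)[OF _ Xx_V]] r by simp
  finally show ?thesis .
qed

lemma num_rel_C:
  assumes s: "s \<in> carrier S" and r: "r \<in> carrier R" and rel: "s \<star> C a \<boxminus> C (r \<otimes> x) \<in> V"
    and b: "b \<in> carrier R"
  shows "(C b \<star> s) \<star> C a \<boxminus> C ((b \<otimes> r) \<otimes> x) \<in> V"
proof -
  have "(C b \<star> s) \<star> C a \<boxminus> C ((b \<otimes> r) \<otimes> x) = C b \<star> (s \<star> C a \<boxminus> C (r \<otimes> x))"
    using s r b x a by (simp add: S.minus_eq S.r_distr S.r_minus S.m_assoc C_mult)
  then show ?thesis using VD(5)[OF _ rel] b by simp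
qed

lemma num_rel_add:
  assumes s: "s \<in> carrier S" "s' \<in> carrier S" and r: "r \<in> carrier R" "r' \<in> carrier R"
    and rel: "s \<star> C a \<boxminus> C (r \<otimes> x) \<in> V" "s' \<star> C a \<boxminus> C (r' \<otimes> x) \<in> V"
  shows "(s \<boxplus> s') \<star> C a \<boxminus> C ((r \<oplus> r') \<otimes> x) \<in> V"
proof -
  have "(s \<boxplus> s') \<star> C a \<boxminus> C ((r \<oplus> r') \<otimes> x) =
      (s \<star> C a \<boxminus> C (r \<otimes> x)) \<boxplus> (s' \<star> C a \<boxminus> C (r' \<otimes> x))"
    using s r x a by (simp add: l_distr C_add S.minus_eq S.minus_add S.l_distr S.a_ac)
  then show ?thesis using VD(4)[OF rel] by simp
qed

lemma Num_ideal: "left_ideal S Num"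
proof (rule left_ideal_SI)
  show "\<zero>\<^bsub>S\<^esub> \<in> Num"
    using VD(3) a x by (auto simp: Num_def S.minus_eq intro!: bexI[of _ \<zero>])
  show "p \<boxplus> q \<in> Num" if "p \<in> Num" "q \<in> Num" for p q
    using that num_rel_add unfolding Num_def by (auto intro!: bexI[of _ "_ \<oplus> _"])
  show "C b \<star> p \<in> Num" if "b \<in> carrier R" "p \<in> Num" for b p
    using that num_rel_C unfolding Num_def by (auto intro!: bexI[of _ "_ \<otimes> _"])
  show "X \<star> p \<in> Num" if "p \<in> Num" for p
    using that num_rel_X unfolding Num_def by (auto intro!: bexI[of _ "\<delta> _"])
qed (auto simp: Num_def)

lemma cst_Num: "cst Num = Q"
proof
  show "cst Num \<subseteq> Q"
  proof
    fix b assume "b \<in> cst Num"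
    then obtain r where b: "b \<in> carrier R" and r: "r \<in> carrier R" "C b \<star> C a \<boxminus> C (r \<otimes> x) \<in> V"
      by (auto simp: cst_def Num_def)
    have "C (b \<otimes> a \<ominus> r \<otimes> x) \<in> V" using r b a x by (simp add: C_minus C_mult)
    then have "b \<otimes> a \<ominus> r \<otimes> x = \<zero>" using C_V b a r x by simp
    then have "b \<otimes> a = r \<otimes> x" using b a r x by simp
    then show "b \<in> Q" using b r unfolding Q(2) by blast
  qed
  show "Q \<subseteq> cst Num"
  proof
    fix b assume "b \<in> Q"
    then obtain r where b: "b \<in> carrier R" and r: "r \<in> carrier R" "b \<otimes> a = r \<otimes> x" unfolding Q(2) by blast
    have "C b \<star> C a \<boxminus> C (r \<otimes> x) = C (b \<otimes> a) \<boxminus> C (b \<otimes> a)"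
      unfolding r(2) using b a by (simp add: C_mult[symmetric] r(2))
    also have "\<dots> = \<zero>\<^bsub>S\<^esub>" using b a by (simp add: S.minus_eq S.r_neg)
    finally show "b \<in> cst Num" using b r(1) VD(3) unfolding cst_def Num_def by (auto intro!: bexI[of _ r])
  qed
qed

lemma x_Q: "x \<in> Q"
  unfolding Q(2) using x(1) a by (auto simp: m_comm[of x])

lemma Q_ideal: "left_ideal R Q"
  using primeideal.axioms(1)[OF Q(1)] left_ideal_iff_ideal by blast

text \<open>\<open>Q\<close> contains \<open>x \<noteq> 0\<close> and is proper, so it is not a
  \<open>\<delta>\<close>-ideal in the \<open>\<delta>\<close>-simple ring \<open>R\<close>, and its
  contraction determines \<open>Num\<close>.\<close>

lemma Num_eq: "Num = W Q"
proof (rule left_ideal_eq_W[OF char0 Q(1) _ Num_ideal cst_Num])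
  show "\<not> \<delta> ` Q \<subseteq> Q"
  proof
    assume "\<delta> ` Q \<subseteq> Q"
    then have "Q = {\<zero>} \<or> Q = carrier R"
      using simple delta_idealI[OF Q_ideal] unfolding delta_simple_def by blast
    then show False using x_Q x(2) primeideal.I_notcarr[OF Q(1)] by auto
  qed
qed

text \<open>The map sending \<open>s\<close> to \<open>s(a/x)\<close> embeds \<open>Num/Ann\<close>
  into \<open>R\<close>, whose \<open>\<delta>\<close>-ideals are trivial. Essentiality means
  clearing denominators: any \<open>h\<close> is carried into \<open>Num\<close> by some non-zero
  \<open>c \<in> R\<close>, and \<open>c h\<close> stays outside \<open>Ann\<close> because
  \<open>V\<close> is saturated.\<close>

lemma essential_Ann_Num: "essential_simple_pair S Ann Num"
  unfolding essential_simple_pair_def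
proof (intro conjI allI impI Ann_ideal Num_ideal)
  have a0: "a \<noteq> \<zero>"
  proof
    assume "a = \<zero>"
    then have "\<one> \<in> Q" unfolding Q(2) using x by (auto intro!: bexI[of _ \<zero>])
    then show False using left_ideal_one[OF Q_ideal] primeideal.I_notcarr[OF Q(1)] by blast
  qed
  have xNum: "C x \<in> Num" using x_Q cst_Num by (auto simp: cst_def)
  have rel0: "s \<in> Ann" if "s \<in> carrier S" "s \<star> C a \<boxminus> C (\<zero> \<otimes> x) \<in> V" for s
    using that a x by (simp add: Ann_def S.minus_eq)
  show "Ann \<subset> Num"
  proof
    have "s \<star> C a \<boxminus> C (\<zero> \<otimes> x) \<in> V" if "s \<in> Ann" for s
      using that a x by (simp add: Ann_def S.minus_eq)
    then show "Ann \<subseteq> Num" unfolding Num_def using left_idealD(1)[OF Ann_ideal] by blast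
    show "Ann \<noteq> Num"
    proof
      assume "Ann = Num"
      then have "C (x \<otimes> a) \<in> V" using xNum x a by (auto simp: Ann_def C_mult)
      then show False using C_V[of "x \<otimes> a"] x a a0 by (simp add: integral_iff)
    qed
  qed
  fix H
  {
    assume "left_ideal S H \<and> Ann \<subseteq> H \<and> H \<subseteq> Num"
    then have H: "left_ideal S H" "Ann \<subseteq> H" "H \<subseteq> Num" by auto
    note D = left_idealD[OF H(1)]
    show "H = Ann \<or> H = Num"
    proof (cases "H = Ann")
      case False
      then obtain s where s: "s \<in> H" "s \<notin> Ann" using H(2) by blast
      \<comment> \<open>The values in \<open>R\<close> taken on \<open>a/x\<close> by elements of
        \<open>H\<close>. They form a \<open>\<delta>\<close>-ideal, non-zero when \<open>H\<close>
        exceeds \<open>Ann\<close>.\<close>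
      let ?I = "{r \<in> carrier R. \<exists>s\<in>H. s \<star> C a \<boxminus> C (r \<otimes> x) \<in> V}"
      have I: "left_ideal R ?I"
      proof (rule left_idealI)
        show "\<zero> \<in> ?I" using D(3) VD(3) a x by (auto intro!: bexI[of _ "\<zero>\<^bsub>S\<^esub>"] simp: S.minus_eq)
        show "r \<oplus> r' \<in> ?I" if rr: "r \<in> ?I" "r' \<in> ?I" for r r'
        proof -
          obtain t t' where t: "t \<in> H" "t \<star> C a \<boxminus> C (r \<otimes> x) \<in> V"
            "t' \<in> H" "t' \<star> C a \<boxminus> C (r' \<otimes> x) \<in> V" using rr by blast
          show ?thesis
            using num_rel_add[OF D(2)[OF t(1)] D(2)[OF t(3)] _ _ t(2,4)] D(4)[OF t(1,3)] rr by blast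
        qed
        show "b \<otimes> r \<in> ?I" if b: "b \<in> carrier R" "r \<in> ?I" for b r
        proof -
          obtain t where t: "t \<in> H" "t \<star> C a \<boxminus> C (r \<otimes> x) \<in> V" using b(2) by blast
          show ?thesis
            using num_rel_C[OF D(2)[OF t(1)] _ t(2) b(1)] D(5)[OF C_closed[OF b(1)] t(1)] b by blast
        qed
      qed blast
      have "delta_ideal R \<delta> ?I"
      proof (rule delta_idealI[OF I])
        fix r assume r: "r \<in> ?I"
        then obtain t where t: "t \<in> H" "t \<star> C a \<boxminus> C (r \<otimes> x) \<in> V" by blast
        then show "\<delta> r \<in> ?I"
          using num_rel_X[OF D(2)[OF t(1)] _ t(2)] D(5)[OF X_closed t(1)] r by blast
      qed
      moreover have "?I \<noteq> {\<zero>}"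
      proof
        assume I0: "?I = {\<zero>}"
        obtain r where r: "r \<in> carrier R" "s \<star> C a \<boxminus> C (r \<otimes> x) \<in> V"
          using s(1) H(3) unfolding Num_def by blast
        then have "r \<in> ?I" using s(1) by blast
        then have "r = \<zero>" using I0 by blast
        then show False using rel0[OF D(2)[OF s(1)]] r(2) s(2) by blast
      qed
      ultimately have "?I = carrier R" using simple unfolding delta_simple_def by blast
      have "n \<in> H" if n: "n \<in> Num" for n
      proof -
        obtain r where r: "n \<in> carrier S" "r \<in> carrier R" "n \<star> C a \<boxminus> C (r \<otimes> x) \<in> V"
          using n unfolding Num_def by blast
        then have "r \<in> ?I" using \<open>?I = carrier R\<close> by blast
        then obtain h where h: "h \<in> H" "h \<star> C a \<boxminus> C (r \<otimes> x) \<in> V" by blast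
        have hc: "h \<in> carrier S" by (rule D(2)[OF h(1)])
        have diff: "(u \<boxminus> w) \<boxminus> (v \<boxminus> w) = u \<boxminus> v"
          if "u \<in> carrier S" "v \<in> carrier S" "w \<in> carrier S" for u v w
          using that by (simp add: S.minus_eq S.minus_add S.a_assoc S.a_comm[of "\<ominus>\<^bsub>S\<^esub> v" w] S.r_neg1 S.r_neg2)
        have "(n \<boxminus> h) \<star> C a =
            (n \<star> C a \<boxminus> C (r \<otimes> x)) \<boxminus> (h \<star> C a \<boxminus> C (r \<otimes> x))"
          using diff[of "n \<star> C a" "h \<star> C a" "C (r \<otimes> x)"] r(1,2) hc a x
          by (simp add: S.minus_eq S.l_distr S.l_minus)
        then have "n \<boxminus> h \<in> Ann"
          using S.left_ideal_minus[OF V_ideal r(3) h(2)] r(1) hc by (simp add: Ann_def)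
        then show ?thesis using S.left_ideal_diff_cancel[OF H(1) r(1) h(1)] H(2) by blast
      qed
      then show ?thesis using H(3) by blast
    qed simp
  next
    assume H: "left_ideal S H \<and> Ann \<subset> H"
    then obtain h where h: "h \<in> H" "h \<notin> Ann" by blast
    have HI: "left_ideal S H" using H by blast
    have hc: "h \<in> carrier S" by (rule left_idealD(2)[OF HI h(1)])
    have "h \<in> sat Num" using sat_carrier[OF Num_ideal x xNum] hc by simp
    then obtain c where c: "c \<in> carrier R" "c \<noteq> \<zero>" "C c \<star> h \<in> Num" by (auto simp: sat_def)
    have "C c \<star> h \<notin> Ann"
    proof
      assume "C c \<star> h \<in> Ann"
      then have "C c \<star> (h \<star> C a) \<in> V" using c(1) hc a by (simp add: Ann_def S.m_assoc)
      then have "h \<star> C a \<in> V" unfolding V_def using sat_mult[OF c(1,2)] hc a by simp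
      then show False using h(2) hc by (simp add: Ann_def)
    qed
    moreover have "C c \<star> h \<in> H" using left_idealD(5)[OF HI _ h(1)] c(1) by simp
    ultimately show "H \<inter> Num \<noteq> Ann" using c(3) by blast
  }
qed

text \<open>The chain is \<open>SQ + S y^n\<close>. If it became stable, its contraction to
  \<open>R\<close> would give \<open>y^n (1 - t y) \<in> Q\<close>, hence
  \<open>1 - t y \<in> Q \<subseteq> M\<close> and \<open>1 \<in> M\<close>.\<close>

lemma not_dcc_above_Ann:
  assumes M: "left_ideal R M" "\<one> \<notin> M" "Q \<subseteq> M" and y: "y \<in> M" "y \<notin> Q"
  shows "\<not> dcc_above S Ann"
proof
  assume dcc: "dcc_above S Ann"
  have yc: "y \<in> carrier R" by (rule left_idealD(2)[OF M(1) y(1)])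
  let ?y = "\<lambda>n::nat. y [^] n"
  define H where "H n = ideal_plus S Num (principal_left S (C (?y n)))" for n
  have Cy: "C (?y n) \<in> carrier S" for n using yc by simp
  have right: "left_ideal S (principal_left S (C (?y n)))" for n
    by (rule S.left_ideal_right_mult[OF S.left_ideal_carrier Cy])
  have "left_ideal S (H n)" for n unfolding H_def by (rule S.left_ideal_sum[OF Num_ideal right])
  moreover have "Ann \<subseteq> Num" using essential_Ann_Num by (simp add: essential_simple_pair_def psubset_eq)
  then have "Ann \<subseteq> H n" for n
    unfolding H_def by (rule subset_trans[OF _ S.left_ideal_sum_upper(1)[OF Num_ideal right]])
  moreover have "H (Suc n) \<subseteq> H n" for n
  proof
    fix p assume "p \<in> H (Suc n)"
    then obtain h s where p: "p \<in> carrier S" "h \<in> Num" "s \<in> carrier S" "p = h \<boxplus> s \<star> C (?y (Suc n))"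
      unfolding H_def by blast
    have "C (?y (Suc n)) = C y \<star> C (?y n)" using yc by (simp add: C_mult[symmetric] m_comm)
    then have "p = h \<boxplus> (s \<star> C y) \<star> C (?y n)" using p(3,4) yc by (simp add: S.m_assoc)
    moreover have "s \<star> C y \<in> carrier S" using p(3) yc by simp
    ultimately show "p \<in> H n" unfolding H_def using p(1,2) by blast
  qed
  ultimately have "\<exists>n. \<forall>m\<ge>n. H m = H n"
    by (intro dcc[unfolded dcc_above_def, rule_format]) blast
  then obtain n where n: "H (Suc n) = H n" by (meson le_SucI order_refl)
  have "C (?y n) \<in> principal_left S (C (?y n))"
    using Cy by (intro image_eqI[of _ _ "\<one>\<^bsub>S\<^esub>"]) auto
  then have "C (?y n) \<in> H n"
    unfolding H_def by (rule subsetD[OF S.left_ideal_sum_upper(2)[OF Num_ideal right]])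
  then have "C (?y n) \<in> H (Suc n)" using n by simp
  then obtain h s where hs: "h \<in> Num" "s \<in> carrier S" "C (?y n) = h \<boxplus> s \<star> C (?y (Suc n))"
    unfolding H_def by blast
  let ?yR = "principal_left R (?y (Suc n))"
  let ?J = "ideal_plus R Q ?yR"
  have yR: "left_ideal R ?yR" by (rule left_ideal_right_mult[OF left_ideal_carrier]) (use yc in simp)
  have J: "left_ideal R ?J" by (rule left_ideal_sum[OF Q_ideal yR])
  \<comment> \<open>The equation is brought back to \<open>R\<close>: both summands lie in
    \<open>SJ\<close> for \<open>J = Q + y^(n+1) R\<close>, and \<open>SJ\<close> contracts to
    \<open>J\<close>.\<close>
  have "h \<in> W ?J"
    using hs(1) W_mono[OF left_ideal_sum_upper(1)[OF Q_ideal yR]] unfolding Num_eq by blast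
  moreover have "?y (Suc n) \<in> ?yR" using yc by (intro image_eqI[of _ _ \<one>]) auto
  then have "?y (Suc n) \<in> ?J" by (rule subsetD[OF left_ideal_sum_upper(2)[OF Q_ideal yR]])
  then have "s \<star> C (?y (Suc n)) \<in> W ?J" by (intro left_idealD(5)[OF W_left_ideal[OF J] hs(2)] W_C[OF J])
  ultimately have "C (?y n) \<in> W ?J" unfolding hs(3) by (rule left_idealD(4)[OF W_left_ideal[OF J]])
  then have "?y n \<in> cst (W ?J)" using yc by (simp add: cst_def)
  then have "?y n \<in> ?J" unfolding cst_W[OF J] .
  then obtain q t where qt: "q \<in> Q" "t \<in> carrier R" "?y n = q \<oplus> t \<otimes> ?y (Suc n)" by blast
  have qc: "q \<in> carrier R" by (rule left_idealD(2)[OF Q_ideal qt(1)])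
  have ync: "?y n \<in> carrier R" using yc by simp
  have "?y n \<otimes> (\<one> \<ominus> t \<otimes> y) = ?y n \<ominus> t \<otimes> ?y (Suc n)"
    using yc ync qt(2) by (simp add: minus_eq r_distr r_minus m_ac)
  also have "\<dots> = (q \<oplus> t \<otimes> ?y (Suc n)) \<ominus> t \<otimes> ?y (Suc n)" using qt(3) by simp
  also have "\<dots> = q" using qc qt(2) yc by (simp add: minus_eq a_assoc r_neg del: nat_pow_Suc)
  finally have "?y n \<otimes> (\<one> \<ominus> t \<otimes> y) \<in> Q" using qt(1) by simp
  moreover have "?y k \<notin> Q" for k :: nat
  proof (induction k)
    case 0
    then show ?case using M(2,3) by auto
  next
    case (Suc k)
    then show ?case using primeideal.I_prime[OF Q(1), of "?y k" y] yc y(2) by auto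
  qed
  ultimately have "\<one> \<ominus> t \<otimes> y \<in> Q" using primeideal.I_prime[OF Q(1) ync, of "\<one> \<ominus> t \<otimes> y"] yc qt(2) by auto
  then have "\<one> \<ominus> t \<otimes> y \<in> M" using M(3) by blast
  then have "\<one> \<in> M" using left_ideal_diff_cancel[OF M(1) one_closed left_idealD(5)[OF M(1) qt(2) y(1)]] by blast
  then show False using M(2) by blast
qed

end

theorem diamond_imp_dim_le_1:
  assumes noeth: "left_noetherian R" and dia: "diamond S" and simple: "delta_simple R \<delta>"
  shows "krull_dim R \<le> 1"
proof (rule ccontr)
  assume "\<not> krull_dim R \<le> 1"
  then obtain Q1 M where Q1: "primeideal Q1 R" "Q1 \<noteq> {\<zero>}" and M: "primeideal M R" "Q1 \<subset> M"
    using krull_dim_gt_1_primes by metis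
  have Q1I: "left_ideal R Q1" using primeideal.axioms(1)[OF Q1(1)] left_ideal_iff_ideal by blast
  have MI: "left_ideal R M" using primeideal.axioms(1)[OF M(1)] left_ideal_iff_ideal by blast
  have M1: "\<one> \<notin> M" using left_ideal_one[OF MI] primeideal.I_notcarr[OF M(1)] by auto
  obtain x where x: "x \<in> Q1" "x \<noteq> \<zero>" using Q1(2) left_idealD(3)[OF Q1I] by blast
  have xc: "x \<in> carrier R" by (rule left_idealD(2)[OF Q1I x(1)])
  obtain a Q where Q: "a \<in> carrier R" "primeideal Q R" "Q \<subseteq> Q1"
    "Q = {b \<in> carrier R. \<exists>s\<in>carrier R. b \<otimes> a = s \<otimes> x}"
    by (rule associated_prime_below[OF noeth Q1(1) x(1)]) (rule that; assumption)
  obtain y where y: "y \<in> M" "y \<notin> Q" using M(2) Q(3) by blast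
  have "dcc_above S (Ann a x)"
    by (rule diamond_imp_dcc_above[OF dia essential_Ann_Num[OF simple Q(1) xc x(2) Q(2,4)]])
  moreover have "\<not> dcc_above S (Ann a x)"
    by (rule not_dcc_above_Ann[OF simple Q(1) xc x(2) Q(2,4) MI M1 _ y]) (use Q(3) M(2) in blast)
  ultimately show False by blast
qed

end

theorem corollary3p4:
  fixes K :: "('k, 'a) ring_scheme" and R :: "('k, 'r, 'b) module_scheme" and \<delta> :: "'r \<Rightarrow> 'r"
  assumes "field K"
    and "\<And>n::nat. n > 0 \<Longrightarrow> [n] \<cdot>\<^bsub>K\<^esub> \<one>\<^bsub>K\<^esub> \<noteq> \<zero>\<^bsub>K\<^esub>"
    and "affine_algebra K R"
    and "domain R"
    and "derivation R \<delta>"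
    and "\<exists>a\<in>carrier R. \<delta> a \<noteq> \<zero>\<^bsub>R\<^esub>"
  shows "(primitive_ring (diff_op_ring R \<delta>) \<longleftrightarrow> delta_primitive R \<delta>) \<and>
    (primitive_ring (diff_op_ring R \<delta>) \<longrightarrow>
      (diamond (diff_op_ring R \<delta>) \<longleftrightarrow> delta_simple R \<delta> \<and> krull_dim R \<le> 1))"
proof -
  interpret domain R by fact
  interpret char_zero_derivation R \<delta>
  proof (intro char_zero_derivation.intro domain_derivation.intro derivation_ring.intro
      derivation_ring_axioms.intro char_zero_derivation_axioms.intro ring_axioms domain_axioms assms(5,6))
    show "[n] \<cdot>\<^bsub>R\<^esub> \<one>\<^bsub>R\<^esub> \<in> Units R" if "n > 0" for n :: nat
      by (rule affine_char_zero_Units[OF assms(1,3) assms(2)[OF that]])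
  qed
  \<comment> \<open>\<open>K\<close> enters through three facts about \<open>R\<close>: positive
    integers are units, ideals satisfy the ascending chain condition, and the Jacobson radical is
    zero.\<close>
  note noeth = affine_domain(1)[OF assms(1,3,4)] and jac = affine_domain(2)[OF assms(1,3,4)]
  show ?thesis
    using delta_primitive_imp_primitive primitive_imp_delta_primitive[OF noeth jac]
      diamond_imp_delta_simple[OF noeth] diamond_imp_dim_le_1[OF noeth] diamond_of_dim_le_1[OF noeth]
    by blast
qed

end
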